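(* Let $X$ and $X'$ be connected nodal curves free from separating nodes, over an algebraically closed field. Then $X$ and $X'$ are T-equivalent if and only if they are C1-equivalent.
   Context: A node $n$ of a nodal curve $Y$ is separating if $Y\smallsetminus n$ has more connected components than $Y$. $\nu:X^\nu=\coprod_{i=1}^\gamma C_i\to X$ is the normalization (the $C_i$ connected); for $S\subset X_{\rm sing}$, $Y_S$ is the partial normalization of $X$ at $S$. $\Gamma_X$ is the dual graph (vertices: irreducible components; edges: nodes). **C1-equivalence.** Let $X$ be connected without separating nodes. For $S\subset X_{\rm sing}$ let $\Gamma_X(S)$ be obtained from $\Gamma_X$ by contracting every edge not in $S$. $S$ is a C1-set if $Y_S$ has no separating node and $\Gamma_X(S)$ is a cycle (connected, $h$ edges and $h$ vertices, each of valency 2, for some $h\ge1$). The C1-sets partition $X_{\rm sing}$; two distinct nodes lie in the same C1-set iff the normalization of $X$ at both is disconnected. ${\rm Set}^1X$ is the set of C1-sets. $X$ and $X'$ are C1-equivalent if there are an isomorphism $\phi:X^\nu\to X'^\nu$ and a bijection ${\rm Set}^1X\to{\rm Set}^1X'$, $S\mapsto S'$, with $\phi(\nu^{-1}(S))=\nu'^{-1}(S')$ for all $S$, where $\nu'$ is the normalization of $X'$. **Cyclic equivalence.** Graphs $\Gamma,\Gamma'$ are cyclically equivalent, $\Gamma\equiv_{\rm cyc}\Gamma'$, if there is a bijection $\epsilon:E(\Gamma)\to E(\Gamma')$ (a cyclic bijection) inducing a bijection between the cycles of $\Gamma$ and the cycles of $\Gamma'$. Equivalently, for any orientation on $\Gamma$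 there is an orientation on $\Gamma'$ such that the linear isomorphism $\epsilon_C:C_1(\Gamma,\mathbb Z)\to C_1(\Gamma',\mathbb Z)$ induced by $\epsilon$ restricts to an isomorphism $\epsilon_H:H_1(\Gamma,\mathbb Z)\to H_1(\Gamma',\mathbb Z)$. **The map $\eta_X$.** Fix an orientation of $\Gamma_X$. For an edge $e$, let $s_e,t_e\in X^\nu$ be the two points over the node $e$ corresponding to the source and the target of $e$. The map $C_1(\Gamma_X,\mathbb Z)\to{\rm Div}^0X^\nu$, $e\mapsto t_e-s_e$, restricts to $\eta_X:H_1(\Gamma_X,\mathbb Z)\to{\rm Div}^{\underline0}X^\nu=\prod_{i=1}^\gamma{\rm Div}^0C_i$ (divisors of degree $0$ on every component). The group $K_\gamma=(\mathbb Z/2\mathbb Z)^\gamma$ acts on ${\rm Div}^{\underline0}X^\nu$ by multiplication by $\pm1$ on each factor ${\rm Div}^0C_i$. **T-equivalence.** Connected nodal curves $X,X'$ are T-equivalent if: (a) there is an isomorphism $\phi:X^\nu\to X'^\nu$; (b) $\Gamma_X\equiv_{\rm cyc}\Gamma_{X'}$, via a cyclic bijection $\epsilon$; (c) for every orientation on $\Gamma_X$ there exist an orientation on $\Gamma_{X'}$ and $\alpha\in K_\gamma$ such that $\eta_{X'}\circ\epsilon_H=\phi_D\circ\alpha\circ\eta_X$, where $\epsilon_H:H_1(\Gamma_X,\mathbb Z)\to H_1(\Gamma_{X'},\mathbb Z)$ is the isomorphism obtained by restricting to $H_1(\Gamma_X,\mathbb Z)$ the linear isomorphism $\epsilon_C:C_1(\Gamma_X,\mathbb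 Z)\to C_1(\Gamma_{X'},\mathbb Z)$ induced by $\epsilon$ with respect to these orientations (the orientation on $\Gamma_{X'}$ being such that $\epsilon_C$ maps $H_1(\Gamma_X,\mathbb Z)$ onto $H_1(\Gamma_{X'},\mathbb Z)$), and $\phi_D:{\rm Div}^{\underline0}X^\nu\to{\rm Div}^{\underline0}X'^\nu$ is induced by $\phi$. *)

theory Defs
  imports "HOL-Analysis.Analysis" "HOL-Computational_Algebra.Polynomial" "HOL-Library.Poly_Mapping"
    "HOL-Library.Multiset"
begin

section \<open>Classical projective varieties\<close>

text \<open>
  Reduced projective schemes over an algebraically closed field are treated classically, as
  Zariski closed subsets of projective space together with their regular functions: a point is a
  closed point, and the sheaf of regular functions is given by its stalks. Thus
  \<open>f \<in> regular_at X p\<close> means that the restriction of \<open>f\<close> to some open neighbourhood of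
  \<open>p\<close> is regular; the values of \<open>f\<close> elsewhere are irrelevant.
\<close>

record ('p, 'k) variety =
  zariski :: "'p topology"
  regular_at :: "'p \<Rightarrow> ('p \<Rightarrow> 'k) set"

abbreviation points :: "('p, 'k, 'z) variety_scheme \<Rightarrow> 'p set" where
  "points X \<equiv> topspace (zariski X)"

text \<open>A point of projective \<open>n\<close>-space is the set of all its homogeneous coordinate vectors
  \<open>(v\<^sub>0, \<dots>, v\<^sub>n)\<close>, extended by zero.\<close>

type_synonym 'k proj_point = "(nat \<Rightarrow> 'k) set"

definition proj_points :: "nat \<Rightarrow> 'k::field proj_point set" where
  "proj_points n = {{w. \<exists>c. c \<noteq> 0 \<and> w = (\<lambda>i. c * v i)} | v. (\<exists>i. v i \<noteq> 0) \<and> (\<forall>i>n. v i = 0)}"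

text \<open>Homogeneous polynomial functions of degree \<open>d\<close> in \<open>v\<^sub>0, \<dots>, v\<^sub>n\<close>.\<close>

definition forms :: "nat \<Rightarrow> nat \<Rightarrow> ((nat \<Rightarrow> 'k::field) \<Rightarrow> 'k) set" where
  "forms n d = {F. \<exists>c. F = (\<lambda>v. \<Sum>a \<in> {a \<in> {..n} \<rightarrow>\<^sub>E {..d}. (\<Sum>i\<le>n. a i) = d}. c a * (\<Prod>i\<le>n. v i ^ a i))}"

text \<open>The generating sets are the basic open sets, which are closed under binary intersection; the
  closed sets are therefore exactly the common zero loci of sets of forms.\<close>

definition proj_zariski :: "nat \<Rightarrow> 'k::field proj_point topology" where
  "proj_zariski n =
     topology_generated_by {{x \<in> proj_points n. \<forall>v\<in>x. F v \<noteq> 0} | F d. F \<in> forms n d}"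

definition closed_subvariety ::
    "nat \<Rightarrow> 'k::field proj_point set \<Rightarrow> ('k proj_point, 'k) variety" where
  "closed_subvariety n Z =
     \<lparr> zariski = subtopology (proj_zariski n) Z,
       regular_at = (\<lambda>x. {f. \<exists>V d F G. openin (subtopology (proj_zariski n) Z) V \<and> x \<in> V \<and>
          F \<in> forms n d \<and> G \<in> forms n d \<and> (\<forall>y\<in>V. \<forall>v\<in>y. G v \<noteq> 0 \<and> f y = F v / G v)}) \<rparr>"

definition projective_variety :: "('k::field proj_point, 'k) variety \<Rightarrow> bool" where
  "projective_variety X \<longleftrightarrow>
     (\<exists>n Z. closedin (proj_zariski n) Z \<and> X = closed_subvariety n Z)"


subsection \<open>Dimension\<close>

definition irreducible_set :: "'p topology \<Rightarrow> 'p set \<Rightarrow> bool" where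
  "irreducible_set T Z \<longleftrightarrow> Z \<subseteq> topspace T \<and> Z \<noteq> {} \<and>
     (\<forall>A B. closedin T A \<longrightarrow> closedin T B \<longrightarrow> Z \<subseteq> A \<union> B \<longrightarrow> Z \<subseteq> A \<or> Z \<subseteq> B)"

definition irreducible_components :: "'p topology \<Rightarrow> 'p set set" where
  "irreducible_components T =
     {Z. irreducible_set T Z \<and> (\<forall>W. irreducible_set T W \<longrightarrow> Z \<subseteq> W \<longrightarrow> W = Z)}"

text \<open>Every irreducible component has Krull dimension exactly one.\<close>

definition pure_dim_one :: "'p topology \<Rightarrow> bool" where
  "pure_dim_one T \<longleftrightarrow> (\<forall>Z \<in> irreducible_components T.
     (\<exists>W. closedin T W \<and> irreducible_set T W \<and> W \<subset> Z) \<and>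
     \<not> (\<exists>V W. closedin T V \<and> irreducible_set T V \<and> closedin T W \<and> irreducible_set T W \<and>
              V \<subset> W \<and> W \<subset> Z))"

definition projective_curve :: "('k::field proj_point, 'k) variety \<Rightarrow> bool" where
  "projective_curve X \<longleftrightarrow> projective_variety X \<and> pure_dim_one (zariski X)"


subsection \<open>Morphisms\<close>

definition morphism :: "('p, 'k) variety \<Rightarrow> ('q, 'k) variety \<Rightarrow> ('p \<Rightarrow> 'q) \<Rightarrow> bool" where
  "morphism X Y f \<longleftrightarrow> continuous_map (zariski X) (zariski Y) f \<and>
     (\<forall>p \<in> points X. \<forall>h \<in> regular_at Y (f p). h \<circ> f \<in> regular_at X p)"

definition isomorphism :: "('p, 'k) variety \<Rightarrow> ('q, 'k) variety \<Rightarrow> ('p \<Rightarrow> 'q) \<Rightarrow> bool" where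
  "isomorphism X Y f \<longleftrightarrow> homeomorphic_map (zariski X) (zariski Y) f \<and>
     (\<forall>p \<in> points X. \<forall>h. h \<in> regular_at Y (f p) \<longleftrightarrow> h \<circ> f \<in> regular_at X p)"

definition open_subvariety :: "('p, 'k) variety \<Rightarrow> 'p set \<Rightarrow> ('p, 'k) variety" where
  "open_subvariety X U = \<lparr> zariski = subtopology (zariski X) U, regular_at = regular_at X \<rparr>"

definition birational :: "('p, 'k) variety \<Rightarrow> ('q, 'k) variety \<Rightarrow> ('p \<Rightarrow> 'q) \<Rightarrow> bool" where
  "birational X Y f \<longleftrightarrow> (\<exists>U. openin (zariski Y) U \<and> zariski Y closure_of U = points Y \<and>
     zariski X closure_of {p \<in> points X. f p \<in> U} = points X \<and>
     isomorphism (open_subvariety X {p \<in> points X. f p \<in> U}) (open_subvariety Y U) f)"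

definition fibre :: "('p, 'k) variety \<Rightarrow> ('p \<Rightarrow> 'q) \<Rightarrow> 'q set \<Rightarrow> 'p set" where
  "fibre X f S = {p \<in> points X. f p \<in> S}"

text \<open>A morphism of projective varieties is proper, hence closed, and a proper morphism is finite
  iff its fibres are finite.\<close>

definition finite_morphism :: "('p, 'k) variety \<Rightarrow> ('q, 'k) variety \<Rightarrow> ('p \<Rightarrow> 'q) \<Rightarrow> bool" where
  "finite_morphism X Y f \<longleftrightarrow> morphism X Y f \<and> closed_map (zariski X) (zariski Y) f \<and>
     (\<forall>y \<in> points Y. finite (fibre X f {y}))"


section \<open>Nodal curves\<close>

definition near :: "('p, 'k) variety \<Rightarrow> 'p \<Rightarrow> ('p \<Rightarrow> bool) \<Rightarrow> bool" where
  "near X p P \<longleftrightarrow> (\<exists>U. openin (zariski X) U \<and> p \<in> U \<and> (\<forall>x\<in>U. P x))"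

text \<open>A point of a curve is nonsingular iff its local ring is a discrete valuation ring: there is
  a nonzero \<open>t\<close> in the maximal ideal such that every nonzero germ is a unit times a power of
  \<open>t\<close>.\<close>

definition nonsingular_at :: "('p, 'k::field) variety \<Rightarrow> 'p \<Rightarrow> bool" where
  "nonsingular_at X p \<longleftrightarrow> (\<exists>t \<in> regular_at X p. t p = 0 \<and> \<not> near X p (\<lambda>x. t x = 0) \<and>
     (\<forall>f \<in> regular_at X p. near X p (\<lambda>x. f x = 0) \<or>
        (\<exists>u \<in> regular_at X p. \<exists>m::nat. u p \<noteq> 0 \<and> near X p (\<lambda>x. f x = u x * t x ^ m))))"

definition singular_points :: "('p, 'k::field) variety \<Rightarrow> 'p set" where
  "singular_points X = {p \<in> points X. \<not> nonsingular_at X p}"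

definition normalization ::
    "('k::field proj_point, 'k) variety \<Rightarrow> ('k proj_point, 'k) variety \<Rightarrow>
     ('k proj_point \<Rightarrow> 'k proj_point) \<Rightarrow> bool" where
  "normalization Xn X \<nu> \<longleftrightarrow> projective_curve Xn \<and> singular_points Xn = {} \<and>
     finite_morphism Xn X \<nu> \<and> birational Xn X \<nu>"

text \<open>A node is an ordinary double point: two points of the normalization lie over it, and
  its delta invariant is one. Since the local ring of \<open>X\<close> at \<open>p\<close> always lies in the subring of
  codimension one of those functions regular at \<open>q\<^sub>1\<close> and \<open>q\<^sub>2\<close> which agree at these two points,
  the latter means that every such function descends to a regular function near \<open>p\<close>.\<close>

definition node ::
    "('q, 'k) variety \<Rightarrow> ('p, 'k) variety \<Rightarrow> ('q \<Rightarrow> 'p) \<Rightarrow> 'p \<Rightarrow> bool" where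
  "node Xn X \<nu> p \<longleftrightarrow> p \<in> points X \<and>
     (\<exists>q1 q2. q1 \<noteq> q2 \<and> fibre Xn \<nu> {p} = {q1, q2} \<and>
        (\<forall>g \<in> regular_at Xn q1 \<inter> regular_at Xn q2. g q1 = g q2 \<longrightarrow>
           (\<exists>f \<in> regular_at X p. \<exists>U. openin (zariski X) U \<and> p \<in> U \<and>
              (\<forall>q \<in> fibre Xn \<nu> U. g q = f (\<nu> q)))))"

text \<open>Together with its normalization, which is unique up to isomorphism.\<close>

definition connected_nodal_curve ::
    "('k::field proj_point, 'k) variety \<Rightarrow> ('k proj_point, 'k) variety \<Rightarrow>
     ('k proj_point \<Rightarrow> 'k proj_point) \<Rightarrow> bool" where
  "connected_nodal_curve X Xn \<nu> \<longleftrightarrow> projective_curve X \<and>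
     points X \<noteq> {} \<and> connected_space (zariski X) \<and>
     normalization Xn X \<nu> \<and> (\<forall>p \<in> singular_points X. node Xn X \<nu> p)"

definition separating_node :: "('p, 'k::field) variety \<Rightarrow> 'p \<Rightarrow> bool" where
  "separating_node Y n \<longleftrightarrow> n \<in> singular_points Y \<and>
     card (connected_components_of (subtopology (zariski Y) (points Y - {n})))
       > card (connected_components_of (zariski Y))"

text \<open>The partial normalization at \<open>S\<close>: the points of \<open>S\<close> are replaced by the points of
  the normalization over them. It is a quotient of the normalization as a topological space,
  being the image of a finite morphism.\<close>

definition partial_norm_map ::
    "('q \<Rightarrow> 'p) \<Rightarrow> 'p set \<Rightarrow> 'q \<Rightarrow> 'p + 'q" where
  "partial_norm_map \<nu> S q = (if \<nu> q \<in> S then Inr q else Inl (\<nu> q))"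

definition partial_norm_open ::
    "('q, 'k) variety \<Rightarrow> ('p, 'k) variety \<Rightarrow> ('q \<Rightarrow> 'p) \<Rightarrow> 'p set \<Rightarrow> ('p + 'q) set \<Rightarrow> bool" where
  "partial_norm_open Xn X \<nu> S U \<longleftrightarrow> U \<subseteq> (points X - S) <+> fibre Xn \<nu> S \<and>
     openin (zariski Xn) (fibre Xn (partial_norm_map \<nu> S) U)"

lemma istopology_partial_norm_open: "istopology (partial_norm_open Xn X \<nu> S)"
proof -
  let ?f = "fibre Xn (partial_norm_map \<nu> S)"
  have "?f (U \<inter> V) = ?f U \<inter> ?f V" for U V
    by (auto simp: fibre_def)
  moreover have "?f (\<Union>K) = (\<Union>U\<in>K. ?f U)" for K
    by (auto simp: fibre_def)
  ultimately show ?thesis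
    unfolding istopology_def partial_norm_open_def by (auto intro!: openin_Union)
qed

definition partial_normalization ::
    "('q, 'k) variety \<Rightarrow> ('p, 'k) variety \<Rightarrow> ('q \<Rightarrow> 'p) \<Rightarrow> 'p set \<Rightarrow> ('p + 'q, 'k) variety" where
  "partial_normalization Xn X \<nu> S =
     \<lparr> zariski = topology (partial_norm_open Xn X \<nu> S),
       regular_at = (\<lambda>y. case y of
           Inl p \<Rightarrow> {f. f \<circ> Inl \<in> regular_at X p}
         | Inr q \<Rightarrow> {f. f \<circ> partial_norm_map \<nu> S \<in> regular_at Xn q}) \<rparr>"


section \<open>Graphs\<close>

text \<open>Undirected graphs with loops and multiple edges: \<open>gends G e\<close> is the multiset of
  the two end vertices of \<open>e\<close>.\<close>

record ('v, 'e) multigraph =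
  gverts :: "'v set"
  gedges :: "'e set"
  gends :: "'e \<Rightarrow> 'v multiset"

definition adjacent_by :: "('v, 'e) multigraph \<Rightarrow> 'e set \<Rightarrow> ('v \<times> 'v) set" where
  "adjacent_by G A = {(u, v). \<exists>e\<in>A. gends G e = {#u, v#}}"

definition graph_connected :: "('v, 'e) multigraph \<Rightarrow> bool" where
  "graph_connected G \<longleftrightarrow> gverts G \<noteq> {} \<and>
     (\<forall>u\<in>gverts G. \<forall>v\<in>gverts G. (u, v) \<in> (adjacent_by G (gedges G))\<^sup>*)"

definition valency :: "('v, 'e) multigraph \<Rightarrow> 'v \<Rightarrow> nat" where
  "valency G v = (\<Sum>e\<in>gedges G. count (gends G e) v)"

definition is_cycle :: "('v, 'e) multigraph \<Rightarrow> bool" where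
  "is_cycle G \<longleftrightarrow> finite (gverts G) \<and> finite (gedges G) \<and> graph_connected G \<and>
     (\<exists>h\<ge>1. card (gedges G) = h \<and> card (gverts G) = h) \<and> (\<forall>v\<in>gverts G. valency G v = 2)"

definition contract_outside :: "('v, 'e) multigraph \<Rightarrow> 'e set \<Rightarrow> ('v set, 'e) multigraph" where
  "contract_outside G S =
     (let cls = (\<lambda>v. {w \<in> gverts G. (v, w) \<in> (adjacent_by G (gedges G - S))\<^sup>*}) in
      \<lparr> gverts = cls ` gverts G, gedges = S, gends = (\<lambda>e. image_mset cls (gends G e)) \<rparr>)"

text \<open>A cycle of a graph has no isolated vertices, so it is given by its set of edges.\<close>

definition cycles :: "('v, 'e) multigraph \<Rightarrow> 'e set set" where
  "cycles G = {C. C \<subseteq> gedges G \<and>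
     is_cycle \<lparr> gverts = (\<Union>e\<in>C. set_mset (gends G e)), gedges = C, gends = gends G \<rparr>}"

definition cyclic_bijection ::
    "('v, 'e) multigraph \<Rightarrow> ('w, 'f) multigraph \<Rightarrow> ('e \<Rightarrow> 'f) \<Rightarrow> bool" where
  "cyclic_bijection G G' \<epsilon> \<longleftrightarrow> bij_betw \<epsilon> (gedges G) (gedges G') \<and>
     bij_betw (image \<epsilon>) (cycles G) (cycles G')"


subsection \<open>Dual graphs and C1-equivalence\<close>

text \<open>The normalization of an irreducible component of \<open>X\<close> is a connected component of the
  normalization; the branch \<open>q\<close> belongs to the image of the connected component through \<open>q\<close>.\<close>

definition branch_component :: "('q, 'k) variety \<Rightarrow> ('q \<Rightarrow> 'p) \<Rightarrow> 'q \<Rightarrow> 'p set" where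
  "branch_component Xn \<nu> q = \<nu> ` connected_component_of_set (zariski Xn) q"

definition dual_graph ::
    "('q, 'k) variety \<Rightarrow> ('p, 'k::field) variety \<Rightarrow> ('q \<Rightarrow> 'p) \<Rightarrow> ('p set, 'p) multigraph" where
  "dual_graph Xn X \<nu> =
     \<lparr> gverts = irreducible_components (zariski X),
       gedges = singular_points X,
       gends = (\<lambda>e. image_mset (branch_component Xn \<nu>) (mset_set (fibre Xn \<nu> {e}))) \<rparr>"

definition C1_sets ::
    "('q, 'k) variety \<Rightarrow> ('p, 'k::field) variety \<Rightarrow> ('q \<Rightarrow> 'p) \<Rightarrow> 'p set set" where
  "C1_sets Xn X \<nu> = {S. S \<subseteq> singular_points X \<and>
     \<not> (\<exists>n. separating_node (partial_normalization Xn X \<nu> S) n) \<and>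
     is_cycle (contract_outside (dual_graph Xn X \<nu>) S)}"

definition C1_equivalent ::
    "('q, 'k) variety \<Rightarrow> ('p, 'k::field) variety \<Rightarrow> ('q \<Rightarrow> 'p) \<Rightarrow>
     ('r, 'k) variety \<Rightarrow> ('s, 'k) variety \<Rightarrow> ('r \<Rightarrow> 's) \<Rightarrow> bool" where
  "C1_equivalent Xn X \<nu> Xn' X' \<nu>' \<longleftrightarrow>
     (\<exists>\<phi> \<sigma>. isomorphism Xn Xn' \<phi> \<and> bij_betw \<sigma> (C1_sets Xn X \<nu>) (C1_sets Xn' X' \<nu>') \<and>
        (\<forall>S \<in> C1_sets Xn X \<nu>. \<phi> ` fibre Xn \<nu> S = fibre Xn' \<nu>' (\<sigma> S)))"


subsection \<open>Orientations, homology and T-equivalence\<close>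

text \<open>An orientation orders the two branches \<open>(s\<^sub>e, t\<^sub>e)\<close> of every node \<open>e\<close>, that is, the two
  half-edges of the corresponding edge; in particular it also orients loops.\<close>

definition orientation ::
    "('q, 'k) variety \<Rightarrow> ('p, 'k::field) variety \<Rightarrow> ('q \<Rightarrow> 'p) \<Rightarrow> ('p \<Rightarrow> 'q \<times> 'q) \<Rightarrow> bool" where
  "orientation Xn X \<nu> ori \<longleftrightarrow>
     (\<forall>e \<in> singular_points X. {fst (ori e), snd (ori e)} = fibre Xn \<nu> {e})"

text \<open>Chains and divisors are elements of free abelian groups, represented as finitely supported
  integer-valued functions.\<close>

definition boundary ::
    "('q, 'k) variety \<Rightarrow> ('q \<Rightarrow> 'p) \<Rightarrow> ('p \<Rightarrow> 'q \<times> 'q) \<Rightarrow> ('p \<Rightarrow>\<^sub>0 int) \<Rightarrow> ('p set \<Rightarrow>\<^sub>0 int)" where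
  "boundary Xn \<nu> ori = frag_extend (\<lambda>e. frag_of (branch_component Xn \<nu> (snd (ori e)))
                                      - frag_of (branch_component Xn \<nu> (fst (ori e))))"

definition H1 ::
    "('q, 'k) variety \<Rightarrow> ('p, 'k::field) variety \<Rightarrow> ('q \<Rightarrow> 'p) \<Rightarrow> ('p \<Rightarrow> 'q \<times> 'q) \<Rightarrow>
     ('p \<Rightarrow>\<^sub>0 int) set" where
  "H1 Xn X \<nu> ori = {c. Poly_Mapping.keys c \<subseteq> singular_points X \<and> boundary Xn \<nu> ori c = 0}"

definition eta :: "('p \<Rightarrow> 'q \<times> 'q) \<Rightarrow> ('p \<Rightarrow>\<^sub>0 int) \<Rightarrow> ('q \<Rightarrow>\<^sub>0 int)" where
  "eta ori = frag_extend (\<lambda>e. frag_of (snd (ori e)) - frag_of (fst (ori e)))"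

definition pushforward :: "('a \<Rightarrow> 'b) \<Rightarrow> ('a \<Rightarrow>\<^sub>0 int) \<Rightarrow> ('b \<Rightarrow>\<^sub>0 int)" where
  "pushforward f = frag_extend (\<lambda>x. frag_of (f x))"

text \<open>The action of a family \<open>\<alpha>\<close> of signs, one for each connected component.\<close>

definition sign_action ::
    "('q, 'k) variety \<Rightarrow> ('q set \<Rightarrow> int) \<Rightarrow> ('q \<Rightarrow>\<^sub>0 int) \<Rightarrow> ('q \<Rightarrow>\<^sub>0 int)" where
  "sign_action Xn \<alpha> =
     frag_extend (\<lambda>q. frag_cmul (\<alpha> (connected_component_of_set (zariski Xn) q)) (frag_of q))"

definition T_equivalent ::
    "('q, 'k) variety \<Rightarrow> ('p, 'k::field) variety \<Rightarrow> ('q \<Rightarrow> 'p) \<Rightarrow>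
     ('r, 'k) variety \<Rightarrow> ('s, 'k) variety \<Rightarrow> ('r \<Rightarrow> 's) \<Rightarrow> bool" where
  "T_equivalent Xn X \<nu> Xn' X' \<nu>' \<longleftrightarrow>
     (\<exists>\<phi> \<epsilon>. isomorphism Xn Xn' \<phi> \<and>
        cyclic_bijection (dual_graph Xn X \<nu>) (dual_graph Xn' X' \<nu>') \<epsilon> \<and>
        (\<forall>ori. orientation Xn X \<nu> ori \<longrightarrow>
          (\<exists>ori' \<alpha>. orientation Xn' X' \<nu>' ori' \<and>
             \<alpha> \<in> connected_components_of (zariski Xn) \<rightarrow> {1, -1} \<and>
             pushforward \<epsilon> ` H1 Xn X \<nu> ori = H1 Xn' X' \<nu>' ori' \<and>
             (\<forall>z \<in> H1 Xn X \<nu> ori.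
                eta ori' (pushforward \<epsilon> z) = pushforward \<phi> (sign_action Xn \<alpha> (eta ori z))))))"

end

theory Submission
  imports Defs "HOL-Library.Function_Algebras"
begin

text \<open>
  Regard a homology class of the dual graph as a flow \<open>z\<close> on the edges. In a connected bridgeless
  graph two edges lie in the same C1-set iff every flow vanishes on both or on neither, so C1-sets
  are determined by the supports of flows, and so are the cycles, which are the minimal nonempty
  supports.

  If \<open>X\<close> and \<open>X'\<close> are T-equivalent, then comparing the supports of \<open>\<eta>(z)\<close> and \<open>\<eta>(\<epsilon> z)\<close>, which are the
  fibres over the supports of \<open>z\<close> and \<open>\<epsilon> z\<close>, shows that \<open>\<phi>\<close> maps the fibre over a C1-set \<open>S\<close> onto the
  fibre over the C1-set \<open>\<epsilon>(S)\<close>.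

  Conversely, let \<open>X\<close> and \<open>X'\<close> be C1-equivalent and let \<open>\<epsilon>\<close> be a bijection of the nodes that induces
  the given bijection of C1-sets. Each C1-set is cyclically ordered by the contracted graph; orient it
  cyclically, so that flows are constant on it. At a component of the complement of \<open>S\<close> the cyclic
  orientations of \<open>S\<close> and of its image agree or not, and the product of these signs over all \<open>S\<close> is the
  \<open>\<alpha>\<close> required at a vertex, because two edges of \<open>S\<close> lie in the same component of the complement of
  any other C1-set.

  To apply this to curves one needs that separating nodes are the bridges of the dual graph, also for
  partial normalizations. As the local ring of a nonsingular point is a discrete valuation ring, such
  a point lies on only one component. So the components of the normalization are disjoint, and the
  connected components of the curves obtained from it by gluing are counted by those of a graph.
\<close>

section \<open>Noetherian rings of polynomial functions\<close>

text \<open>The map \<phi> respects C1-sets but not single nodes: the two branches of a node may go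
  to branches of two different nodes of the image C1-set, and the cyclic order of a C1-set may
  change. The condition on \<eta> survives because a flow takes one common value on a cyclically
  oriented C1-set, so that up to sign the coefficient of \<eta>(z) at a branch depends only on z and
  the C1-set. What remains is a sign problem: one factor per node, absorbed by the orientation of
  the target, and one per vertex, which is \<alpha>.

  Flows are preferred to cycles because they are linear. An edge is not a bridge iff some flow is
  nonzero on it, and flows can be combined, restricted to a union of components of their support and
  lifted from contracted graphs. That a graph is a cycle is shown by counting half-edges, so no
  cyclic enumeration of edges is ever handled.

  The finiteness of the dual graph, for components and for nodes, rests on the descending chain
  condition for Zariski closed sets, which is why the development begins with Hilbert's basis
  theorem.\<close>

definition subring :: "'a::comm_ring_1 set \<Rightarrow> bool" where
  "subring A \<longleftrightarrow> 1 \<in> A \<and> (\<forall>a\<in>A. \<forall>b\<in>A. a + b \<in> A \<and> a * b \<in> A) \<and> (\<forall>a\<in>A. - a \<in> A)"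

definition ideal_of :: "'a::comm_ring_1 set \<Rightarrow> 'a set \<Rightarrow> bool" where
  "ideal_of A I \<longleftrightarrow> I \<subseteq> A \<and> 0 \<in> I \<and> (\<forall>a\<in>I. \<forall>b\<in>I. a + b \<in> I) \<and> (\<forall>r\<in>A. \<forall>a\<in>I. r * a \<in> I)"

definition noetherian_ring :: "'a::comm_ring_1 set \<Rightarrow> bool" where
  "noetherian_ring A \<longleftrightarrow> (\<forall>I::nat \<Rightarrow> 'a set. (\<forall>n. ideal_of A (I n)) \<longrightarrow> (\<forall>n. I n \<subseteq> I (Suc n)) \<longrightarrow>
     (\<exists>N. \<forall>n\<ge>N. I n = I N))"

lemma noetherian_ringD:
  assumes "noetherian_ring A" "\<And>n::nat. ideal_of A (I n)" "\<And>n. I n \<subseteq> I (Suc n)"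
  obtains N where "\<And>n. n \<ge> N \<Longrightarrow> I n = I N"
  using assms unfolding noetherian_ring_def by blast

lemma subring_0: "subring A \<Longrightarrow> 0 \<in> A"
  unfolding subring_def by (metis add.right_inverse)

section \<open>Hilbert's basis theorem\<close>

primrec polys :: "'a::comm_ring_1 set \<Rightarrow> 'a \<Rightarrow> nat \<Rightarrow> 'a set" where
  "polys A x 0 = {0}"
| "polys A x (Suc d) = {y + a * x ^ d | y a. y \<in> polys A x d \<and> a \<in> A}"

definition adjoin :: "'a::comm_ring_1 set \<Rightarrow> 'a \<Rightarrow> 'a set" where
  "adjoin A x = (\<Union>d. polys A x d)"

context
  fixes A :: "'a::comm_ring_1 set" and x :: 'a
  assumes A: "subring A"
begin

lemma polys_0: "0 \<in> polys A x d"
proof (induction d)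
  case (Suc d)
  then show ?case using subring_0[OF A] by (auto intro!: exI[of _ 0])
qed simp

lemma polys_Suc_mono: "y \<in> polys A x d \<Longrightarrow> y \<in> polys A x (Suc d)"
  unfolding polys.simps using subring_0[OF A] by (intro CollectI exI[of _ y] exI[of _ 0]) simp

lemma polys_mono: "y \<in> polys A x d \<Longrightarrow> d \<le> e \<Longrightarrow> y \<in> polys A x e"
  using lift_Suc_mono_le[of "polys A x" d e] polys_Suc_mono by blast

lemma polys_add: "y \<in> polys A x d \<Longrightarrow> z \<in> polys A x d \<Longrightarrow> y + z \<in> polys A x d"
proof (induction d arbitrary: y z)
  case (Suc d)
  then obtain y' z' a b where *: "y = y' + a * x ^ d" "z = z' + b * x ^ d" "y' \<in> polys A x d" "z' \<in> polys A x d"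
    "a \<in> A" "b \<in> A" by auto
  then have "y + z = (y' + z') + (a + b) * x ^ d" by (simp add: algebra_simps)
  moreover have "y' + z' \<in> polys A x d" "a + b \<in> A" using * Suc.IH A by (auto simp: subring_def)
  ultimately show ?case by auto
qed simp

lemma polys_scale: "a \<in> A \<Longrightarrow> y \<in> polys A x d \<Longrightarrow> a * y \<in> polys A x d"
proof (induction d arbitrary: y)
  case (Suc d)
  then obtain y' b where *: "y = y' + b * x ^ d" "y' \<in> polys A x d" "b \<in> A" by auto
  then have "a * y = a * y' + (a * b) * x ^ d" by (simp add: algebra_simps)
  moreover have "a * y' \<in> polys A x d" "a * b \<in> A" using * Suc A by (auto simp: subring_def)
  ultimately show ?case by auto
qed simp

lemma polys_diff: "y \<in> polys A x d \<Longrightarrow> z \<in> polys A x d \<Longrightarrow> y - z \<in> polys A x d"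
  using polys_add[of y d "-1 * z"] polys_scale[of "-1" z d] A by (auto simp: subring_def)

lemma polys_shift: "y \<in> polys A x d \<Longrightarrow> x * y \<in> polys A x (Suc d)"
proof (induction d arbitrary: y)
  case 0
  then show ?case using polys_0[of "Suc 0"] by simp
next
  case (Suc d)
  then obtain y' b where *: "y = y' + b * x ^ d" "y' \<in> polys A x d" "b \<in> A" by auto
  then have "x * y = x * y' + b * x ^ Suc d" by (simp add: algebra_simps)
  moreover have "x * y' \<in> polys A x (Suc d)" using * Suc.IH by blast
  ultimately show ?case using * polys.simps(2)[of A x "Suc d"] by blast
qed

lemma adjoin_contains: "A \<subseteq> adjoin A x" "x \<in> adjoin A x"
proof -
  have 1: "a \<in> polys A x (Suc 0)" if "a \<in> A" for a using that by auto
  then show "A \<subseteq> adjoin A x" unfolding adjoin_def by blast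
  have "x * 1 \<in> polys A x (Suc (Suc 0))" by (rule polys_shift, rule 1) (use A in \<open>simp add: subring_def\<close>)
  then show "x \<in> adjoin A x" unfolding adjoin_def mult_1_right by blast
qed

lemma adjoin_add: "y \<in> adjoin A x \<Longrightarrow> z \<in> adjoin A x \<Longrightarrow> y + z \<in> adjoin A x"
proof -
  assume "y \<in> adjoin A x" "z \<in> adjoin A x"
  then obtain d e where de: "y \<in> polys A x d" "z \<in> polys A x e" by (auto simp: adjoin_def)
  then have "y \<in> polys A x (max d e)" "z \<in> polys A x (max d e)" using polys_mono max.cobounded1 max.cobounded2 by blast+
  then show ?thesis using polys_add unfolding adjoin_def by blast
qed

lemma adjoin_mult_power: "z \<in> adjoin A x \<Longrightarrow> x ^ d * z \<in> adjoin A x"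
proof (induction d)
  case (Suc d)
  then obtain e where "x ^ d * z \<in> polys A x e" by (auto simp: adjoin_def)
  then have "x * (x ^ d * z) \<in> polys A x (Suc e)" by (rule polys_shift)
  then show ?case unfolding adjoin_def by (auto simp: mult.assoc simp del: polys.simps)
qed simp

lemma subring_adjoin: "subring (adjoin A x)"
proof -
  have mult: "y * z \<in> adjoin A x" if y: "y \<in> polys A x d" and z: "z \<in> adjoin A x" for y z d
    using y
  proof (induction d arbitrary: y)
    case 0
    then show ?case using polys_0 unfolding adjoin_def by auto
  next
    case (Suc d)
    then obtain y' b where *: "y = y' + b * x ^ d" "y' \<in> polys A x d" "b \<in> A" by auto
    obtain e where "x ^ d * z \<in> polys A x e" using adjoin_mult_power[OF z, of d] by (auto simp: adjoin_def)
    then have "b * (x ^ d * z) \<in> adjoin A x" using polys_scale[OF *(3)] unfolding adjoin_def by blast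
    then have "y' * z + b * (x ^ d * z) \<in> adjoin A x" using adjoin_add Suc.IH[OF *(2)] by blast
    then show ?case by (simp add: * algebra_simps)
  qed
  have "1 \<in> adjoin A x" "-1 \<in> adjoin A x" using adjoin_contains(1) A by (auto simp: subring_def)
  moreover have "y * z \<in> adjoin A x" if "y \<in> adjoin A x" "z \<in> adjoin A x" for y z
    using that mult unfolding adjoin_def by blast
  moreover from this have "- y \<in> adjoin A x" if "y \<in> adjoin A x" for y
    using that \<open>-1 \<in> adjoin A x\<close> by (metis mult_minus1)
  ultimately show ?thesis using adjoin_add unfolding subring_def by blast
qed

text \<open>Since \<open>x\<close> may be algebraic over \<open>A\<close>, an element of
  \<open>adjoin A x\<close> has no well-defined degree or leading coefficient. Therefore
  \<open>polys A x d\<close> collects the values of expressions of formal degree below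
  \<open>d\<close>, and a coefficient of \<open>x ^ d\<close> counts as soon as it occurs in one
  such expression for an element of \<open>I\<close>.\<close>

definition leading :: "'a set \<Rightarrow> nat \<Rightarrow> 'a set" where
  "leading I d = {a \<in> A. \<exists>y\<in>polys A x d. y + a * x ^ d \<in> I}"

lemma ideal_leading:
  assumes I: "ideal_of (adjoin A x) I"
  shows "ideal_of A (leading I d)"
  unfolding ideal_of_def
proof (intro conjI ballI)
  show "leading I d \<subseteq> A" by (auto simp: leading_def)
  show "0 \<in> leading I d" using polys_0[of d] subring_0[OF A] I by (auto simp: leading_def ideal_of_def intro!: bexI[of _ 0])
next
  fix a b assume "a \<in> leading I d" "b \<in> leading I d"
  then obtain y z where *: "a \<in> A" "b \<in> A" "y \<in> polys A x d" "z \<in> polys A x d" "y + a * x ^ d \<in> I" "z + b * x ^ d \<in> I"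
    by (auto simp: leading_def)
  then have "(y + a * x ^ d) + (z + b * x ^ d) \<in> I" using I unfolding ideal_of_def by blast
  then have "(y + z) + (a + b) * x ^ d \<in> I" by (simp add: algebra_simps)
  then show "a + b \<in> leading I d" using * polys_add A by (auto simp: leading_def subring_def)
next
  fix r a assume "r \<in> A" "a \<in> leading I d"
  then obtain y where *: "a \<in> A" "r \<in> A" "y \<in> polys A x d" "y + a * x ^ d \<in> I"
    by (auto simp: leading_def)
  moreover have "r * (y + a * x ^ d) \<in> I" using I * adjoin_contains(1) unfolding ideal_of_def by blast
  then have "r * y + (r * a) * x ^ d \<in> I" by (simp add: algebra_simps)
  ultimately show "r * a \<in> leading I d" using polys_scale A by (auto simp: leading_def subring_def)
qed

lemma leading_Suc: "ideal_of (adjoin A x) I \<Longrightarrow> leading I d \<subseteq> leading I (Suc d)"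
proof
  fix a assume I: "ideal_of (adjoin A x) I" and "a \<in> leading I d"
  then obtain y where *: "a \<in> A" "y \<in> polys A x d" "y + a * x ^ d \<in> I" by (auto simp: leading_def)
  have "x * (y + a * x ^ d) \<in> I" using I * adjoin_contains(2) unfolding ideal_of_def by blast
  then have "x * y + a * x ^ Suc d \<in> I" by (simp add: algebra_simps)
  then show "a \<in> leading I (Suc d)" unfolding leading_def using * polys_shift by blast
qed

lemma leading_mono: "I \<subseteq> J \<Longrightarrow> leading I d \<subseteq> leading J d"
  by (auto simp: leading_def)

text \<open>Induction on the formal degree: from an element of \<open>J\<close> one subtracts an
  element of \<open>I\<close> with the same top coefficient. The difference still lies in
  \<open>J\<close> and has smaller formal degree.\<close>

lemma leading_inj:
  assumes I: "ideal_of (adjoin A x) I" and J: "ideal_of (adjoin A x) J" and "I \<subseteq> J"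
    and eq: "\<And>d. leading I d = leading J d"
  shows "I = J"
proof -
  have m1: "- 1 \<in> adjoin A x" using adjoin_contains(1) A by (auto simp: subring_def)
  have "y \<in> polys A x d \<Longrightarrow> y \<in> J \<Longrightarrow> y \<in> I" for y d
  proof (induction d arbitrary: y)
    case 0
    then show ?case using I by (simp add: ideal_of_def)
  next
    case (Suc d)
    then obtain y' a where *: "y = y' + a * x ^ d" "y' \<in> polys A x d" "a \<in> A" by auto
    then have "a \<in> leading J d" using Suc.prems by (auto simp: leading_def)
    then have "a \<in> leading I d" using eq by simp
    then obtain z where z: "z \<in> polys A x d" "z + a * x ^ d \<in> I" by (auto simp: leading_def)
    then have "-1 * (z + a * x ^ d) \<in> J" using J m1 \<open>I \<subseteq> J\<close> unfolding ideal_of_def by blast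
    then have "y + -1 * (z + a * x ^ d) \<in> J" using Suc.prems J unfolding ideal_of_def by blast
    then have "y' - z \<in> J" using * by simp
    then have "y' - z \<in> I" using Suc.IH polys_diff * z by blast
    then have "(y' - z) + (z + a * x ^ d) \<in> I" using z I unfolding ideal_of_def by blast
    then show ?case using * by simp
  qed
  moreover have "J \<subseteq> (\<Union>d. polys A x d)" using J by (simp add: ideal_of_def adjoin_def)
  ultimately show ?thesis using \<open>I \<subseteq> J\<close> by blast
qed

lemma noetherian_adjoin:
  assumes "noetherian_ring A"
  shows "noetherian_ring (adjoin A x)"
  unfolding noetherian_ring_def
proof (intro allI impI)
  fix I :: "nat \<Rightarrow> 'a set"
  assume I: "\<forall>n. ideal_of (adjoin A x) (I n)" and inc: "\<forall>n. I n \<subseteq> I (Suc n)"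
  have mono: "I m \<subseteq> I n" if "m \<le> n" for m n using inc that by (meson lift_Suc_mono_le)
  have lmono: "leading (I m) d \<subseteq> leading (I n) e" if "m \<le> n" "d \<le> e" for m n d e
  proof -
    have "leading (I n) d \<subseteq> leading (I n) e" using lift_Suc_mono_le[of "leading (I n)" d e] leading_Suc I that by blast
    then show ?thesis using leading_mono[OF mono[OF that(1)]] by blast
  qed
  \<comment> \<open>The diagonal settles all large degrees at once: \<open>leading (I n) d\<close>
    is monotone in \<open>n\<close> and \<open>d\<close>, so for \<open>n\<close> and
    \<open>d\<close> beyond \<open>N\<close> it is squeezed between the diagonal terms at
    \<open>N\<close> and at \<open>max n d\<close>.\<close>
  obtain N where N: "\<And>n. n \<ge> N \<Longrightarrow> leading (I n) n = leading (I N) N"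
    by (rule noetherian_ringD[OF assms, of "\<lambda>n. leading (I n) n"]) (use I ideal_leading lmono in auto)
  have N': "leading (I n) d = leading (I N) N" if "n \<ge> N" "d \<ge> N" for n d
  proof -
    have "leading (I n) d \<subseteq> leading (I (max n d)) (max n d)" by (rule lmono) auto
    also have "\<dots> = leading (I N) N" by (rule N) (use that in auto)
    finally show ?thesis using lmono[OF that] by blast
  qed
  have "\<exists>M. \<forall>n\<ge>M. leading (I n) d = leading (I M) d" for d
  proof -
    obtain K where "\<And>n. n \<ge> K \<Longrightarrow> leading (I n) d = leading (I K) d"
      by (rule noetherian_ringD[OF assms, of "\<lambda>n. leading (I n) d"]) (use I ideal_leading lmono in auto)
    then show ?thesis by (intro exI[of _ K] allI impI)
  qed
  then obtain M where M: "\<And>n d. n \<ge> M d \<Longrightarrow> leading (I n) d = leading (I (M d)) d" by metis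
  \<comment> \<open>The finitely many degrees below \<open>N\<close> stabilize separately; the sum
    is a common bound for their indices.\<close>
  define K where "K = N + (\<Sum>d<N. M d)"
  have "I n = I K" if n: "n \<ge> K" for n
  proof -
    have "leading (I K) d = leading (I n) d" for d
    proof (cases "d < N")
      case True
      then have "M d \<le> (\<Sum>d<N. M d)" by (intro member_le_sum) auto
      then have "M d \<le> K" "M d \<le> n" using n by (auto simp: K_def)
      then show ?thesis using M by metis
    next
      case False
      then have "N \<le> K" "N \<le> n" "N \<le> d" using n by (auto simp: K_def)
      then have "leading (I K) d = leading (I N) N" "leading (I n) d = leading (I N) N"
        using N' by blast+
      then show ?thesis by (rule trans[OF _ sym])
    qed
    then show ?thesis using leading_inj[of "I K" "I n"] I mono[OF n] by blast
  qed
  then show "\<exists>N. \<forall>n\<ge>N. I n = I N" by blast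
qed

end

text \<open>The chain condition in a form that can be pulled back along the map from closed sets to
  vanishing ideals.\<close>

lemma wf_ideals:
  assumes "noetherian_ring A"
  shows "wf {(J, I). ideal_of A I \<and> ideal_of A J \<and> I \<subset> J}"
  unfolding wf_iff_no_infinite_down_chain
proof
  assume "\<exists>f. \<forall>i. (f (Suc i), f i) \<in> {(J, I). ideal_of A I \<and> ideal_of A J \<and> I \<subset> J}"
  then obtain f where "\<And>i. (f (Suc i), f i) \<in> {(J, I). ideal_of A I \<and> ideal_of A J \<and> I \<subset> J}" by blast
  then have f: "\<And>i. ideal_of A (f i)" "\<And>i. f i \<subset> f (Suc i)" by auto
  then obtain N where "\<And>n. n \<ge> N \<Longrightarrow> f n = f N" using noetherian_ringD[OF assms, of f] by blast
  then show False using f(2)[of N] by (metis le_Suc_eq order.refl psubset_eq)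
qed

text \<open>A tower in which each stage adjoins one coordinate, so that the basis theorem applies by
  induction on \<open>m\<close>. The elements are functions rather than formal polynomials, as are
  the elements of \<open>forms\<close>.\<close>

primrec polynomial_functions :: "nat \<Rightarrow> ((nat \<Rightarrow> 'k::field) \<Rightarrow> 'k) set" where
  "polynomial_functions 0 = range (\<lambda>c v. c)"
| "polynomial_functions (Suc m) = adjoin (polynomial_functions m) (\<lambda>v. v m)"

lemma subring_polynomial_functions: "subring (polynomial_functions m :: ((nat \<Rightarrow> 'k::field) \<Rightarrow> 'k) set)"
proof (induction m)
  case 0
  show ?case by (auto simp: subring_def plus_fun_def times_fun_def fun_Compl_def image_iff one_fun_def)
qed (simp add: subring_adjoin)

lemma noetherian_polynomial_functions:
  "noetherian_ring (polynomial_functions m :: ((nat \<Rightarrow> 'k::field) \<Rightarrow> 'k) set)"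
proof (induction m)
  case 0
  let ?A = "range (\<lambda>c v. c) :: ((nat \<Rightarrow> 'k) \<Rightarrow> 'k) set"
  \<comment> \<open>The constants form a field, which has only the two trivial ideals.\<close>
  have ideal: "I = {0} \<or> I = ?A" if I: "ideal_of ?A I" for I
  proof (cases "I \<subseteq> {0}")
    case True
    then show ?thesis using I by (auto simp: ideal_of_def)
  next
    case False
    then obtain g where g: "g \<in> I" "g \<noteq> 0" by blast
    then obtain c where "g = (\<lambda>v. c)" using I unfolding ideal_of_def by blast
    then have c: "(\<lambda>v. c) \<in> I" "c \<noteq> 0" using g by (auto simp: zero_fun_def)
    have "(\<lambda>v. d) \<in> I" for d
    proof -
      have "(\<lambda>v::nat \<Rightarrow> 'k. d / c) * (\<lambda>v. c) \<in> I" using I c(1) by (auto simp: ideal_of_def)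
      then show ?thesis using c(2) by (simp add: times_fun_def)
    qed
    then show ?thesis using I by (auto simp: ideal_of_def)
  qed
  show ?case
    unfolding noetherian_ring_def polynomial_functions.simps
  proof (intro allI impI)
    fix I assume I: "\<forall>n. ideal_of ?A (I n)" and inc: "\<forall>n. I n \<subseteq> I (Suc n)"
    have mono: "I m \<subseteq> I n" if "m \<le> n" for m n using inc that by (meson lift_Suc_mono_le)
    show "\<exists>N. \<forall>n\<ge>N. I n = I N"
    proof (cases "\<exists>N. I N = ?A")
      case True
      then obtain N where "I N = ?A" by blast
      then have "I n = I N" if "n \<ge> N" for n using mono[OF that] I by (auto simp: ideal_of_def)
      then show ?thesis by blast
    next
      case False
      have "I n = {0}" for n
        using ideal[of "I n"] False I by metis
      then show ?thesis by (intro exI[of _ 0] allI impI) simp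
    qed
  qed
next
  case (Suc m)
  then show ?case
    unfolding polynomial_functions.simps by (rule noetherian_adjoin[OF subring_polynomial_functions])
qed

lemma subring_sum:
  assumes "subring R" "finite S" "\<And>a. a \<in> S \<Longrightarrow> g a \<in> R"
  shows "(\<lambda>v. \<Sum>a\<in>S. g a v) \<in> R"
  using assms(2,3)
proof (induction S)
  case empty
  then show ?case using subring_0[OF assms(1)] by (simp add: zero_fun_def)
next
  case (insert a S)
  then have "g a + (\<lambda>v. \<Sum>a\<in>S. g a v) \<in> R" using assms(1) by (simp add: subring_def)
  then show ?case using insert by (simp add: plus_fun_def)
qed

lemma subring_prod:
  assumes "subring R" "finite S" "\<And>a. a \<in> S \<Longrightarrow> g a \<in> R"
  shows "(\<lambda>v. \<Prod>a\<in>S. g a v) \<in> R"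
  using assms(2,3)
proof (induction S)
  case empty
  then show ?case using assms(1) by (simp add: subring_def one_fun_def)
next
  case (insert a S)
  then have "g a * (\<lambda>v. \<Prod>a\<in>S. g a v) \<in> R" using assms(1) by (simp add: subring_def)
  then show ?case using insert by (simp add: times_fun_def)
qed

lemma subring_power:
  assumes "subring R" "g \<in> R"
  shows "(\<lambda>v. g v ^ m) \<in> R"
  using subring_prod[OF assms(1), of "{..<m}" "\<lambda>_. g"] assms(2) by simp

lemma polynomial_functions_mono:
  "m \<le> n \<Longrightarrow> polynomial_functions m \<subseteq> (polynomial_functions n :: ((nat \<Rightarrow> 'k::field) \<Rightarrow> 'k) set)"
proof (induction n rule: dec_induct)
  case (step n)
  then show ?case using adjoin_contains(1)[OF subring_polynomial_functions] by (simp; blast)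
qed simp

lemma forms_polynomial:
  fixes F :: "(nat \<Rightarrow> 'k::field) \<Rightarrow> 'k"
  assumes "F \<in> forms n d"
  shows "F \<in> polynomial_functions (Suc n)"
proof -
  let ?R = "polynomial_functions (Suc n) :: ((nat \<Rightarrow> 'k) \<Rightarrow> 'k) set"
  define S where "S = {a \<in> {..n} \<rightarrow>\<^sub>E {..d}. (\<Sum>i\<le>n. a i) = d}"
  obtain c where c: "F = (\<lambda>v. \<Sum>a\<in>S. c a * (\<Prod>i\<le>n. v i ^ a i))" using assms by (auto simp: forms_def S_def)
  note R = subring_polynomial_functions[of "Suc n"]
  have fin: "finite S" unfolding S_def by (rule finite_subset[OF _ finite_PiE[of "{..n}" "\<lambda>_. {..d}"]]) auto
  have const: "(\<lambda>v. a) \<in> ?R" for a using polynomial_functions_mono[of 0 "Suc n"] by (auto simp del: polynomial_functions.simps(2))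
  have var: "(\<lambda>v. v i) \<in> ?R" if "i \<le> n" for i
    using adjoin_contains(2)[OF subring_polynomial_functions[of i], of "\<lambda>v. v i"] polynomial_functions_mono[of "Suc i" "Suc n"] that
    by (auto simp del: polynomial_functions.simps simp add: polynomial_functions.simps(2)[symmetric])
  have "(\<lambda>v. c a * (\<Prod>i\<le>n. v i ^ a i)) \<in> ?R" for a
  proof -
    have "(\<lambda>v. \<Prod>i\<in>{..n}. (\<lambda>v. v i ^ a i) v) \<in> ?R"
      by (rule subring_prod[OF R]) (use subring_power[OF R var] in auto)
    then have "(\<lambda>v. c a) * (\<lambda>v. \<Prod>i\<in>{..n}. v i ^ a i) \<in> ?R" using R const unfolding subring_def by blast
    then show ?thesis by (simp add: times_fun_def)
  qed
  then show ?thesis unfolding c by (intro subring_sum[OF R fin])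
qed

section \<open>The Zariski topology of projective space\<close>

text \<open>What makes vanishing at a projective point independent of the coordinate vector.
  Products of forms are tracked by this property and by being polynomial functions, which is what
  the chain condition uses.\<close>

definition homogeneous :: "((nat \<Rightarrow> 'k::field) \<Rightarrow> 'k) \<Rightarrow> bool" where
  "homogeneous F \<longleftrightarrow> (\<exists>d. \<forall>c v. F (\<lambda>i. c * v i) = c ^ d * F v)"

lemma forms_scale:
  assumes "F \<in> forms n d"
  shows "F (\<lambda>i. c * v i) = c ^ d * F v"
proof -
  obtain b where b: "F = (\<lambda>v. \<Sum>a \<in> {a \<in> {..n} \<rightarrow>\<^sub>E {..d}. (\<Sum>i\<le>n. a i) = d}. b a * (\<Prod>i\<le>n. v i ^ a i))"
    using assms by (auto simp: forms_def)
  show ?thesis unfolding b sum_distrib_left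
    by (rule sum.cong) (auto simp: power_mult_distrib prod.distrib power_sum[symmetric])
qed

lemma forms_homogeneous: "F \<in> forms n d \<Longrightarrow> homogeneous F"
  unfolding homogeneous_def using forms_scale by blast

lemma proj_point_cases:
  assumes "x \<in> proj_points n" "v \<in> x"
  obtains i where "i \<le> n" "v i \<noteq> 0" "\<And>i. i > n \<Longrightarrow> v i = 0" "x = {w. \<exists>c. c \<noteq> 0 \<and> w = (\<lambda>i. c * v i)}"
proof -
  obtain u where u: "x = {w. \<exists>c. c \<noteq> 0 \<and> w = (\<lambda>i. c * u i)}" "\<exists>i. u i \<noteq> 0" "\<forall>i>n. u i = 0"
    using assms by (auto simp: proj_points_def)
  obtain c where c: "c \<noteq> 0" "v = (\<lambda>i. c * u i)" using assms(2) u by auto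
  obtain i where i: "u i \<noteq> 0" "i \<le> n" using u(2,3) by (metis not_le)
  have "x = {w. \<exists>c. c \<noteq> 0 \<and> w = (\<lambda>i. c * v i)}"
    unfolding u(1)
  proof (intro Collect_cong iffI)
    fix w assume "\<exists>c. c \<noteq> 0 \<and> w = (\<lambda>i. c * u i)"
    then obtain b where "b \<noteq> 0" "w = (\<lambda>i. b * u i)" by blast
    then show "\<exists>c. c \<noteq> 0 \<and> w = (\<lambda>i. c * v i)" using c by (intro exI[of _ "b / c"]) auto
  next
    fix w assume "\<exists>c. c \<noteq> 0 \<and> w = (\<lambda>i. c * v i)"
    then obtain b where "b \<noteq> 0" "w = (\<lambda>i. b * v i)" by blast
    then show "\<exists>c. c \<noteq> 0 \<and> w = (\<lambda>i. c * u i)" using c by (intro exI[of _ "b * c"]) (auto simp: mult.assoc)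
  qed
  then show ?thesis using that i c u(3) by simp
qed

lemma proj_point_nonempty: "x \<in> proj_points n \<Longrightarrow> \<exists>v. v \<in> x"
proof -
  assume "x \<in> proj_points n"
  then obtain u where "x = {w. \<exists>c. c \<noteq> 0 \<and> w = (\<lambda>i. c * u i)}" by (auto simp: proj_points_def)
  then have "u \<in> x" by (auto intro: exI[of _ 1])
  then show "\<exists>v. v \<in> x" by blast
qed

lemma homogeneous_zero_iff:
  assumes "homogeneous F" "x \<in> proj_points n" "v \<in> x" "w \<in> x"
  shows "F v = 0 \<longleftrightarrow> F w = 0"
proof -
  obtain c where "c \<noteq> 0" "w = (\<lambda>i. c * v i)" using proj_point_cases[OF assms(2,3)] assms(4) by blast
  then show ?thesis using assms(1) by (auto simp: homogeneous_def)
qed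

definition nonzero_at :: "((nat \<Rightarrow> 'k::field) \<Rightarrow> 'k) \<Rightarrow> 'k proj_point \<Rightarrow> bool" where
  "nonzero_at F x \<longleftrightarrow> (\<forall>v\<in>x. F v \<noteq> 0)"

lemma openin_proj_zariski:
  "openin (proj_zariski n) W \<longleftrightarrow>
     generate_topology_on {{x \<in> proj_points n. nonzero_at F x} | F d. F \<in> forms n d} W"
  unfolding proj_zariski_def openin_topology_generated_by_iff nonzero_at_def ..

lemma open_nonzero: "F \<in> forms n d \<Longrightarrow> openin (proj_zariski n) {x \<in> proj_points n. nonzero_at F x}"
  unfolding openin_proj_zariski by (rule generate_topology_on.Basis) blast

text \<open>The intersection of the nonvanishing loci of \<open>F\<close> and \<open>G\<close> is
  that of \<open>F * G\<close>, so the loci of products of generators form a basis.\<close>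

lemma open_contains_basic:
  assumes "openin (proj_zariski n) W" "x \<in> W"
  shows "\<exists>F \<in> polynomial_functions (Suc n). homogeneous F \<and> nonzero_at F x \<and>
    {y \<in> proj_points n. nonzero_at F y} \<subseteq> W"
  using assms unfolding openin_proj_zariski
proof (induction arbitrary: x rule: generate_topology_on.induct)
  case (Int a b)
  obtain F where F: "F \<in> polynomial_functions (Suc n)" "homogeneous F" "nonzero_at F x"
      "{y \<in> proj_points n. nonzero_at F y} \<subseteq> a"
    using Int.IH(1)[OF IntD1[OF Int.prems]] by blast
  obtain G where G: "G \<in> polynomial_functions (Suc n)" "homogeneous G" "nonzero_at G x"
      "{y \<in> proj_points n. nonzero_at G y} \<subseteq> b"
    using Int.IH(2)[OF IntD2[OF Int.prems]] by blast
  have "F * G \<in> polynomial_functions (Suc n)"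
    using F G subring_polynomial_functions[of "Suc n"] unfolding subring_def by blast
  moreover have "homogeneous (F * G)"
  proof -
    obtain d e where "\<And>c v. F (\<lambda>i. c * v i) = c ^ d * F v" "\<And>c v. G (\<lambda>i. c * v i) = c ^ e * G v"
      using F G unfolding homogeneous_def by blast
    then have "(F * G) (\<lambda>i. c * v i) = c ^ (d + e) * (F * G) v" for c v
      by (simp add: times_fun_def power_add algebra_simps)
    then show ?thesis unfolding homogeneous_def by blast
  qed
  moreover have iff: "nonzero_at (F * G) y \<longleftrightarrow> nonzero_at F y \<and> nonzero_at G y" for y
    by (auto simp: nonzero_at_def times_fun_def)
  have "{y \<in> proj_points n. nonzero_at (F * G) y} \<subseteq> a \<inter> b" unfolding iff using F(4) G(4) by blast
  moreover have "nonzero_at (F * G) x" unfolding iff using F(3) G(3) by blast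
  ultimately show ?case by blast
next
  case (UN K)
  then obtain k where k: "k \<in> K" "x \<in> k" by blast
  from UN.IH[OF this] k show ?case by blast
next
  case (Basis s)
  then obtain F d where F: "F \<in> forms n d" "s = {x \<in> proj_points n. nonzero_at F x}" by blast
  then show ?case using Basis forms_polynomial[OF F(1)] forms_homogeneous[OF F(1)] by blast
qed simp

definition noetherian_space :: "'a topology \<Rightarrow> bool" where
  "noetherian_space T \<longleftrightarrow> wf {(A, B). closedin T A \<and> closedin T B \<and> A \<subset> B}"

lemma noetherian_proj_zariski: "noetherian_space (proj_zariski n :: 'k::field proj_point topology)"
proof -
  let ?R = "polynomial_functions (Suc n) :: ((nat \<Rightarrow> 'k) \<Rightarrow> 'k) set"
  let ?T = "proj_zariski n :: 'k proj_point topology"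
  define I where "I = (\<lambda>Z. {F \<in> ?R. \<forall>x\<in>Z. \<forall>v\<in>x. F v = 0})"
  have ideal: "ideal_of ?R (I Z)" for Z
    unfolding ideal_of_def
  proof (intro conjI ballI)
    show "I Z \<subseteq> ?R" by (auto simp: I_def)
    show "0 \<in> I Z" using subring_0[OF subring_polynomial_functions[of "Suc n"]] by (simp add: I_def zero_fun_def)
  next
    fix F G assume "F \<in> I Z" "G \<in> I Z"
    moreover from this have "F + G \<in> ?R"
      using subring_polynomial_functions[of "Suc n"] unfolding subring_def I_def by blast
    ultimately show "F + G \<in> I Z" unfolding I_def by (simp add: plus_fun_def)
  next
    fix F G assume "F \<in> ?R" "G \<in> I Z"
    moreover from this have "F * G \<in> ?R"
      using subring_polynomial_functions[of "Suc n"] unfolding subring_def I_def by blast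
    ultimately show "F * G \<in> I Z" unfolding I_def by (simp add: times_fun_def)
  qed
  \<comment> \<open>A point \<open>x\<close> of \<open>B\<close> outside \<open>A\<close> has a
    basic neighbourhood missing \<open>A\<close>; the function defining it vanishes on
    \<open>A\<close> but not at \<open>x\<close>. So the passage to vanishing ideals turns strict
    inclusions around.\<close>
  have desc: "I B \<subset> I A" if A: "closedin ?T A" and B: "closedin ?T B" and AB: "A \<subset> B" for A B
  proof -
    obtain x where x: "x \<in> B" "x \<notin> A" using AB by blast
    have sub: "A \<subseteq> topspace ?T" "B \<subseteq> topspace ?T" using A B closedin_subset by blast+
    have top: "topspace ?T \<subseteq> proj_points n" unfolding proj_zariski_def by auto
    have "openin ?T (topspace ?T - A)" using A by blast
    then obtain F where F: "F \<in> ?R" "homogeneous F" "nonzero_at F x"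
        "{y \<in> proj_points n. nonzero_at F y} \<subseteq> topspace ?T - A"
      using open_contains_basic[of n "topspace ?T - A" x] x sub by blast
    have "F v = 0" if "y \<in> A" "v \<in> y" for y v
    proof -
      have y: "y \<in> proj_points n" using that sub top by blast
      then have "\<not> nonzero_at F y" using F(4) that by blast
      then show ?thesis using homogeneous_zero_iff[OF F(2) y that(2)] unfolding nonzero_at_def by blast
    qed
    then have "F \<in> I A" using F by (simp add: I_def)
    moreover have "F \<notin> I B"
      using F(3) x proj_point_nonempty[of x n] sub top unfolding I_def nonzero_at_def by blast
    moreover have "I B \<subseteq> I A" using AB by (auto simp: I_def)
    ultimately show ?thesis by blast
  qed
  have "{(A, B). closedin ?T A \<and> closedin ?T B \<and> A \<subset> B} \<subseteq>
      inv_image {(J, I). ideal_of ?R I \<and> ideal_of ?R J \<and> I \<subset> J} I"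
  proof
    fix p assume "p \<in> {(A, B). closedin ?T A \<and> closedin ?T B \<and> A \<subset> B}"
    then obtain A B where p: "p = (A, B)" "closedin ?T A" "closedin ?T B" "A \<subset> B" by blast
    show "p \<in> inv_image {(J, I). ideal_of ?R I \<and> ideal_of ?R J \<and> I \<subset> J} I"
      unfolding p(1) inv_image_def using ideal desc[OF p(2-4)] by simp
  qed
  then show ?thesis
    unfolding noetherian_space_def
    by (rule wf_subset[rotated]) (rule wf_inv_image[OF wf_ideals[OF noetherian_polynomial_functions]])
qed

lemma forms_add: "F \<in> forms n d \<Longrightarrow> G \<in> forms n d \<Longrightarrow> (\<lambda>v. F v + G v) \<in> forms n d"
proof -
  assume "F \<in> forms n d" "G \<in> forms n d"
  then obtain b c where "F = (\<lambda>v. \<Sum>a \<in> {a \<in> {..n} \<rightarrow>\<^sub>E {..d}. (\<Sum>i\<le>n. a i) = d}. b a * (\<Prod>i\<le>n. v i ^ a i))"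
    "G = (\<lambda>v. \<Sum>a \<in> {a \<in> {..n} \<rightarrow>\<^sub>E {..d}. (\<Sum>i\<le>n. a i) = d}. c a * (\<Prod>i\<le>n. v i ^ a i))"
    by (auto simp: forms_def)
  then show ?thesis
    unfolding forms_def by (intro CollectI exI[of _ "\<lambda>a. b a + c a"]) (simp add: algebra_simps sum.distrib)
qed

lemma forms_cmult: "F \<in> forms n d \<Longrightarrow> (\<lambda>v. b * F v) \<in> forms n d"
proof -
  assume "F \<in> forms n d"
  then obtain c where "F = (\<lambda>v. \<Sum>a \<in> {a \<in> {..n} \<rightarrow>\<^sub>E {..d}. (\<Sum>i\<le>n. a i) = d}. c a * (\<Prod>i\<le>n. v i ^ a i))"
    by (auto simp: forms_def)
  then show ?thesis
    unfolding forms_def by (intro CollectI exI[of _ "\<lambda>a. b * c a"]) (simp add: sum_distrib_left mult.assoc)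
qed

text \<open>Every point has a nonzero coordinate, so these powers supply, in each degree, a
  denominator that does not vanish at a given point.\<close>

lemma coordinate_power_form:
  assumes "i \<le> n"
  shows "(\<lambda>v. v i ^ d) \<in> forms n d"
proof -
  define S where "S = {a \<in> {..n} \<rightarrow>\<^sub>E {..d}. (\<Sum>i\<le>n. a i) = d}"
  \<comment> \<open>The exponent vector with single entry \<open>d\<close> at \<open>i\<close>;
    \<open>restrict\<close> is there because the exponents in \<open>forms\<close> are extensional
    functions on \<open>{..n}\<close>.\<close>
  define e where "e = restrict (\<lambda>j. if j = i then d else 0) {..n}"
  have fin: "finite S" unfolding S_def by (rule finite_subset[OF _ finite_PiE[of "{..n}" "\<lambda>_. {..d}"]]) auto
  have "(\<Sum>j\<le>n. e j) = (\<Sum>j\<le>n. if j = i then d else 0)" by (rule sum.cong) (auto simp: e_def)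
  then have "e \<in> S" using assms by (auto simp: S_def e_def)
  have "v i ^ d = (\<Sum>a\<in>S. (if a = e then 1 else 0) * (\<Prod>j\<le>n. v j ^ a j))" for v :: "nat \<Rightarrow> 'a"
  proof -
    have "(\<Sum>a\<in>S. (if a = e then 1 else 0) * (\<Prod>j\<le>n. v j ^ a j)) = (\<Sum>a\<in>S. if a = e then (\<Prod>j\<le>n. v j ^ a j) else 0)"
      by (rule sum.cong) auto
    also have "\<dots> = (\<Prod>j\<le>n. v j ^ e j)" using fin \<open>e \<in> S\<close> by simp
    also have "\<dots> = (\<Prod>j\<le>n. if j = i then v j ^ d else 1)" by (rule prod.cong) (auto simp: e_def)
    also have "\<dots> = v i ^ d" using assms by simp
    finally show ?thesis by simp
  qed
  then have "(\<lambda>v. v i ^ d) = (\<lambda>v::nat \<Rightarrow> 'a. \<Sum>a\<in>S. (if a = e then 1 else 0) * (\<Prod>j\<le>n. v j ^ a j))"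
    by (rule ext)
  then show ?thesis unfolding forms_def S_def mem_Collect_eq by (rule exI[of _ "\<lambda>a. if a = e then 1 else 0"])
qed

lemma linear_form:
  assumes "i \<le> n" "j \<le> n"
  shows "(\<lambda>v. a * v i + b * v j) \<in> forms n 1"
proof -
  have "(\<lambda>v. v i ^ 1) \<in> forms n 1" "(\<lambda>v. v j ^ 1) \<in> forms n 1"
    using coordinate_power_form assms by blast+
  from forms_add[OF forms_cmult[OF this(1), of a] forms_cmult[OF this(2), of b]]
  show ?thesis by simp
qed

lemma topspace_proj_zariski: "topspace (proj_zariski n) = (proj_points n :: 'k::field proj_point set)"
proof
  show "topspace (proj_zariski n) \<subseteq> (proj_points n :: 'k proj_point set)" unfolding proj_zariski_def by auto
  show "(proj_points n :: 'k proj_point set) \<subseteq> topspace (proj_zariski n)"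
  proof
    fix x :: "'k proj_point" assume x: "x \<in> proj_points n"
    have "nonzero_at (\<lambda>v. v 0 ^ 0) x" by (simp add: nonzero_at_def)
    then show "x \<in> topspace (proj_zariski n)"
      using openin_subset[OF open_nonzero[OF coordinate_power_form[of 0 n 0]]] x by auto
  qed
qed

lemma t1_proj_zariski: "t1_space (proj_zariski n)"
  unfolding t1_space_def topspace_proj_zariski
proof (intro ballI impI)
  fix x y :: "'a proj_point" assume xy: "x \<in> proj_points n" "y \<in> proj_points n" "x \<noteq> y"
  obtain v w where v: "v \<in> y" and w: "w \<in> x" using proj_point_nonempty xy by blast
  obtain i where i: "i \<le> n" "v i \<noteq> 0" "\<And>i. i > n \<Longrightarrow> v i = 0" "y = {w. \<exists>c. c \<noteq> 0 \<and> w = (\<lambda>i. c * v i)}"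
    by (rule proj_point_cases[OF xy(2) v], rule that)
  obtain m where m: "w m \<noteq> 0" "\<And>i. i > n \<Longrightarrow> w i = 0" "x = {u. \<exists>c. c \<noteq> 0 \<and> u = (\<lambda>i. c * w i)}"
    by (rule proj_point_cases[OF xy(1) w], rule that)
  \<comment> \<open>If these 2 by 2 minors all vanished, \<open>w\<close> would be the multiple of
    \<open>v\<close> by \<open>w i / v i\<close> and the points would coincide. With
    \<open>w\<close> replaced by a variable, a nonzero minor is a linear form that vanishes at
    \<open>y\<close> but not at \<open>x\<close>.\<close>
  have "\<exists>j\<le>n. v i * w j - v j * w i \<noteq> 0"
  proof (rule ccontr)
    assume "\<not> ?thesis"
    then have eq: "v i * w j = v j * w i" if "j \<le> n" for j using that by auto
    have eq: "w j = (w i / v i) * v j" for j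
    proof (cases "j \<le> n")
      case True
      then show ?thesis using eq[of j] i(2) by (simp add: field_simps)
    next
      case False
      then show ?thesis using i(3) m(2) by simp
    qed
    have c: "w i / v i \<noteq> 0" using m(1) eq[of m] by auto
    have "w = (\<lambda>j. (w i / v i) * v j)" using eq by blast
    then have "w \<in> y" unfolding i(4) using c by blast
    then have "y = {u. \<exists>c. c \<noteq> 0 \<and> u = (\<lambda>i. c * w i)}" by (rule proj_point_cases[OF xy(2)])
    then show False using m(3) xy(3) by simp
  qed
  then obtain j where j: "j \<le> n" "v i * w j - v j * w i \<noteq> 0" by blast
  define F where "F = (\<lambda>u. v i * u j + (- v j) * u i)"
  have F: "F \<in> forms n 1" unfolding F_def using linear_form[OF j(1) i(1)] .
  have "nonzero_at F x"
    unfolding nonzero_at_def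
    using homogeneous_zero_iff[OF forms_homogeneous[OF F] xy(1) w] j(2) by (auto simp: F_def)
  moreover have "\<not> nonzero_at F y" unfolding nonzero_at_def using v by (auto simp: F_def intro!: bexI[of _ v])
  ultimately show "\<exists>U. openin (proj_zariski n) U \<and> x \<in> U \<and> y \<notin> U"
    using open_nonzero[OF F] xy by (intro exI[of _ "{x \<in> proj_points n. nonzero_at F x}"]) auto
qed

lemma irreducible_setD:
  assumes "irreducible_set T Z" "openin T U" "openin T V" "U \<inter> Z \<noteq> {}" "V \<inter> Z \<noteq> {}"
  shows "U \<inter> V \<inter> Z \<noteq> {}"
proof
  assume "U \<inter> V \<inter> Z = {}"
  then have "Z \<subseteq> (topspace T - U) \<union> (topspace T - V)" using assms(1) by (auto simp: irreducible_set_def)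
  moreover have "closedin T (topspace T - U)" "closedin T (topspace T - V)" using assms by auto
  ultimately have "Z \<subseteq> topspace T - U \<or> Z \<subseteq> topspace T - V" using assms(1) unfolding irreducible_set_def by blast
  then show False using assms(4,5) by blast
qed

text \<open>Regular functions are quotients of forms of equal degree, so here an actual form is
  required. Irreducibility makes one possible: if \<open>a \<inter> b\<close> misses
  \<open>Z\<close>, then \<open>a\<close> or \<open>b\<close> alone does, and the search ends at a
  single generator.\<close>

lemma separating_form:
  assumes "openin (proj_zariski n) W" "x \<in> W" "irreducible_set (proj_zariski n) Z" "W \<inter> Z = {}"
  shows "\<exists>d F. F \<in> forms n d \<and> nonzero_at F x \<and> (\<forall>y\<in>Z. \<not> nonzero_at F y)"
  using assms(1,2,4) unfolding openin_proj_zariski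
proof (induction arbitrary: x rule: generate_topology_on.induct)
  case (Int a b)
  have "a \<inter> Z = {} \<or> b \<inter> Z = {}"
    using irreducible_setD[OF assms(3), of a b] Int.hyps Int.prems unfolding openin_proj_zariski by blast
  then show ?case using Int.IH Int.prems by blast
next
  case (UN K)
  then obtain k where k: "k \<in> K" "x \<in> k" by blast
  moreover have "k \<inter> Z = {}" using UN.prems k by blast
  ultimately show ?case using UN.IH by blast
next
  case (Basis s)
  then obtain F d where F: "F \<in> forms n d" "s = {x \<in> proj_points n. nonzero_at F x}" by blast
  have "Z \<subseteq> proj_points n" using assms(3) by (simp add: irreducible_set_def topspace_proj_zariski)
  then have "\<forall>y\<in>Z. \<not> nonzero_at F y" using F Basis by blast
  then show ?case using F Basis by blast
qed simp

section \<open>Components and nonsingular points\<close>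

lemma noetherian_subtopology:
  assumes "noetherian_space T" "closedin T Z"
  shows "noetherian_space (subtopology T Z)"
  unfolding noetherian_space_def
proof (rule wf_subset[OF assms(1)[unfolded noetherian_space_def]])
  show "{(A, B). closedin (subtopology T Z) A \<and> closedin (subtopology T Z) B \<and> A \<subset> B}
    \<subseteq> {(A, B). closedin T A \<and> closedin T B \<and> A \<subset> B}"
    using closedin_trans_full[OF _ assms(2)] by blast
qed

lemma noetherian_decomposition:
  assumes T: "noetherian_space T" and A: "closedin T A"
  shows "\<exists>F. finite F \<and> A = \<Union>F \<and> (\<forall>Z\<in>F. closedin T Z \<and> irreducible_set T Z)"
  using A
proof (induction A rule: wf_induct_rule[OF T[unfolded noetherian_space_def]])
  case (1 A)
  show ?case
  proof (cases "A = {} \<or> irreducible_set T A")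
    case True
    then show ?thesis
    proof
      assume "A = {}"
      then show ?thesis by (intro exI[of _ "{}"]) simp
    next
      assume "irreducible_set T A"
      then show ?thesis using 1 by (intro exI[of _ "{A}"]) simp
    qed
  next
    case False
    then obtain B C where BC: "closedin T B" "closedin T C" "A \<subseteq> B \<union> C" "\<not> A \<subseteq> B" "\<not> A \<subseteq> C"
      using 1 closedin_subset unfolding irreducible_set_def by metis
    have "\<exists>F. finite F \<and> A \<inter> D = \<Union>F \<and> (\<forall>Z\<in>F. closedin T Z \<and> irreducible_set T Z)"
      if "closedin T D" "\<not> A \<subseteq> D" for D
    proof (rule "1.IH")
      have "closedin T (A \<inter> D)" using that 1 by blast
      then show "(A \<inter> D, A) \<in> {(A, B). closedin T A \<and> closedin T B \<and> A \<subset> B}" using that 1 by blast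
      show "closedin T (A \<inter> D)" by fact
    qed
    note dec = this
    obtain F where F: "finite F" "A \<inter> B = \<Union>F" "\<forall>Z\<in>F. closedin T Z \<and> irreducible_set T Z"
      using dec[OF BC(1,4)] by (elim exE conjE) (rule that)
    obtain F' where F': "finite F'" "A \<inter> C = \<Union>F'" "\<forall>Z\<in>F'. closedin T Z \<and> irreducible_set T Z"
      using dec[OF BC(2,5)] by (elim exE conjE) (rule that)
    have "A = \<Union>(F \<union> F')" unfolding Union_Un_distrib F(2)[symmetric] F'(2)[symmetric] using BC(3) by blast
    moreover have "finite (F \<union> F')" "\<forall>Z\<in>F \<union> F'. closedin T Z \<and> irreducible_set T Z"
      using F(1,3) F'(1,3) by (simp, blast)
    ultimately show ?thesis by (intro exI[of _ "F \<union> F'"] conjI)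
  qed
qed

lemma irreducible_in_finite_union:
  assumes "irreducible_set T Z" "finite F" "\<And>A. A \<in> F \<Longrightarrow> closedin T A" "Z \<subseteq> \<Union>F"
  shows "\<exists>A\<in>F. Z \<subseteq> A"
  using assms(2,3,4)
proof (induction F)
  case empty
  then show ?case using assms(1) by (simp add: irreducible_set_def)
next
  case (insert A F)
  have "closedin T A" "closedin T (\<Union>F)" using insert by (auto intro: closedin_Union)
  then have "Z \<subseteq> A \<or> Z \<subseteq> \<Union>F" using assms(1) insert.prems unfolding irreducible_set_def by simp
  then show ?case using insert by auto
qed

lemma noetherian_components:
  assumes T: "noetherian_space T"
  shows "finite (irreducible_components T)" "\<And>Z. Z \<in> irreducible_components T \<Longrightarrow> closedin T Z"
    "\<Union>(irreducible_components T) = topspace T"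
proof -
  obtain F where F: "finite F" "topspace T = \<Union>F" "\<And>Z. Z \<in> F \<Longrightarrow> closedin T Z" "\<And>Z. Z \<in> F \<Longrightarrow> irreducible_set T Z"
    using noetherian_decomposition[OF T closedin_topspace] by blast
  have inF: "\<exists>A\<in>F. Z \<subseteq> A" if "irreducible_set T Z" for Z
    by (rule irreducible_in_finite_union[OF that F(1,3)]) (use that F in \<open>auto simp: irreducible_set_def\<close>)
  have sub: "irreducible_components T \<subseteq> F"
  proof
    fix Z assume Z: "Z \<in> irreducible_components T"
    then have "irreducible_set T Z" by (simp add: irreducible_components_def)
    then obtain A where A: "A \<in> F" "Z \<subseteq> A" using inF by blast
    then have "A = Z" using Z F(4) unfolding irreducible_components_def by blast
    then show "Z \<in> F" using A by simp
  qed
  show "finite (irreducible_components T)" using sub F(1) by (rule finite_subset)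
  show "closedin T Z" if "Z \<in> irreducible_components T" for Z using that sub F(3) by blast
  show "\<Union>(irreducible_components T) = topspace T"
  proof (intro equalityI Union_least)
    fix Z assume "Z \<in> irreducible_components T"
    then show "Z \<subseteq> topspace T" unfolding irreducible_components_def irreducible_set_def by blast
  next
    show "topspace T \<subseteq> \<Union>(irreducible_components T)"
    proof
      fix x assume "x \<in> topspace T"
      then obtain A where A: "A \<in> F" "x \<in> A" using F(2) by blast
      have "finite {M \<in> F. A \<subseteq> M}" "A \<in> {M \<in> F. A \<subseteq> M}" using A F(1) by auto
      then obtain M where M: "M \<in> {M \<in> F. A \<subseteq> M}" "\<forall>B\<in>{M \<in> F. A \<subseteq> M}. M \<subseteq> B \<longrightarrow> M = B"
        using finite_has_maximal[of "{M \<in> F. A \<subseteq> M}"] by blast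
      have "M \<in> irreducible_components T"
        unfolding irreducible_components_def
      proof (intro CollectI conjI allI impI)
        show "irreducible_set T M" using M F(4) by blast
        fix W assume W: "irreducible_set T W" "M \<subseteq> W"
        then obtain B where B: "B \<in> F" "W \<subseteq> B" using inF by blast
        then have "M = B" using M W by blast
        then show "W = M" using B W by blast
      qed
      then show "x \<in> \<Union>(irreducible_components T)" using M A by blast
    qed
  qed
qed

lemma irreducible_component_maximal:
  assumes "Z \<in> irreducible_components T" "W \<in> irreducible_components T" "Z \<subseteq> W"
  shows "Z = W"
  using assms unfolding irreducible_components_def by blast

lemma irreducible_singleton: "x \<in> topspace T \<Longrightarrow> irreducible_set T {x}"
  unfolding irreducible_set_def by blast

lemma irreducible_connected:
  assumes "irreducible_set T Z"
  shows "connectedin T Z"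
  unfolding connectedin_closedin
proof (intro conjI notI)
  show "Z \<subseteq> topspace T" using assms by (simp add: irreducible_set_def)
  assume "\<exists>E1 E2. closedin T E1 \<and> closedin T E2 \<and> Z \<subseteq> E1 \<union> E2 \<and> E1 \<inter> E2 \<inter> Z = {} \<and> E1 \<inter> Z \<noteq> {} \<and> E2 \<inter> Z \<noteq> {}"
  then obtain E1 E2 where E: "closedin T E1" "closedin T E2" "Z \<subseteq> E1 \<union> E2" "E1 \<inter> E2 \<inter> Z = {}"
    "E1 \<inter> Z \<noteq> {}" "E2 \<inter> Z \<noteq> {}" by (elim exE conjE) (rule that)
  then have "Z \<subseteq> E1 \<or> Z \<subseteq> E2" using assms unfolding irreducible_set_def by metis
  then show False using E(4-6) by blast
qed

text \<open>\<open>F \<inter> Z\<close> is closed in a T1 space, so it can be added to a closed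
  cover of \<open>Z - F\<close>; an infinite irreducible \<open>Z\<close> cannot be inside it and
  must lie in one of the other two sets.\<close>

lemma irreducible_minus_finite:
  assumes T: "t1_space T" and Z: "irreducible_set T Z" "infinite Z" and F: "finite F"
  shows "irreducible_set T (Z - F)"
  unfolding irreducible_set_def
proof (intro conjI allI impI)
  show "Z - F \<subseteq> topspace T" using Z by (auto simp: irreducible_set_def)
  show "Z - F \<noteq> {}" using Z(2) F by (metis finite.emptyI finite_Diff2)
  fix A B assume AB: "closedin T A" "closedin T B" "Z - F \<subseteq> A \<union> B"
  have "F \<inter> Z \<subseteq> topspace T" "finite (F \<inter> Z)" using Z F by (auto simp: irreducible_set_def)
  then have cF: "closedin T (F \<inter> Z)" using T by (simp add: t1_space_closedin_finite)
  have "Z \<subseteq> A \<union> (B \<union> (F \<inter> Z))" using AB by blast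
  then have "Z \<subseteq> A \<or> Z \<subseteq> B \<union> (F \<inter> Z)" using Z(1) AB cF unfolding irreducible_set_def by (metis closedin_Un)
  moreover have "Z \<subseteq> B \<or> Z \<subseteq> F \<inter> Z" if "Z \<subseteq> B \<union> (F \<inter> Z)"
    using that Z(1) AB cF unfolding irreducible_set_def by metis
  moreover have "\<not> Z \<subseteq> F \<inter> Z" using Z(2) F by (metis finite_Int finite_subset)
  ultimately show "Z - F \<subseteq> A \<or> Z - F \<subseteq> B" by blast
qed

text \<open>A finite irreducible set in a T1 space is a point, which leaves no room for the smaller
  irreducible set demanded by dimension one.\<close>

lemma infinite_component:
  assumes T: "t1_space T" and dim: "pure_dim_one T" and Z: "Z \<in> irreducible_components T"
  shows "infinite Z"
proof
  assume fin: "finite Z"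
  have irr: "irreducible_set T Z" using Z by (simp add: irreducible_components_def)
  then have ZT: "Z \<subseteq> topspace T" by (simp add: irreducible_set_def)
  obtain W where W: "irreducible_set T W" "W \<subset> Z" using dim Z unfolding pure_dim_one_def by blast
  have "\<exists>A\<in>(\<lambda>x. {x}) ` Z. Z \<subseteq> A"
    by (rule irreducible_in_finite_union[OF irr])
      (use fin ZT T in \<open>auto simp: t1_space_closedin_singleton\<close>)
  then obtain x where "Z \<subseteq> {x}" by blast
  moreover have "W \<noteq> {}" using W(1) by (simp add: irreducible_set_def)
  ultimately show False using W(2) by blast
qed

text \<open>Each irreducible piece \<open>W\<close> of \<open>A\<close> is a point: otherwise a
  point of \<open>W\<close>, \<open>W\<close> and \<open>Z\<close> would be a chain that is too long
  for dimension one.\<close>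

lemma proper_closed_finite:
  assumes T: "noetherian_space T" "t1_space T" and dim: "pure_dim_one T"
    and Z: "Z \<in> irreducible_components T" and A: "closedin T A" "A \<subset> Z"
  shows "finite A"
proof -
  obtain F where F: "finite F" "A = \<Union>F" "\<And>W. W \<in> F \<Longrightarrow> closedin T W" "\<And>W. W \<in> F \<Longrightarrow> irreducible_set T W"
    using noetherian_decomposition[OF T(1) A(1)] by (metis (no_types))
  have "finite W" if W: "W \<in> F" for W
  proof -
    have WT: "W \<subseteq> topspace T" "W \<noteq> {}" using F(4)[OF W] by (auto simp: irreducible_set_def)
    then obtain w where w: "w \<in> W" "w \<in> topspace T" by blast
    have "closedin T {w}" "irreducible_set T {w}"
      using T(2) w by (auto simp: t1_space_closedin_singleton irreducible_singleton)
    moreover have "W \<subset> Z" using W F(2) A(2) by blast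
    ultimately have "\<not> {w} \<subset> W" using dim Z F(3,4)[OF W] unfolding pure_dim_one_def by blast
    then have "W = {w}" using w by blast
    then show ?thesis by simp
  qed
  then show ?thesis using F by blast
qed

lemma regular_nonzero_near:
  assumes "u \<in> regular_at (closed_subvariety n Z) p" "u p \<noteq> 0"
  shows "near (closed_subvariety n Z) p (\<lambda>y. u y \<noteq> 0)"
proof -
  have "\<exists>V d F G. openin (subtopology (proj_zariski n) Z) V \<and> p \<in> V \<and> F \<in> forms n d \<and> G \<in> forms n d \<and>
      (\<forall>y\<in>V. \<forall>v\<in>y. G v \<noteq> 0 \<and> u y = F v / G v)"
    using assms(1) by (simp add: closed_subvariety_def)
  then obtain V d F G where V: "openin (subtopology (proj_zariski n) Z) V" "p \<in> V" "F \<in> forms n d"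
    "\<And>y v. y \<in> V \<Longrightarrow> v \<in> y \<Longrightarrow> G v \<noteq> 0 \<and> u y = F v / G v"
    by blast
  have VP: "V \<subseteq> proj_points n" using openin_subset[OF V(1)] by (simp add: topspace_proj_zariski)
  have "openin (subtopology (proj_zariski n) Z) (V \<inter> {y \<in> proj_points n. nonzero_at F y})"
  proof -
    have "openin (subtopology (proj_zariski n) Z) (Z \<inter> {y \<in> proj_points n. nonzero_at F y})"
      by (rule openin_subtopology_Int2[OF open_nonzero[OF V(3)]])
    moreover have eq: "V \<inter> {y \<in> proj_points n. nonzero_at F y} = V \<inter> (Z \<inter> {y \<in> proj_points n. nonzero_at F y})"
      using openin_subset[OF V(1)] by auto
    ultimately show ?thesis unfolding eq using openin_Int[OF V(1)] by blast
  qed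
  moreover have "nonzero_at F p" using assms(2) V(2,4) by (auto simp: nonzero_at_def)
  moreover have "u y \<noteq> 0" if y: "y \<in> V" "nonzero_at F y" for y
  proof -
    have "y \<in> proj_points n" using y VP by blast
    then obtain v where "v \<in> y" using proj_point_nonempty by blast
    then show ?thesis using V(4)[OF y(1)] y(2) by (simp add: nonzero_at_def)
  qed
  ultimately show ?thesis using V(2) VP unfolding near_def
    by (intro exI[of _ "V \<inter> {y \<in> proj_points n. nonzero_at F y}"]) (auto simp: closed_subvariety_def)
qed

lemma irreducible_subtopology:
  assumes "irreducible_set (subtopology T Z) W"
  shows "irreducible_set T W"
  unfolding irreducible_set_def
proof (intro conjI allI impI)
  show "W \<subseteq> topspace T" "W \<noteq> {}" using assms by (auto simp: irreducible_set_def)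
  fix A B assume AB: "closedin T A" "closedin T B" "W \<subseteq> A \<union> B"
  have "W \<subseteq> Z" using assms by (auto simp: irreducible_set_def)
  then have "W \<subseteq> (Z \<inter> A) \<union> (Z \<inter> B)" using AB by blast
  moreover have "closedin (subtopology T Z) (Z \<inter> A)" "closedin (subtopology T Z) (Z \<inter> B)"
    unfolding closedin_subtopology using AB by blast+
  ultimately have "W \<subseteq> Z \<inter> A \<or> W \<subseteq> Z \<inter> B" using assms unfolding irreducible_set_def by blast
  then show "W \<subseteq> A \<or> W \<subseteq> B" by blast
qed

text \<open>A germ at \<open>p\<close> that vanishes on \<open>Z2\<close> but not on
  \<open>Z1\<close> near \<open>p\<close>. It is a form separating the two components, divided by a
  form of the same degree that is nonzero at \<open>p\<close>.\<close>

lemma separating_function: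
  fixes n :: nat and Z :: "'k::field proj_point set"
  defines "X \<equiv> closed_subvariety n Z"
  assumes Z: "closedin (proj_zariski n) Z"
    and Z1: "Z1 \<in> irreducible_components (zariski X)" and Z2: "Z2 \<in> irreducible_components (zariski X)"
    and "Z1 \<noteq> Z2" "p \<in> Z1" "p \<in> Z2"
  obtains h V U where "h \<in> regular_at X p" "openin (zariski X) V" "p \<in> V" "\<And>y. y \<in> V \<Longrightarrow> y \<in> Z2 \<Longrightarrow> h y = 0"
    "openin (zariski X) U" "U \<inter> Z1 \<noteq> {}" "\<And>y. y \<in> V \<Longrightarrow> y \<in> U \<Longrightarrow> h y \<noteq> 0"
proof -
  let ?P = "proj_zariski n :: 'k proj_point topology"
  have zX: "zariski X = subtopology ?P Z" by (simp add: X_def closed_subvariety_def)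
  have noeth: "noetherian_space (zariski X)"
    unfolding zX by (rule noetherian_subtopology[OF noetherian_proj_zariski Z])
  obtain x where x: "x \<in> Z1" "x \<notin> Z2" using irreducible_component_maximal[OF Z1 Z2] assms(5) by blast
  have irr: "irreducible_set (zariski X) Z1" "irreducible_set (zariski X) Z2"
    using Z1 Z2 by (auto simp: irreducible_components_def)
  have sub: "Z1 \<subseteq> topspace ?P" "Z2 \<subseteq> topspace ?P" "Z1 \<subseteq> Z" using irr by (auto simp: irreducible_set_def zX)
  have "closedin ?P Z2" using noetherian_components(2)[OF noeth Z2] closedin_trans_full[OF _ Z] unfolding zX by blast
  then have "openin ?P (topspace ?P - Z2)" by blast
  moreover have "irreducible_set ?P Z2" using irr(2) irreducible_subtopology unfolding zX by blast
  ultimately obtain d F where F: "F \<in> forms n d" "nonzero_at F x" "\<And>y. y \<in> Z2 \<Longrightarrow> \<not> nonzero_at F y"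
    using separating_form[of n "topspace ?P - Z2" x Z2] x sub by blast
  have pP: "p \<in> proj_points n" using assms(6) sub by (auto simp: topspace_proj_zariski)
  then obtain v where v: "v \<in> p" using proj_point_nonempty by blast
  obtain i where i: "i \<le> n" "v i \<noteq> 0" by (rule proj_point_cases[OF pP v])
  define G where "G = (\<lambda>v::nat \<Rightarrow> 'k. v i ^ d)"
  have G: "G \<in> forms n d" unfolding G_def by (rule coordinate_power_form[OF i(1)])
  have Gp: "nonzero_at G p"
    using homogeneous_zero_iff[OF forms_homogeneous[OF G] pP v] i(2) by (auto simp: nonzero_at_def G_def)
  \<comment> \<open>Numerator and denominator scale by the same power \<open>c ^ d\<close>, so the
    representative picked by \<open>SOME\<close> does not affect the value.\<close>
  define h where "h = (\<lambda>y. F (SOME v. v \<in> y) / G (SOME v. v \<in> y))"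
  define V where "V = Z \<inter> {y \<in> proj_points n. nonzero_at G y}"
  define U where "U = Z \<inter> {y \<in> proj_points n. nonzero_at F y}"
  have oV: "openin (zariski X) V" unfolding zX V_def by (rule openin_subtopology_Int2[OF open_nonzero[OF G]])
  have oU: "openin (zariski X) U" unfolding zX U_def by (rule openin_subtopology_Int2[OF open_nonzero[OF F(1)]])
  have hFG: "G w \<noteq> 0 \<and> h y = F w / G w" if "y \<in> V" "w \<in> y" for y w
  proof -
    have y: "y \<in> proj_points n" "nonzero_at G y" using that by (auto simp: V_def)
    define u where "u = (SOME v. v \<in> y)"
    have u: "u \<in> y" unfolding u_def by (rule someI[of "\<lambda>v. v \<in> y", OF that(2)])
    have "y = {x. \<exists>c. c \<noteq> 0 \<and> x = (\<lambda>i. c * w i)}" by (rule proj_point_cases[OF y(1) that(2)])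
    then obtain c where c: "c \<noteq> 0" "u = (\<lambda>i. c * w i)" using u by blast
    have "F u = c ^ d * F w" "G u = c ^ d * G w" unfolding c(2) by (rule forms_scale[OF F(1)], rule forms_scale[OF G])
    then have "h y = F w / G w" using c(1) unfolding h_def u_def[symmetric] by simp
    then show ?thesis using y(2) that(2) by (simp add: nonzero_at_def)
  qed
  have pV: "p \<in> V" using assms(6) sub pP Gp by (auto simp: V_def)
  have "\<exists>V d F G. openin (subtopology ?P Z) V \<and> p \<in> V \<and> F \<in> forms n d \<and> G \<in> forms n d \<and>
      (\<forall>y\<in>V. \<forall>w\<in>y. G w \<noteq> 0 \<and> h y = F w / G w)"
    using oV[unfolded zX] pV F(1) G hFG by blast
  then have "h \<in> regular_at X p" by (simp add: X_def closed_subvariety_def)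
  moreover have "h y = 0" if y: "y \<in> V" "y \<in> Z2" for y
  proof -
    obtain w where "w \<in> y" "F w = 0" using F(3)[OF y(2)] by (auto simp: nonzero_at_def)
    then show ?thesis using hFG[OF y(1)] by simp
  qed
  moreover have "h y \<noteq> 0" if y: "y \<in> V" "y \<in> U" for y
  proof -
    have "y \<in> proj_points n" using y(2) by (simp add: U_def)
    then obtain w where "w \<in> y" using proj_point_nonempty by blast
    moreover from this have "F w \<noteq> 0" using y(2) by (simp add: U_def nonzero_at_def)
    ultimately show ?thesis using hFG[OF y(1)] by simp
  qed
  moreover have "x \<in> U" using x F(2) sub by (auto simp: U_def topspace_proj_zariski)
  then have "U \<inter> Z1 \<noteq> {}" using x by blast
  ultimately show ?thesis using that[of h V U] oV oU pV by blast
qed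

text \<open>The zero set of a nonunit that is not locally zero agrees near \<open>p\<close> with that of the uniformizer
  \<open>t\<close>, whereas functions vanishing on only one of two components through \<open>p\<close> have different zero
  sets.\<close>

lemma nonsingular_one_component:
  fixes n :: nat and Z :: "'k::field proj_point set"
  defines "X \<equiv> closed_subvariety n Z"
  assumes Z: "closedin (proj_zariski n) Z" and ns: "nonsingular_at X p"
    and Z1: "Z1 \<in> irreducible_components (zariski X)" and Z2: "Z2 \<in> irreducible_components (zariski X)"
    and p: "p \<in> Z1" "p \<in> Z2"
  shows "Z1 = Z2"
proof (rule ccontr)
  assume ne: "Z1 \<noteq> Z2"
  obtain t where t: "t p = 0"
    and dvr: "\<And>f. f \<in> regular_at X p \<Longrightarrow> near X p (\<lambda>x. f x = 0) \<or>
        (\<exists>u \<in> regular_at X p. \<exists>m::nat. u p \<noteq> 0 \<and> near X p (\<lambda>x. f x = u x * t x ^ m))"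
    using ns unfolding nonsingular_at_def by blast
  have zeros: "near X p (\<lambda>y. h y = 0 \<longleftrightarrow> t y = 0)"
    if h: "h \<in> regular_at X p" "openin (zariski X) V" "p \<in> V" "\<And>y. y \<in> V \<Longrightarrow> y \<in> B \<Longrightarrow> h y = 0" "p \<in> B"
      "openin (zariski X) U" "U \<inter> A \<noteq> {}" "\<And>y. y \<in> V \<Longrightarrow> y \<in> U \<Longrightarrow> h y \<noteq> 0" "p \<in> A" "irreducible_set (zariski X) A"
    for h V U A B
  proof -
    have "\<not> near X p (\<lambda>x. h x = 0)"
    proof
      assume "near X p (\<lambda>x. h x = 0)"
      then obtain W where W: "openin (zariski X) W" "p \<in> W" "\<And>x. x \<in> W \<Longrightarrow> h x = 0" by (auto simp: near_def)
      have "(W \<inter> V) \<inter> U \<inter> A \<noteq> {}"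
        by (rule irreducible_setD[OF h(10)]) (use W h in auto)
      then show False using W(3) h(8) by blast
    qed
    then obtain u m where u: "u \<in> regular_at X p" "u p \<noteq> 0" "near X p (\<lambda>x. h x = u x * t x ^ m)"
      using dvr[OF h(1)] by blast
    obtain W where W: "openin (zariski X) W" "p \<in> W" "\<And>x. x \<in> W \<Longrightarrow> h x = u x * t x ^ m"
      using u(3) by (auto simp: near_def)
    obtain W' where W': "openin (zariski X) W'" "p \<in> W'" "\<And>x. x \<in> W' \<Longrightarrow> u x \<noteq> 0"
      using regular_nonzero_near[of u n Z p] u(1,2) unfolding X_def near_def by blast
    have "u p * t p ^ m = 0" using W(3)[OF W(2)] h(3,4,5) by simp
    then have "m \<noteq> 0" using u(2) by (cases m) auto
    then have "h x = 0 \<longleftrightarrow> t x = 0" if "x \<in> W \<inter> W'" for x using W(3)[of x] W'(3)[of x] that by simp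
    moreover have "openin (zariski X) (W \<inter> W')" "p \<in> W \<inter> W'" using W W' by auto
    ultimately show ?thesis unfolding near_def by blast
  qed
  have irr: "irreducible_set (zariski X) Z1" "irreducible_set (zariski X) Z2"
    using Z1 Z2 by (auto simp: irreducible_components_def)
  obtain h V U where h: "h \<in> regular_at X p" "openin (zariski X) V" "p \<in> V" "\<And>y. y \<in> V \<Longrightarrow> y \<in> Z2 \<Longrightarrow> h y = 0"
    "openin (zariski X) U" "U \<inter> Z1 \<noteq> {}" "\<And>y. y \<in> V \<Longrightarrow> y \<in> U \<Longrightarrow> h y \<noteq> 0"
    using separating_function[OF Z Z1[unfolded X_def] Z2[unfolded X_def] ne p] unfolding X_def by metis
  obtain h' V' U' where h': "h' \<in> regular_at X p" "openin (zariski X) V'" "p \<in> V'" "\<And>y. y \<in> V' \<Longrightarrow> y \<in> Z1 \<Longrightarrow> h' y = 0"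
    "openin (zariski X) U'" "U' \<inter> Z2 \<noteq> {}" "\<And>y. y \<in> V' \<Longrightarrow> y \<in> U' \<Longrightarrow> h' y \<noteq> 0"
    using separating_function[OF Z Z2[unfolded X_def] Z1[unfolded X_def] ne[symmetric] p(2,1)] unfolding X_def by metis
  obtain N where N: "openin (zariski X) N" "p \<in> N" "\<And>y. y \<in> N \<Longrightarrow> h y = 0 \<longleftrightarrow> t y = 0"
    using zeros[OF h(1-4) p(2) h(5-7) p(1) irr(1)] by (auto simp: near_def)
  obtain N' where N': "openin (zariski X) N'" "p \<in> N'" "\<And>y. y \<in> N' \<Longrightarrow> h' y = 0 \<longleftrightarrow> t y = 0"
    using zeros[OF h'(1-4) p(1) h'(5-7) p(2) irr(2)] by (auto simp: near_def)
  have "(N \<inter> N' \<inter> V \<inter> V') \<inter> U' \<inter> Z2 \<noteq> {}"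
    by (rule irreducible_setD[OF irr(2)]) (use N(1,2) N'(1,2) h(2,3) h'(2,3,5,6) p in auto)
  then obtain y where y: "y \<in> N" "y \<in> N'" "y \<in> V" "y \<in> V'" "y \<in> U'" "y \<in> Z2" by blast
  then have "h' y = 0" using h(4) N(3) N'(3) by blast
  then show False using h'(7) y by blast
qed

section \<open>Components of quotient spaces\<close>

text \<open>\<open>meet\<close> and \<open>chain\<close> together say that \<open>E\<close> is
  generated by the relation of meeting. The union over a class is closed, and so is its complement
  as a finite union of other pieces; being connected as well, it is a connected component.\<close>

lemma components_of_closed_cover:
  assumes I: "finite I" and K: "\<And>i. i \<in> I \<Longrightarrow> connectedin T (K i)" "\<And>i. i \<in> I \<Longrightarrow> closedin T (K i)"
      "\<And>i. i \<in> I \<Longrightarrow> K i \<noteq> {}" "topspace T = (\<Union>i\<in>I. K i)"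
    and E: "equiv I E" and meet: "\<And>i j. i \<in> I \<Longrightarrow> j \<in> I \<Longrightarrow> K i \<inter> K j \<noteq> {} \<Longrightarrow> (i, j) \<in> E"
    and chain: "\<And>i j. (i, j) \<in> E \<Longrightarrow> (i, j) \<in> {(i, j). i \<in> I \<and> j \<in> I \<and> K i \<inter> K j \<noteq> {}}\<^sup>*"
  shows "card (connected_components_of T) = card (I // E)"
proof -
  define U where "U = (\<lambda>c. \<Union>i\<in>c. K i)"
  have cI: "c \<subseteq> I" "c \<noteq> {}" if "c \<in> I // E" for c
    using that E in_quotient_imp_subset in_quotient_imp_non_empty by blast+
  have same: "c = c'" if "c \<in> I // E" "c' \<in> I // E" "i \<in> c" "j \<in> c'" "K i \<inter> K j \<noteq> {}" for c c' i j
    using quotient_eqI[OF E that(1-4)] meet cI that by blast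
  have ne: "U c \<noteq> {}" if "c \<in> I // E" for c using cI[OF that] K(3) unfolding U_def by blast
  have closed: "closedin T (\<Union>i\<in>J. K i)" if "J \<subseteq> I" for J
    using that I K(2) by (intro closedin_Union) (auto intro: finite_subset)
  have clopen: "closedin T (U c)" "openin T (U c)" if c: "c \<in> I // E" for c
  proof -
    show "closedin T (U c)" unfolding U_def by (rule closed) (rule cI[OF c])
    have "topspace T - U c = (\<Union>i\<in>I - c. K i)"
    proof (intro equalityI subsetI)
      fix x assume x: "x \<in> (\<Union>i\<in>I - c. K i)"
      then obtain i where i: "i \<in> I - c" "x \<in> K i" by blast
      have "x \<notin> K j" if "j \<in> c" for j
      proof
        assume "x \<in> K j"
        then have "(j, i) \<in> E" using i that meet cI[OF c] by blast
        then have "i \<in> c" using c that in_quotient_imp_closed[OF E] by metis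
        then show False using i by blast
      qed
      then show "x \<in> topspace T - U c" using i K(4) by (auto simp: U_def)
    qed (auto simp: U_def K(4))
    then have "closedin T (topspace T - U c)" using closed[of "I - c"] by simp
    moreover have "U c \<subseteq> topspace T" using cI[OF c] K(4) by (auto simp: U_def)
    ultimately show "openin T (U c)" by (simp add: openin_closedin)
  qed
  have conn: "connectedin T (U c)" if c: "c \<in> I // E" for c
  proof -
    obtain i where i: "i \<in> I" "c = E `` {i}" using c by (auto simp: quotient_def)
    have ic: "i \<in> c" unfolding i(2) by (rule equiv_class_self[OF E i(1)])
    have step: "\<exists>D. connectedin T D \<and> K i \<subseteq> D \<and> K j \<subseteq> D \<and> D \<subseteq> U c"
      if "(i, j) \<in> {(i, j). i \<in> I \<and> j \<in> I \<and> K i \<inter> K j \<noteq> {}}\<^sup>*" for j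
    proof -
      from that have "(i, j) \<in> E \<and> (\<exists>D. connectedin T D \<and> K i \<subseteq> D \<and> K j \<subseteq> D \<and> D \<subseteq> U c)"
      proof (induction rule: rtrancl_induct)
        case base
        have "(i, i) \<in> E" using ic i by simp
        moreover have "K i \<subseteq> U c" using ic by (auto simp: U_def)
        ultimately show ?case using K(1)[OF i(1)] by blast
      next
        case (step j l)
        then have jl: "j \<in> I" "l \<in> I" "K j \<inter> K l \<noteq> {}" by auto
        obtain D where D: "connectedin T D" "K i \<subseteq> D" "K j \<subseteq> D" "D \<subseteq> U c" using step.IH by blast
        have il: "(i, l) \<in> E" using step.IH meet[OF jl] E by (meson equivE transE)
        then have "K l \<subseteq> U c" using i by (auto simp: U_def)
        moreover have "connectedin T (D \<union> K l)"
          by (rule connectedin_Un[OF D(1) K(1)[OF jl(2)]]) (use D(3) jl(3) in blast)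
        ultimately show ?case using il D by blast
      qed
      then show ?thesis by blast
    qed
    have "\<forall>j\<in>c. \<exists>D. connectedin T D \<and> K i \<subseteq> D \<and> K j \<subseteq> D \<and> D \<subseteq> U c"
      using step chain i by blast
    then obtain D where D: "\<And>j. j \<in> c \<Longrightarrow> connectedin T (D j) \<and> K i \<subseteq> D j \<and> K j \<subseteq> D j \<and> D j \<subseteq> U c" by metis
    have "U c = \<Union>(D ` c)" using D unfolding U_def by blast
    moreover have "connectedin T (\<Union>(D ` c))"
      by (rule connectedin_Union) (use D K(3)[OF i(1)] ic in blast)+
    ultimately show ?thesis by simp
  qed
  have comp: "C = U c" if C: "C \<in> connected_components_of T" and c: "c \<in> I // E" and "C \<inter> U c \<noteq> {}" for C c
  proof
    show "U c \<subseteq> C" using connected_components_of_maximal[OF C conn[OF c]] that(3) by (simp add: disjnt_def)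
    have "C \<subseteq> U c \<or> disjnt C (U c)"
      using connectedin_clopen_cases[OF connectedin_connected_components_of[OF C]] clopen[OF c] by blast
    then show "C \<subseteq> U c" using that(3) by (simp add: disjnt_def)
  qed
  have "connected_components_of T = U ` (I // E)"
  proof (intro equalityI subsetI)
    fix C assume C: "C \<in> connected_components_of T"
    then obtain x where x: "x \<in> C" "x \<in> topspace T"
      using nonempty_connected_components_of connected_components_of_subset by blast
    then obtain i where i: "i \<in> I" "x \<in> K i" using K(4) by blast
    have c: "E `` {i} \<in> I // E" by (rule quotientI[OF i(1)])
    have "i \<in> E `` {i}" by (rule equiv_class_self[OF E i(1)])
    then have "x \<in> U (E `` {i})" using i(2) unfolding U_def by blast
    then show "C \<in> U ` (I // E)" using comp[OF C c] x c by blast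
  next
    fix D assume "D \<in> U ` (I // E)"
    then obtain c where c: "c \<in> I // E" "D = U c" by blast
    obtain x where x: "x \<in> U c" using ne[OF c(1)] by blast
    then have xT: "x \<in> topspace T" using clopen(1)[OF c(1)] closedin_subset by blast
    have cc: "connected_component_of_set T x \<in> connected_components_of T"
      using xT by (simp add: connected_component_in_connected_components_of)
    have "x \<in> connected_component_of_set T x" using xT by (simp add: connected_component_of_refl)
    then have "connected_component_of_set T x = U c" using x by (intro comp[OF cc c(1)]) blast
    then show "D \<in> connected_components_of T" using cc c(2) by simp
  qed
  moreover have "inj_on U (I // E)"
  proof (rule inj_onI)
    fix c c' assume cc: "c \<in> I // E" "c' \<in> I // E" "U c = U c'"
    obtain x where "x \<in> U c" "x \<in> U c'" using ne[OF cc(1)] cc(3) by blast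
    then show "c = c'" using same[OF cc(1,2)] unfolding U_def by blast
  qed
  ultimately show ?thesis by (simp add: card_image)
qed

text \<open>The canonical map from \<open>I // E'\<close> to \<open>I // E\<close> is surjective
  between finite sets. A pair in \<open>E\<close> outside \<open>E'\<close> shows that it is not
  injective.\<close>

lemma finer_quotient_card:
  assumes I: "finite I" and E: "equiv I E" and E': "equiv I E'" and sub: "E' \<subseteq> E"
  shows "card (I // E) < card (I // E') \<longleftrightarrow> E' \<noteq> E"
proof
  assume "card (I // E) < card (I // E')"
  then show "E' \<noteq> E" by auto
next
  assume ne: "E' \<noteq> E"
  define h where "h = (\<lambda>c. E `` c)"
  have h: "h (E' `` {i}) = E `` {i}" if "i \<in> I" for i
  proof -
    have "h (E' `` {i}) \<subseteq> E `` {i}" using sub E unfolding h_def by (meson equivE transE subsetD ImageE ImageI subsetI Image_singleton_iff)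
    moreover have "i \<in> E' `` {i}" using E' that by (rule equiv_class_self)
    ultimately show ?thesis unfolding h_def by blast
  qed
  have fin: "finite (I // E')" using I E' by (metis equiv_type finite_quotient)
  have img: "h ` (I // E') = I // E"
  proof (intro equalityI subsetI)
    fix c assume "c \<in> h ` (I // E')"
    then obtain i where "i \<in> I" "c = h (E' `` {i})" unfolding quotient_def by blast
    then show "c \<in> I // E" using h quotientI by metis
  next
    fix c assume "c \<in> I // E"
    then obtain i where i: "i \<in> I" "c = E `` {i}" unfolding quotient_def by blast
    then have "c = h (E' `` {i})" using h by simp
    moreover have "E' `` {i} \<in> I // E'" by (rule quotientI[OF i(1)])
    ultimately show "c \<in> h ` (I // E')" by blast
  qed
  obtain i j where ij: "(i, j) \<in> E" "(i, j) \<notin> E'" using ne sub by auto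
  have iI: "i \<in> I" "j \<in> I" using ij(1) equiv_type[OF E] by blast+
  have "\<not> inj_on h (I // E')"
  proof
    assume inj: "inj_on h (I // E')"
    have "h (E' `` {i}) = h (E' `` {j})" using h iI equiv_class_eq[OF E ij(1)] by simp
    then have "E' `` {i} = E' `` {j}" using inj_onD[OF inj] iI quotientI by metis
    then show False using eq_equiv_class_iff[OF E' iI] ij(2) by blast
  qed
  then have "card (h ` (I // E')) \<noteq> card (I // E')" using fin eq_card_imp_inj_on by blast
  then show "card (I // E) < card (I // E')" using card_image_le[OF fin, of h] img by simp
qed

text \<open>\<open>T\<close> plays the part of the normalization, \<open>k\<close> labels its
  components, \<open>Q\<close> is a curve glued from it and \<open>M\<close> a finite set of points
  removed from \<open>Q\<close>. Then \<open>R\<close> records which components still share a point,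
  so connected components are counted by a graph.\<close>

lemma quotient_components:
  fixes T :: "'q topology" and Q :: "'y topology" and k :: "'q \<Rightarrow> 'v"
  assumes T: "t1_space T" and V: "finite V" "k ` topspace T = V"
    and comps: "\<And>v. v \<in> V \<Longrightarrow> irreducible_set T {q \<in> topspace T. k q = v}"
      "\<And>v. v \<in> V \<Longrightarrow> infinite {q \<in> topspace T. k q = v}" "\<And>v. v \<in> V \<Longrightarrow> closedin T {q \<in> topspace T. k q = v}"
    and quot: "quotient_map T Q \<pi>" and fib: "\<And>y. finite {q \<in> topspace T. \<pi> q = y}"
    and overlap: "finite {q \<in> topspace T. \<exists>r\<in>topspace T. \<pi> r = \<pi> q \<and> k r \<noteq> k q}" and M: "finite M"
  defines "R \<equiv> {(u, v). \<exists>q r. q \<in> topspace T \<and> r \<in> topspace T \<and> \<pi> q = \<pi> r \<and> \<pi> q \<notin> M \<and> k q = u \<and> k r = v}"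
  defines "E \<equiv> {(u, v). u \<in> V \<and> v \<in> V \<and> (u, v) \<in> R\<^sup>*}"
  shows "card (connected_components_of (subtopology Q (topspace Q - M))) = card (V // E)" "equiv V E"
proof -
  have symR: "sym R" unfolding R_def sym_def by force
  show E: "equiv V E"
  proof (rule equivI)
    show "E \<subseteq> V \<times> V" by (auto simp: E_def)
    show "refl_on V E" by (auto simp: E_def refl_on_def)
    show "sym E" using sym_rtrancl[OF symR] by (auto simp: E_def sym_def)
    show "trans E" unfolding E_def trans_def by (auto intro: rtrancl_trans)
  qed
  have surj: "\<pi> ` topspace T = topspace Q" using quot by (simp add: quotient_map_def)
  have cont: "continuous_map T Q \<pi>" using quot by (rule quotient_imp_continuous_map)
  define C where "C = (\<lambda>v. {q \<in> topspace T. k q = v})"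
  define K where "K = (\<lambda>v. \<pi> ` C v - M)"
  have finM: "finite {q \<in> topspace T. \<pi> q \<in> M}"
  proof -
    have "{q \<in> topspace T. \<pi> q \<in> M} = (\<Union>y\<in>M. {q \<in> topspace T. \<pi> q = y})" by auto
    then show ?thesis using M fib by simp
  qed
  \<comment> \<open>Puncturing does not disconnect a component: it is irreducible and infinite,
    while the fibre over \<open>M\<close> is finite.\<close>
  have irrK: "irreducible_set T (C v - {q \<in> topspace T. \<pi> q \<in> M})" if "v \<in> V" for v
    unfolding C_def using irreducible_minus_finite[OF T comps(1,2)[OF that] finM] .
  have Keq: "K v = \<pi> ` (C v - {q \<in> topspace T. \<pi> q \<in> M})" for v by (auto simp: K_def C_def)
  have KQ: "K v \<subseteq> topspace Q - M" for v using surj by (auto simp: K_def C_def)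
  have closedC: "closedin Q (\<pi> ` C v)" if v: "v \<in> V" for v
  proof -
    let ?D = "{q \<in> topspace T. \<exists>r\<in>topspace T. \<pi> r = \<pi> q \<and> k r \<noteq> k q}"
    \<comment> \<open>Closedness in \<open>Q\<close> is tested upstairs, where the preimage of the
      image of \<open>C v\<close> differs from \<open>C v\<close> only by points of the finite
      overlap.\<close>
    have eq: "{q \<in> topspace T. \<pi> q \<in> \<pi> ` C v} = C v \<union> {q \<in> ?D. \<pi> q \<in> \<pi> ` C v}"
      by (auto simp: C_def)
    have "finite {q \<in> ?D. \<pi> q \<in> \<pi> ` C v}" by (rule finite_subset[OF _ overlap]) blast
    then have "closedin T {q \<in> ?D. \<pi> q \<in> \<pi> ` C v}" using T by (auto simp: t1_space_closedin_finite)
    then have "closedin T {q \<in> topspace T. \<pi> q \<in> \<pi> ` C v}"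
      unfolding eq using comps(3)[OF v] by (intro closedin_Un) (simp_all add: C_def)
    moreover have "\<pi> ` C v \<subseteq> topspace Q" using surj by (auto simp: C_def)
    ultimately show ?thesis using quot unfolding quotient_map_closedin by blast
  qed
  show "card (connected_components_of (subtopology Q (topspace Q - M))) = card (V // E)"
  proof (rule components_of_closed_cover[where K=K, OF V(1) _ _ _ _ E])
    fix v assume v: "v \<in> V"
    have "connectedin Q (K v)"
      unfolding Keq by (rule connectedin_continuous_map_image[OF cont irreducible_connected[OF irrK[OF v]]])
    then show "connectedin (subtopology Q (topspace Q - M)) (K v)"
      using KQ[of v] by (simp add: connectedin_subtopology)
    have "K v = \<pi> ` C v \<inter> (topspace Q - M)" using surj by (auto simp: K_def C_def)
    then show "closedin (subtopology Q (topspace Q - M)) (K v)"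
      unfolding closedin_subtopology using closedC[OF v] by blast
    show "K v \<noteq> {}" using irrK[OF v] unfolding Keq irreducible_set_def by blast
  next
    show "topspace (subtopology Q (topspace Q - M)) = (\<Union>v\<in>V. K v)"
      unfolding topspace_subtopology K_def C_def surj[symmetric] V(2)[symmetric] by blast
  next
    fix u v assume uv: "u \<in> V" "v \<in> V" "K u \<inter> K v \<noteq> {}"
    then obtain q r where "q \<in> C u" "r \<in> C v" "\<pi> q = \<pi> r" "\<pi> q \<notin> M" by (auto simp: K_def)
    then have "(u, v) \<in> R" unfolding R_def C_def by blast
    then show "(u, v) \<in> E" using uv by (auto simp: E_def)
  next
    fix u v assume "(u, v) \<in> E"
    then have "(u, v) \<in> R\<^sup>*" by (simp add: E_def)
    moreover have "R \<subseteq> {(i, j). i \<in> V \<and> j \<in> V \<and> K i \<inter> K j \<noteq> {}}"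
    proof clarify
      fix u v assume "(u, v) \<in> R"
      then obtain q r where "q \<in> topspace T" "r \<in> topspace T" "\<pi> q = \<pi> r" "\<pi> q \<notin> M" "k q = u" "k r = v"
        unfolding R_def by blast
      then have "q \<in> C u" "r \<in> C v" "\<pi> q = \<pi> r" "\<pi> q \<notin> M" "u \<in> V" "v \<in> V" using V(2) by (auto simp: C_def)
      then have "u \<in> V" "v \<in> V" "\<pi> q \<in> K u" "\<pi> q \<in> K v" unfolding K_def by (blast, blast, blast, metis DiffI imageI)
      then show "u \<in> V \<and> v \<in> V \<and> K u \<inter> K v \<noteq> {}" by blast
    qed
    ultimately show "(u, v) \<in> {(i, j). i \<in> V \<and> j \<in> V \<and> K i \<inter> K j \<noteq> {}}\<^sup>*" using rtrancl_mono by blast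
  qed
qed

section \<open>Nodal curves and their normalization\<close>

lemma projective_curveE:
  assumes "projective_curve X"
  obtains n Z where "closedin (proj_zariski n) Z" "X = closed_subvariety n Z"
    "noetherian_space (zariski X)" "t1_space (zariski X)" "pure_dim_one (zariski X)"
proof -
  obtain n Z where nZ: "closedin (proj_zariski n) Z" "X = closed_subvariety n Z"
    using assms unfolding projective_curve_def projective_variety_def by blast
  have zX: "zariski X = subtopology (proj_zariski n) Z" by (simp add: nZ(2) closed_subvariety_def)
  have "noetherian_space (zariski X)" "t1_space (zariski X)"
    unfolding zX using noetherian_subtopology[OF noetherian_proj_zariski nZ(1)] t1_space_subtopology[OF t1_proj_zariski]
    by blast+
  moreover have "pure_dim_one (zariski X)" using assms by (simp add: projective_curve_def)
  ultimately show ?thesis using that nZ by blast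
qed

lemma regular_at_cong:
  assumes X: "X = closed_subvariety n Z" and f: "f \<in> regular_at X p"
    and W: "openin (zariski X) W" "p \<in> W" "\<And>y. y \<in> W \<Longrightarrow> f y = g y"
  shows "g \<in> regular_at X p"
proof -
  have zX: "zariski X = subtopology (proj_zariski n) Z" by (simp add: X closed_subvariety_def)
  have "\<exists>V d F G. openin (subtopology (proj_zariski n) Z) V \<and> p \<in> V \<and> F \<in> forms n d \<and> G \<in> forms n d \<and>
      (\<forall>y\<in>V. \<forall>v\<in>y. G v \<noteq> 0 \<and> f y = F v / G v)"
    using f by (simp add: X closed_subvariety_def)
  then obtain V d F G where V: "openin (subtopology (proj_zariski n) Z) V" "p \<in> V" "F \<in> forms n d" "G \<in> forms n d"
    "\<And>y v. y \<in> V \<Longrightarrow> v \<in> y \<Longrightarrow> G v \<noteq> 0 \<and> f y = F v / G v"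
    by blast
  have op: "openin (subtopology (proj_zariski n) Z) (V \<inter> W)" using V(1) W(1) unfolding zX by (rule openin_Int)
  have eq: "\<forall>y\<in>V \<inter> W. \<forall>v\<in>y. G v \<noteq> 0 \<and> g y = F v / G v"
  proof (intro ballI)
    fix y v assume y: "y \<in> V \<inter> W" "v \<in> y"
    then show "G v \<noteq> 0 \<and> g y = F v / G v" using V(5)[of y v] W(3)[of y] by simp
  qed
  have "\<exists>V d F G. openin (subtopology (proj_zariski n) Z) V \<and> p \<in> V \<and> F \<in> forms n d \<and> G \<in> forms n d \<and>
      (\<forall>y\<in>V. \<forall>v\<in>y. G v \<noteq> 0 \<and> g y = F v / G v)"
    by (intro exI conjI, rule op, rule IntI[OF V(2) W(2)], rule V(3), rule V(4), rule eq)
  then show ?thesis by (simp add: X closed_subvariety_def)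
qed

text \<open>The irreducible components are finitely many closed sets, pairwise disjoint at
  nonsingular points; so each is open too, and being connected it is a connected component.\<close>

lemma components_nonsingular_curve:
  assumes X: "projective_curve X" and ns: "singular_points X = {}"
    and Z: "Z \<in> irreducible_components (zariski X)" and q: "q \<in> Z"
  shows "connected_component_of_set (zariski X) q = Z" "openin (zariski X) Z"
proof -
  obtain n A where nA: "closedin (proj_zariski n) A" "X = closed_subvariety n A" and noeth: "noetherian_space (zariski X)"
    using projective_curveE[OF X] .
  note comps = noetherian_components[OF noeth]
  have Zsub: "Z \<subseteq> topspace (zariski X)" using comps(3) Z by blast
  have disj: "Z' = Z" if "Z' \<in> irreducible_components (zariski X)" "x \<in> Z" "x \<in> Z'" for Z' x
  proof -
    have "x \<in> points X" using that Zsub by blast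
    then have "nonsingular_at X x" using ns by (auto simp: singular_points_def)
    then show ?thesis
      using nonsingular_one_component[OF nA(1), of x Z' Z] that Z unfolding nA(2)[symmetric] by blast
  qed
  have eq: "topspace (zariski X) - Z = \<Union>(irreducible_components (zariski X) - {Z})"
    using comps(3) disj Z by blast
  have "closedin (zariski X) (\<Union>(irreducible_components (zariski X) - {Z}))"
    using comps(1,2) by (intro closedin_Union) auto
  then show op: "openin (zariski X) Z" unfolding openin_closedin_eq eq using Zsub by simp
  have conn: "connectedin (zariski X) Z"
    by (rule irreducible_connected) (use Z in \<open>simp add: irreducible_components_def\<close>)
  show "connected_component_of_set (zariski X) q = Z"
  proof (rule connected_component_of_unique[OF q conn])
    fix C assume C: "q \<in> C \<and> connectedin (zariski X) C"
    then have "C \<subseteq> Z \<or> disjnt C Z" using connectedin_clopen_cases[of "zariski X" C Z] op comps(2)[OF Z] by blast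
    then show "C \<subseteq> Z" using C q by (auto simp: disjnt_def)
  qed
qed

section \<open>Branches, components and nodes seen from the normalization\<close>

locale nodal_curve =
  fixes X Xn :: "('k::field proj_point, 'k) variety" and \<nu>
  assumes nodal: "connected_nodal_curve X Xn \<nu>"
begin

abbreviation "k \<equiv> branch_component Xn \<nu>"
abbreviation "cc \<equiv> connected_component_of_set (zariski Xn)"

lemma curve: "projective_curve X" and curve_n: "projective_curve Xn" and smooth: "singular_points Xn = {}"
  and fin_mor: "finite_morphism Xn X \<nu>" and birat: "birational Xn X \<nu>"
  using nodal by (auto simp: connected_nodal_curve_def normalization_def)

lemma cont: "continuous_map (zariski Xn) (zariski X) \<nu>"
  and closed: "closed_map (zariski Xn) (zariski X) \<nu>"
  using fin_mor by (auto simp: finite_morphism_def morphism_def)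

lemma \<nu>_points: "q \<in> points Xn \<Longrightarrow> \<nu> q \<in> points X"
  using cont by (auto simp: continuous_map_def)

lemma finite_fibre: "finite {q \<in> points Xn. \<nu> q = y}"
proof (cases "y \<in> points X")
  case True
  then show ?thesis using fin_mor by (simp add: finite_morphism_def fibre_def)
next
  case False
  then have "{q \<in> points Xn. \<nu> q = y} = {}" using \<nu>_points by auto
  then show ?thesis by (metis finite.emptyI)
qed

lemma noeth: "noetherian_space (zariski Xn)" and t1: "t1_space (zariski Xn)" and dim: "pure_dim_one (zariski Xn)"
  by (rule projective_curveE[OF curve_n], assumption)+

lemma cc_component: "q \<in> points Xn \<Longrightarrow> cc q \<in> irreducible_components (zariski Xn)"
proof -
  assume "q \<in> points Xn"
  then obtain Z where "Z \<in> irreducible_components (zariski Xn)" "q \<in> Z"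
    using noetherian_components(3)[OF noeth] by blast
  then show ?thesis using components_nonsingular_curve(1)[OF curve_n smooth] by metis
qed

lemma component_cc: "Z \<in> irreducible_components (zariski Xn) \<Longrightarrow> \<exists>q\<in>points Xn. Z = cc q"
proof -
  assume Z: "Z \<in> irreducible_components (zariski Xn)"
  then obtain q where q: "q \<in> Z" unfolding irreducible_components_def irreducible_set_def by blast
  then have "q \<in> points Xn" using noetherian_components(3)[OF noeth] Z by blast
  then show ?thesis using components_nonsingular_curve(1)[OF curve_n smooth Z q] by blast
qed

lemma cc_refl: "q \<in> points Xn \<Longrightarrow> q \<in> cc q"
  by (simp add: connected_component_of_refl)

lemma cc_sub: "cc q \<subseteq> points Xn"
  by (rule connected_component_of_subset_topspace)

lemma cc_eq: "r \<in> cc q \<Longrightarrow> cc r = cc q"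
  using connected_component_of_equiv[of "zariski Xn" q r] by simp

lemma open_cc: "q \<in> points Xn \<Longrightarrow> openin (zariski Xn) (cc q)"
  using components_nonsingular_curve(2)[OF curve_n smooth cc_component cc_refl] by blast

lemma irreducible_cc: "q \<in> points Xn \<Longrightarrow> irreducible_set (zariski Xn) (cc q)"
  using cc_component by (simp add: irreducible_components_def)

lemma birational_open:
  obtains U where "openin (zariski X) U" "zariski X closure_of U = points X"
    "zariski Xn closure_of {q \<in> points Xn. \<nu> q \<in> U} = points Xn"
    "isomorphism (open_subvariety Xn {q \<in> points Xn. \<nu> q \<in> U}) (open_subvariety X U) \<nu>"
    "inj_on \<nu> {q \<in> points Xn. \<nu> q \<in> U}" "\<nu> ` {q \<in> points Xn. \<nu> q \<in> U} = U"
    "\<And>W. openin (zariski Xn) W \<Longrightarrow> openin (zariski X) (\<nu> ` (W \<inter> {q \<in> points Xn. \<nu> q \<in> U}))"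
proof -
  obtain U where U: "openin (zariski X) U" "zariski X closure_of U = points X"
    "zariski Xn closure_of {q \<in> points Xn. \<nu> q \<in> U} = points Xn"
    "isomorphism (open_subvariety Xn {q \<in> points Xn. \<nu> q \<in> U}) (open_subvariety X U) \<nu>"
    using birat unfolding birational_def by blast
  define V where "V = {q \<in> points Xn. \<nu> q \<in> U}"
  have hom: "homeomorphic_map (subtopology (zariski Xn) V) (subtopology (zariski X) U) \<nu>"
    using U(4) by (simp add: isomorphism_def open_subvariety_def V_def)
  have UX: "U \<subseteq> points X" using U(1) by (rule openin_subset)
  have top: "topspace (subtopology (zariski Xn) V) = V" "topspace (subtopology (zariski X) U) = U"
    using UX by (auto simp: V_def)
  have "inj_on \<nu> V" "\<nu> ` V = U"
    using homeomorphic_imp_injective_map[OF hom] homeomorphic_imp_surjective_map[OF hom] by (simp_all only: top)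
  moreover have "openin (zariski X) (\<nu> ` (W \<inter> V))" if "openin (zariski Xn) W" for W
  proof -
    have "openin (subtopology (zariski Xn) V) (W \<inter> V)" using that by (rule openin_subtopology_Int)
    then have "openin (subtopology (zariski X) U) (\<nu> ` (W \<inter> V))"
      using homeomorphic_imp_open_map[OF hom] by (simp add: open_map_def)
    then show ?thesis using U(1) by (rule openin_trans_full)
  qed
  ultimately show ?thesis using that[OF U] unfolding V_def by blast
qed

lemma surj: "\<nu> ` points Xn = points X"
proof -
  obtain U where U: "zariski X closure_of U = points X" "\<nu> ` {q \<in> points Xn. \<nu> q \<in> U} = U"
    by (rule birational_open)
  have "closedin (zariski X) (\<nu> ` points Xn)" using closed by (simp add: closed_map_def)
  moreover have "U \<subseteq> \<nu> ` points Xn" using U(2) by blast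
  ultimately have "zariski X closure_of U \<subseteq> \<nu> ` points Xn" by (rule closure_of_minimal[rotated])
  then show ?thesis using U(1) \<nu>_points by blast
qed

lemma quotient: "quotient_map (zariski Xn) (zariski X) \<nu>"
  by (rule continuous_closed_imp_quotient_map[OF cont closed surj])

text \<open>The open set \<open>cc q\<close> meets the dense set where \<nu> is injective. The image
  of a point found there has no other preimage, so that point lies in \<open>cc r\<close> as well.
  Hence distinct components of \<open>Xn\<close> have incomparable images.\<close>

lemma k_subset_imp:
  assumes q: "q \<in> points Xn" and r: "r \<in> points Xn" and sub: "k q \<subseteq> k r"
  shows "cc q = cc r"
proof -
  obtain U where U: "zariski Xn closure_of {q \<in> points Xn. \<nu> q \<in> U} = points Xn"
    "inj_on \<nu> {q \<in> points Xn. \<nu> q \<in> U}"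
    by (rule birational_open)
  have "{q \<in> points Xn. \<nu> q \<in> U} \<inter> cc q \<noteq> {}"
    using U(1) open_cc[OF q] cc_refl[OF q] unfolding dense_intersects_open by blast
  then obtain q' where q': "q' \<in> points Xn" "\<nu> q' \<in> U" "q' \<in> cc q" by blast
  then have "\<nu> q' \<in> \<nu> ` cc r" using sub unfolding branch_component_def by blast
  then obtain r' where r': "r' \<in> cc r" "\<nu> r' = \<nu> q'" by auto
  then have "r' \<in> points Xn" using cc_sub by blast
  then have "r' = q'" using inj_onD[OF U(2), of r' q'] r' q' by simp
  then show ?thesis using cc_eq[OF r'(1)] cc_eq[OF q'(3)] by simp
qed

lemma k_eq_iff: "q \<in> points Xn \<Longrightarrow> r \<in> points Xn \<Longrightarrow> k q = k r \<longleftrightarrow> cc q = cc r"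
  using k_subset_imp[of q r] by (auto simp: branch_component_def)

lemma k_fibre: "q \<in> points Xn \<Longrightarrow> {r \<in> points Xn. k r = k q} = cc q"
  using k_eq_iff cc_eq cc_refl cc_sub by blast

lemma k_irreducible: "q \<in> points Xn \<Longrightarrow> irreducible_set (zariski X) (k q)"
  unfolding irreducible_set_def
proof (intro conjI allI impI)
  assume q: "q \<in> points Xn"
  show "k q \<subseteq> points X" using cc_sub \<nu>_points by (auto simp: branch_component_def)
  show "k q \<noteq> {}" using cc_refl[OF q] by (auto simp: branch_component_def)
  fix A B assume AB: "closedin (zariski X) A" "closedin (zariski X) B" "k q \<subseteq> A \<union> B"
  have irr: "closedin (zariski Xn) C \<Longrightarrow> closedin (zariski Xn) D \<Longrightarrow> cc q \<subseteq> C \<union> D \<Longrightarrow> cc q \<subseteq> C \<or> cc q \<subseteq> D" for C D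
    using irreducible_cc[OF q] by (simp add: irreducible_set_def)
  have "closedin (zariski Xn) {x \<in> points Xn. \<nu> x \<in> A}" "closedin (zariski Xn) {x \<in> points Xn. \<nu> x \<in> B}"
    using closedin_continuous_map_preimage[OF cont] AB by blast+
  moreover have "cc q \<subseteq> {x \<in> points Xn. \<nu> x \<in> A} \<union> {x \<in> points Xn. \<nu> x \<in> B}"
    using AB(3) cc_sub unfolding branch_component_def by blast
  ultimately have "cc q \<subseteq> {x \<in> points Xn. \<nu> x \<in> A} \<or> cc q \<subseteq> {x \<in> points Xn. \<nu> x \<in> B}"
    using irr by blast
  then show "k q \<subseteq> A \<or> k q \<subseteq> B" unfolding branch_component_def by blast
qed

lemma finite_k: "finite (k ` points Xn)"
proof -
  have "k ` points Xn \<subseteq> (image \<nu>) ` irreducible_components (zariski Xn)"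
    using cc_component unfolding branch_component_def by blast
  then show ?thesis using noetherian_components(1)[OF noeth] by (metis finite_imageI finite_subset)
qed

text \<open>The sets \<open>k q\<close> are closed, irreducible and finite in number, and they cover
  \<open>X\<close>; every irreducible set lies in one of them. By \<open>k_subset_imp\<close> none
  lies properly in another.\<close>

lemma irreducible_components_eq: "irreducible_components (zariski X) = k ` points Xn"
proof -
  have closedk: "closedin (zariski X) (k q)" if "q \<in> points Xn" for q
    using closed noetherian_components(2)[OF noeth cc_component[OF that]] unfolding closed_map_def branch_component_def by blast
  have cover: "\<exists>q\<in>points Xn. W \<subseteq> k q" if W: "irreducible_set (zariski X) W" for W
  proof -
    have "W \<subseteq> \<Union>(k ` points Xn)"
    proof
      fix x assume "x \<in> W"
      then have "x \<in> points X" using W by (auto simp: irreducible_set_def)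
      then obtain q where "q \<in> points Xn" "x = \<nu> q" using surj by blast
      then show "x \<in> \<Union>(k ` points Xn)" using cc_refl unfolding branch_component_def by blast
    qed
    then have "\<exists>A\<in>k ` points Xn. W \<subseteq> A"
      by (intro irreducible_in_finite_union[OF W finite_k]) (use closedk in auto)
    then show ?thesis by blast
  qed
  show ?thesis
  proof (intro equalityI subsetI)
    fix Z assume Z: "Z \<in> irreducible_components (zariski X)"
    then have "irreducible_set (zariski X) Z" by (simp add: irreducible_components_def)
    then obtain q where q: "q \<in> points Xn" "Z \<subseteq> k q" using cover by blast
    then have "k q = Z" using Z k_irreducible unfolding irreducible_components_def by blast
    then show "Z \<in> k ` points Xn" using q by blast
  next
    fix Z assume "Z \<in> k ` points Xn"
    then obtain q where q: "q \<in> points Xn" "Z = k q" by blast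
    show "Z \<in> irreducible_components (zariski X)"
      unfolding irreducible_components_def q(2)
    proof (intro CollectI conjI allI impI)
      show "irreducible_set (zariski X) (k q)" by (rule k_irreducible[OF q(1)])
      fix W assume W: "irreducible_set (zariski X) W" "k q \<subseteq> W"
      then obtain r where r: "r \<in> points Xn" "W \<subseteq> k r" using cover by blast
      then have "cc q = cc r" using k_subset_imp[OF q(1) r(1)] W by blast
      then have "k q = k r" by (simp add: branch_component_def)
      then show "W = k q" using r W by blast
    qed
  qed
qed

lemma nonsingular_same_component:
  assumes "q \<in> points Xn" "r \<in> points Xn" "\<nu> q = \<nu> r" "\<nu> q \<notin> singular_points X"
  shows "k q = k r"
proof -
  obtain n Z where nZ: "closedin (proj_zariski n) Z" "X = closed_subvariety n Z"
    using projective_curveE[OF curve] .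
  have "nonsingular_at X (\<nu> q)" using assms \<nu>_points by (auto simp: singular_points_def)
  moreover have "\<nu> q \<in> k q" "\<nu> q \<in> k r" unfolding branch_component_def using cc_refl assms(1-3) by auto
  ultimately show ?thesis
    using nonsingular_one_component[OF nZ(1), of "\<nu> q" "k q" "k r"] assms irreducible_components_eq
    unfolding nZ(2)[symmetric] by blast
qed

text \<open>Over the locus where \<nu> is an isomorphism, a uniformizer at \<open>q\<close> descends
  to a uniformizer at \<open>\<nu> q\<close>.\<close>

lemma nonsingular_isomorphism_point:
  assumes q: "q \<in> points Xn" and U: "openin (zariski X) U" "\<nu> q \<in> U"
    and iso: "isomorphism (open_subvariety Xn {q \<in> points Xn. \<nu> q \<in> U}) (open_subvariety X U) \<nu>"
    and inj: "inj_on \<nu> {q \<in> points Xn. \<nu> q \<in> U}"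
    and op: "\<And>W. openin (zariski Xn) W \<Longrightarrow> openin (zariski X) (\<nu> ` (W \<inter> {q \<in> points Xn. \<nu> q \<in> U}))"
  shows "nonsingular_at X (\<nu> q)"
proof -
  obtain n Z where nZ: "Xn = closed_subvariety n Z"
    using projective_curveE[OF curve_n] .
  define V where "V = {q \<in> points Xn. \<nu> q \<in> U}"
  have oV: "openin (zariski Xn) V" unfolding V_def by (rule openin_continuous_map_preimage[OF cont U(1)])
  have qV: "q \<in> V" using q U(2) by (simp add: V_def)
  have injV: "inj_on \<nu> V" using inj by (simp add: V_def)
  have reg: "h \<in> regular_at X (\<nu> q) \<longleftrightarrow> h \<circ> \<nu> \<in> regular_at Xn q" for h
  proof -
    have "q \<in> points (open_subvariety Xn V)" using qV q by (simp add: open_subvariety_def)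
    then show ?thesis using iso unfolding isomorphism_def V_def[symmetric] by (simp add: open_subvariety_def)
  qed
  have near_iff: "near X (\<nu> q) P \<longleftrightarrow> near Xn q (\<lambda>x. P (\<nu> x))" for P
  proof
    assume "near X (\<nu> q) P"
    then obtain W where W: "openin (zariski X) W" "\<nu> q \<in> W" "\<And>x. x \<in> W \<Longrightarrow> P x" by (auto simp: near_def)
    have "openin (zariski Xn) {x \<in> points Xn. \<nu> x \<in> W}" by (rule openin_continuous_map_preimage[OF cont W(1)])
    then show "near Xn q (\<lambda>x. P (\<nu> x))" unfolding near_def using q W by (intro exI[of _ "{x \<in> points Xn. \<nu> x \<in> W}"]) simp
  next
    assume "near Xn q (\<lambda>x. P (\<nu> x))"
    then obtain W where W: "openin (zariski Xn) W" "q \<in> W" "\<And>x. x \<in> W \<Longrightarrow> P (\<nu> x)" by (auto simp: near_def)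
    have "openin (zariski X) (\<nu> ` (W \<inter> V))" using op[OF W(1)] by (simp add: V_def)
    then show "near X (\<nu> q) P" unfolding near_def using W qV by (intro exI[of _ "\<nu> ` (W \<inter> V)"]) auto
  qed
  \<comment> \<open>A function on \<open>Xn\<close> descends by composition with this inverse. Its
    values outside the image of \<open>V\<close> are arbitrary, which is harmless for germs at
    \<open>\<nu> q\<close>.\<close>
  define inv where "inv = inv_into V \<nu>"
  have inv: "inv (\<nu> x) = x" if "x \<in> V" for x using that injV by (simp add: inv_def)
  have lift: "(\<lambda>y. g (inv y)) \<in> regular_at X (\<nu> q)" if "g \<in> regular_at Xn q" for g
    unfolding reg by (rule regular_at_cong[OF nZ that oV qV]) (simp add: inv)
  have near_inv: "near Xn q (\<lambda>x. P x (\<nu> x)) \<longleftrightarrow> near X (\<nu> q) (\<lambda>y. P (inv y) y)" for P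
  proof -
    have mono: "near Xn q Q" if N: "near Xn q R" and RQ: "\<And>x. x \<in> V \<Longrightarrow> R x \<Longrightarrow> Q x" for Q R
    proof -
      obtain W where "openin (zariski Xn) W" "q \<in> W" "\<And>x. x \<in> W \<Longrightarrow> R x" using N by (auto simp: near_def)
      then show ?thesis unfolding near_def using RQ oV qV by (intro exI[of _ "W \<inter> V"]) auto
    qed
    have "near Xn q (\<lambda>x. P x (\<nu> x)) \<longleftrightarrow> near Xn q (\<lambda>x. P (inv (\<nu> x)) (\<nu> x))"
      using inv by (intro iffI; elim mono) simp_all
    then show ?thesis unfolding near_iff .
  qed
  have "nonsingular_at Xn q" using smooth q by (auto simp: singular_points_def)
  then obtain t where t: "t \<in> regular_at Xn q" "t q = 0" "\<not> near Xn q (\<lambda>x. t x = 0)"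
    and dvr: "\<And>f. f \<in> regular_at Xn q \<Longrightarrow> near Xn q (\<lambda>x. f x = 0) \<or>
        (\<exists>u \<in> regular_at Xn q. \<exists>m::nat. u q \<noteq> 0 \<and> near Xn q (\<lambda>x. f x = u x * t x ^ m))"
    unfolding nonsingular_at_def by blast
  show ?thesis
    unfolding nonsingular_at_def
  proof (intro bexI[of _ "\<lambda>y. t (inv y)"] conjI ballI)
    show "(\<lambda>y. t (inv y)) \<in> regular_at X (\<nu> q)" by (rule lift[OF t(1)])
    show "t (inv (\<nu> q)) = 0" using inv[OF qV] t(2) by simp
    show "\<not> near X (\<nu> q) (\<lambda>y. t (inv y) = 0)" using t(3) near_inv[of "\<lambda>x y. t x = 0"] by simp
    fix h assume "h \<in> regular_at X (\<nu> q)"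
    then have "h \<circ> \<nu> \<in> regular_at Xn q" by (simp add: reg)
    from dvr[OF this] show "near X (\<nu> q) (\<lambda>y. h y = 0) \<or>
        (\<exists>u\<in>regular_at X (\<nu> q). \<exists>m. u (\<nu> q) \<noteq> 0 \<and> near X (\<nu> q) (\<lambda>y. h y = u y * t (inv y) ^ m))"
    proof (elim disjE bexE exE conjE)
      assume "near Xn q (\<lambda>x. (h \<circ> \<nu>) x = 0)"
      then show ?thesis unfolding near_iff by simp
    next
      fix u m assume u: "u \<in> regular_at Xn q" "u q \<noteq> 0" "near Xn q (\<lambda>x. (h \<circ> \<nu>) x = u x * t x ^ m)"
      have "near X (\<nu> q) (\<lambda>y. h y = u (inv y) * t (inv y) ^ m)"
        using u(3) near_inv[of "\<lambda>x y. h y = u x * t x ^ m"] by simp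
      then show ?thesis using lift[OF u(1)] inv[OF qV] u(2) by (intro disjI2 bexI[of _ "\<lambda>y. u (inv y)"] exI[of _ m]) auto
    qed
  qed
qed

text \<open>All singular points lie under the closed set \<open>A\<close> where \<nu> is not known
  to be an isomorphism. By density \<open>A\<close> contains no component, so it meets each of the
  finitely many components in a finite set.\<close>

lemma finite_singular: "finite (singular_points X)"
proof -
  obtain U where U: "openin (zariski X) U" "zariski Xn closure_of {q \<in> points Xn. \<nu> q \<in> U} = points Xn"
    "isomorphism (open_subvariety Xn {q \<in> points Xn. \<nu> q \<in> U}) (open_subvariety X U) \<nu>"
    "inj_on \<nu> {q \<in> points Xn. \<nu> q \<in> U}"
    "\<And>W. openin (zariski Xn) W \<Longrightarrow> openin (zariski X) (\<nu> ` (W \<inter> {q \<in> points Xn. \<nu> q \<in> U}))"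
    by (rule birational_open, rule that)
  define A where "A = {q \<in> points Xn. \<nu> q \<notin> U}"
  have A: "A = points Xn - {q \<in> points Xn. \<nu> q \<in> U}" by (auto simp: A_def)
  have "openin (zariski Xn) {q \<in> points Xn. \<nu> q \<in> U}" by (rule openin_continuous_map_preimage[OF cont U(1)])
  then have clA: "closedin (zariski Xn) A" unfolding A by (rule closedin_diff[OF closedin_topspace])
  have "finite (A \<inter> Z)" if Z: "Z \<in> irreducible_components (zariski Xn)" for Z
  proof -
    obtain q where q: "q \<in> points Xn" "Z = cc q" using component_cc[OF Z] by blast
    have "{q \<in> points Xn. \<nu> q \<in> U} \<inter> cc q \<noteq> {}"
      using U(2) open_cc[OF q(1)] cc_refl[OF q(1)] unfolding dense_intersects_open by blast
    then have "A \<inter> Z \<subset> Z" using q by (auto simp: A_def)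
    moreover have "closedin (zariski Xn) (A \<inter> Z)" using clA noetherian_components(2)[OF noeth Z] by blast
    ultimately show ?thesis using proper_closed_finite[OF noeth t1 dim Z] by blast
  qed
  moreover have "A = (\<Union>Z\<in>irreducible_components (zariski Xn). A \<inter> Z)"
    using noetherian_components(3)[OF noeth] by (auto simp: A_def)
  ultimately have "finite A" using noetherian_components(1)[OF noeth] by (metis (no_types, lifting) finite_UN_I)
  moreover have "singular_points X \<subseteq> \<nu> ` A"
  proof
    fix p assume p: "p \<in> singular_points X"
    then have "p \<in> points X" by (simp add: singular_points_def)
    then obtain q where q: "q \<in> points Xn" "p = \<nu> q" using surj by blast
    have "\<nu> q \<notin> U" using nonsingular_isomorphism_point[OF q(1) U(1) _ U(3-5)] p q by (auto simp: singular_points_def)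
    then show "p \<in> \<nu> ` A" using q by (auto simp: A_def)
  qed
  ultimately show ?thesis by (metis finite_imageI finite_subset)
qed

lemma node_branches:
  assumes "p \<in> singular_points X"
  obtains q r where "q \<noteq> r" "{x \<in> points Xn. \<nu> x = p} = {q, r}"
proof -
  have "node Xn X \<nu> p" using assms nodal by (simp add: connected_nodal_curve_def)
  then obtain q r where "q \<noteq> r" "fibre Xn \<nu> {p} = {q, r}"
    unfolding node_def by (elim conjE exE) (rule that)
  then show ?thesis using that by (simp add: fibre_def)
qed

lemma infinite_cc: "q \<in> points Xn \<Longrightarrow> infinite (cc q)"
  using infinite_component[OF t1 dim cc_component] .

lemma k_fibres:
  assumes "v \<in> k ` points Xn"
  shows "irreducible_set (zariski Xn) {q \<in> points Xn. k q = v}" "infinite {q \<in> points Xn. k q = v}"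
    "closedin (zariski Xn) {q \<in> points Xn. k q = v}"
proof -
  obtain q where q: "q \<in> points Xn" "v = k q" using assms by (elim imageE) (rule that)
  show "irreducible_set (zariski Xn) {q \<in> points Xn. k q = v}" "infinite {q \<in> points Xn. k q = v}"
    "closedin (zariski Xn) {q \<in> points Xn. k q = v}"
    unfolding q(2) k_fibre[OF q(1)]
    using irreducible_cc infinite_cc noetherian_components(2)[OF noeth cc_component] q(1) by blast+
qed

end

section \<open>Flows on half-edges\<close>

text \<open>A graph is encoded by its set \<open>B\<close> of half-edges, where \<open>f q\<close> is the edge and \<open>k q\<close> the vertex
  of \<open>q\<close>, and \<open>sg\<close> orients each edge from its half with sign \<open>-1\<close> to the one with sign \<open>1\<close>. Up to
  this encoding \<open>pairing\<close> evaluates a vertex function on the boundary of a chain. For the dual graph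
  of a curve the half-edges are the points of the normalization over the nodes, so \<open>sg q * z (f q)\<close>
  is the coefficient of \<open>\<eta>(z)\<close> at \<open>q\<close>.\<close>

definition halves :: "'q set \<Rightarrow> ('q \<Rightarrow> 'e) \<Rightarrow> ('q \<Rightarrow> int) \<Rightarrow> bool" where
  "halves B f sg \<longleftrightarrow> finite B \<and>
     (\<forall>e\<in>f ` B. \<exists>q r. {x\<in>B. f x = e} = {q, r} \<and> sg q = 1 \<and> sg r = -1)"

definition pairing ::
    "'q set \<Rightarrow> ('q \<Rightarrow> 'e) \<Rightarrow> ('q \<Rightarrow> int) \<Rightarrow> ('q \<Rightarrow> 'v) \<Rightarrow> ('e \<Rightarrow> int) \<Rightarrow> ('v \<Rightarrow> int) \<Rightarrow> int" where
  "pairing B f sg k z g = (\<Sum>q\<in>B. g (k q) * (sg q * z (f q)))"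

lemma pairing_lincomb:
  "pairing B f sg k (\<lambda>e. a * z e + b * w e) g = a * pairing B f sg k z g + b * pairing B f sg k w g"
  by (simp add: pairing_def sum_distrib_left algebra_simps sum.distrib)

lemma pairing_add: "pairing B f sg k (\<lambda>e. z e + w e) g = pairing B f sg k z g + pairing B f sg k w g"
  by (simp add: pairing_def algebra_simps sum.distrib)

lemma pairing_sum:
  "pairing B f sg k (\<lambda>e. \<Sum>i\<in>I. c i * w i e) g = (\<Sum>i\<in>I. c i * pairing B f sg k (w i) g)"
  unfolding pairing_def sum_distrib_left by (subst sum.swap) (simp add: algebra_simps)

lemma halvesE:
  assumes "halves B f sg" "e \<in> f ` B"
  obtains q r where "q \<noteq> r" "{x\<in>B. f x = e} = {q, r}" "q \<in> B" "r \<in> B" "f q = e" "f r = e"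
    "sg q = 1" "sg r = -1"
proof -
  obtain q r where qr: "{x\<in>B. f x = e} = {q, r}" "sg q = 1" "sg r = -1"
    using assms by (auto simp: halves_def)
  moreover have "q \<in> {x\<in>B. f x = e}" "r \<in> {x\<in>B. f x = e}" unfolding qr by auto
  ultimately show ?thesis by (intro that[of q r]) auto
qed

lemma halves_pair:
  assumes "halves B f sg" "q \<in> B" "r \<in> B" "q \<noteq> r" "f q = f r"
  shows "{x\<in>B. f x = f q} = {q, r}" "sg r = - sg q" "\<bar>sg q\<bar> = 1"
proof -
  obtain a b where "{x\<in>B. f x = f q} = {a, b}" "sg a = 1" "sg b = -1"
    by (rule halvesE[OF assms(1), of "f q"]) (use assms in auto)
  moreover have "q \<in> {x\<in>B. f x = f q}" "r \<in> {x\<in>B. f x = f q}" using assms by auto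
  ultimately show "{x\<in>B. f x = f q} = {q, r}" "sg r = - sg q" "\<bar>sg q\<bar> = 1"
    using assms(4) by auto
qed

lemma halves_other:
  assumes "halves B f sg" "q \<in> B"
  obtains r where "r \<in> B" "r \<noteq> q" "f r = f q"
proof -
  obtain a b where *: "a \<noteq> b" "{x\<in>B. f x = f q} = {a, b}" "f a = f q" "f b = f q" "a \<in> B" "b \<in> B"
    by (rule halvesE[OF assms(1), of "f q"]) (use assms in auto)
  moreover have "q \<in> {x\<in>B. f x = f q}" using assms by auto
  ultimately have "q = a \<or> q = b" by auto
  then show ?thesis using that[of a] that[of b] * by metis
qed

lemma abs_sg: "halves B f sg \<Longrightarrow> q \<in> B \<Longrightarrow> \<bar>sg q\<bar> = 1"
  by (metis halves_other halves_pair(3))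

lemma sum_by_edges:
  fixes h :: "'q \<Rightarrow> 'a::comm_monoid_add"
  assumes "halves B f sg"
  shows "sum h {q\<in>B. f q \<in> A} = (\<Sum>e\<in>A \<inter> f ` B. sum h {q\<in>B. f q = e})"
proof -
  have fin: "finite B" using assms by (simp add: halves_def)
  have "(\<Sum>e\<in>A \<inter> f ` B. sum h {q\<in>{q\<in>B. f q \<in> A}. f q = e}) = sum h {q\<in>B. f q \<in> A}"
    by (rule sum.group) (use fin in auto)
  then show ?thesis by (auto intro!: sum.cong elim!: trans[rotated] simp: conj_ac cong: conj_cong) 
qed

lemma sum_edge_cancel:
  fixes h :: "'q \<Rightarrow> int"
  assumes "halves B f sg"
    and "\<And>q r. q \<in> B \<Longrightarrow> r \<in> B \<Longrightarrow> q \<noteq> r \<Longrightarrow> f q = f r \<Longrightarrow> f q \<in> A \<Longrightarrow> h q + h r = 0"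
  shows "sum h {q\<in>B. f q \<in> A} = 0"
  unfolding sum_by_edges[OF assms(1)]
proof (rule sum.neutral, safe)
  fix q assume "q \<in> B" "f q \<in> A"
  moreover obtain r where r: "r \<in> B" "r \<noteq> q" "f r = f q" using halves_other[OF assms(1) \<open>q \<in> B\<close>] .
  moreover have "{x\<in>B. f x = f q} = {q, r}" using halves_pair(1)[OF assms(1) \<open>q \<in> B\<close> r(1)] r by metis
  ultimately show "sum h {x\<in>B. f x = f q} = 0" using assms(2)[of q r] by simp
qed

lemma pairing_single:
  assumes "halves B f sg" "q \<in> B" "r \<in> B" "q \<noteq> r" "f q = f r"
  shows "pairing B f sg k (\<lambda>e. if e = f q then a else 0) g = a * sg q * (g (k q) - g (k r))"
proof -
  note * = halves_pair[OF assms]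
  have fin: "finite B" using assms by (simp add: halves_def)
  have "pairing B f sg k (\<lambda>e. if e = f q then a else 0) g
      = (\<Sum>x\<in>{x\<in>B. f x = f q}. g (k x) * (sg x * a))"
    unfolding pairing_def using fin by (auto simp: sum.inter_filter if_distrib cong: if_cong)
  also have "\<dots> = a * sg q * (g (k q) - g (k r))"
    unfolding *(1) using assms(4) *(2) by (simp add: algebra_simps)
  finally show ?thesis .
qed

text \<open>Induction by contracting an edge of \<open>D\<close> that is not a loop.\<close>

lemma nontrivial_flow:
  fixes k :: "'q \<Rightarrow> 'v"
  assumes h: "halves B f sg" and "finite V" "D \<subseteq> f ` B" "D \<noteq> {}" "card V \<le> card D"
    "\<And>q. q \<in> B \<Longrightarrow> f q \<in> D \<Longrightarrow> k q \<in> V"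
  shows "\<exists>z. (\<forall>e. e \<notin> D \<longrightarrow> z e = 0) \<and> (\<exists>e. z e \<noteq> 0) \<and> (\<forall>g. pairing B f sg k z g = 0)"
  using assms(2-)
proof (induction "card V" arbitrary: V D k rule: less_induct)
  case less
  have finD: "finite D" using less.prems(2) h finite_surj unfolding halves_def by blast
  obtain e where e: "e \<in> D" using less.prems by auto
  then obtain q r where qr: "q \<in> B" "r \<in> B" "q \<noteq> r" "f q = e" "f r = e" "sg q = 1"
    using halvesE[OF h, of e] less.prems(2) by (metis subsetD)
  note single = pairing_single[OF h qr(1-3), unfolded qr(4,5), OF refl]
  show ?case
  proof (cases "k q = k r")
    case True
    then have "pairing B f sg k (\<lambda>x. if x = e then 1 else 0) g = 0" for g
      by (simp add: single)
    then show ?thesis using e by (intro exI[of _ "\<lambda>x. if x = e then 1 else 0"]) auto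
  next
    case False
    have V: "k q \<in> V" "k r \<in> V" using less.prems(5) qr e by auto
    \<comment> \<open>Contraction of \<open>e\<close> as a change of the vertex map alone:
      \<open>k q\<close> is moved to \<open>k r\<close>, and the half-edges stay the same.\<close>
    define k' where "k' = (\<lambda>x. if k x = k q then k r else k x)"
    have "card V \<ge> 2"
      using card_mono[of V "{k q, k r}"] V False less.prems(1) by auto
    then have "card D \<ge> 2" using less.prems by simp
    have cD: "card (D - {e}) = card D - 1" "card (V - {k q}) = card V - 1" using e V by auto
    have "D - {e} \<noteq> {}" using cD \<open>card D \<ge> 2\<close> by fastforce
    moreover have "card (V - {k q}) < card V" using \<open>card V \<ge> 2\<close> cD by linarith
    moreover have "k' x \<in> V - {k q}" if "x \<in> B" "f x \<in> D - {e}" for x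
      using that less.prems(5) V False by (auto simp: k'_def)
    moreover have "card (V - {k q}) \<le> card (D - {e})" using cD less.prems by linarith
    moreover have "finite (V - {k q})" "D - {e} \<subseteq> f ` B" using less.prems(1,2) by auto
    ultimately have "\<exists>z. (\<forall>x. x \<notin> D - {e} \<longrightarrow> z x = 0) \<and> (\<exists>x. z x \<noteq> 0) \<and>
        (\<forall>g. pairing B f sg k' z g = 0)"
      by (intro less.hyps[of "V - {k q}"])
    then obtain z where z: "\<And>x. x \<notin> D - {e} \<Longrightarrow> z x = 0" "\<exists>x. z x \<noteq> 0"
        "\<And>g. pairing B f sg k' z g = 0"
      by auto
    \<comment> \<open>In the contracted graph only the sum of the net flows at \<open>k q\<close>
      and \<open>k r\<close> is known to vanish. The excess at \<open>k q\<close> is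
      \<open>p\<close>, and the value \<open>- p\<close> on \<open>e\<close> carries it over to
      \<open>k r\<close>.\<close>
    define p where "p = pairing B f sg k z (\<lambda>v. of_bool (v = k q))"
    define w where "w = (\<lambda>x. z x + (if x = e then - p else 0))"
    have "pairing B f sg k w g = 0" for g
    proof -
      have "pairing B f sg k z g - pairing B f sg k' z g = p * (g (k q) - g (k r))"
        unfolding p_def pairing_def sum_distrib_right sum_subtractf[symmetric]
        by (auto intro!: sum.cong simp: k'_def algebra_simps)
      then have "pairing B f sg k z g = p * (g (k q) - g (k r))" using z(3) by simp
      then show ?thesis unfolding w_def pairing_add single qr by simp
    qed
    moreover have "w x = 0" if "x \<notin> D" for x using that z(1)[of x] e by (auto simp: w_def)
    moreover have "\<exists>x. w x \<noteq> 0" using z(2) z(1)[of e] unfolding w_def by (metis add.right_neutral Diff_iff singletonI)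
    ultimately show ?thesis by blast
  qed
qed

text \<open>The vertex map \<open>h\<close> is a parameter because the lemma serves subgraphs of a
  graph, with \<open>h = k\<close>, as well as contracted graphs, where \<open>h\<close> sends a
  half-edge to a class. A loop contributes both of its halves.\<close>

lemma valency_eq_card:
  assumes h: "halves B f sg" and C: "C \<subseteq> f ` B" "gedges M = C"
    and M: "\<And>e. e \<in> C \<Longrightarrow> gends M e = image_mset h (mset_set {x\<in>B. f x = e})"
  shows "valency M v = card {q\<in>B. f q \<in> C \<and> h q = v}"
proof -
  have fin: "finite B" using h by (simp add: halves_def)
  have c: "count (image_mset h (mset_set F)) v = (\<Sum>x\<in>F. of_bool (h x = v))" if "finite F" for F
    using that by (auto simp: count_image_mset of_bool_def sum.If_cases Int_def conj_commute vimage_def)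
  have "valency M v = (\<Sum>e\<in>C \<inter> f ` B. \<Sum>x\<in>{x\<in>B. f x = e}. of_bool (h x = v))"
    unfolding valency_def C(2) using C(1) fin by (intro sum.cong) (auto simp: M c)
  also have "\<dots> = (\<Sum>x\<in>{x\<in>B. f x \<in> C}. of_bool (h x = v))" by (rule sum_by_edges[OF h, symmetric])
  also have "\<dots> = card {q\<in>B. f q \<in> C \<and> h q = v}"
    using fin by (simp add: of_bool_def sum.If_cases Int_def conj_assoc)
  finally show ?thesis .
qed

lemma card_half_edges:
  assumes h: "halves B f sg" and C: "C \<subseteq> f ` B"
  shows "card {q\<in>B. f q \<in> C} = 2 * card C"
proof -
  have "card {q\<in>B. f q \<in> C} = (\<Sum>e\<in>C \<inter> f ` B. card {q\<in>B. f q = e})"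
    using sum_by_edges[OF h, of "\<lambda>_. 1::nat" C] by simp
  also have "\<dots> = (\<Sum>e\<in>C. 2)"
  proof (rule sum.cong)
    fix e assume "e \<in> C"
    then have "e \<in> f ` B" using C by auto
    then obtain q r where "q \<noteq> r" "{x\<in>B. f x = e} = {q, r}" using halvesE[OF h] by metis
    then show "card {q\<in>B. f q = e} = 2" by simp
  qed (use C in auto)
  finally show ?thesis by simp
qed

text \<open>Double counting: the valencies add up to \<open>2 * card C\<close>, which is at most
  \<open>2 * card W\<close>, while each of them is at least 2. So all these inequalities are
  equalities.\<close>

lemma all_valencies_2:
  assumes h: "halves B f sg" and C: "C \<subseteq> f ` B" and W: "finite W" "\<And>q. q \<in> B \<Longrightarrow> f q \<in> C \<Longrightarrow> h q \<in> W"
    and val: "\<And>v. v \<in> W \<Longrightarrow> 2 \<le> card {q\<in>B. f q \<in> C \<and> h q = v}" and le: "card C \<le> card W"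
  shows "card C = card W \<and> (\<forall>v\<in>W. card {q\<in>B. f q \<in> C \<and> h q = v} = 2)"
proof -
  have fin: "finite B" using h by (simp add: halves_def)
  have "(\<Sum>v\<in>W. \<Sum>q\<in>{q\<in>{q\<in>B. f q \<in> C}. h q = v}. 1::nat) = (\<Sum>q\<in>{q\<in>B. f q \<in> C}. 1)"
    by (rule sum.group) (use fin W in auto)
  then have s: "(\<Sum>v\<in>W. card {q\<in>B. f q \<in> C \<and> h q = v}) = 2 * card C"
    using card_half_edges[OF h C] by (simp add: conj_assoc)
  moreover have "(\<Sum>v\<in>W. 2) \<le> (\<Sum>v\<in>W. card {q\<in>B. f q \<in> C \<and> h q = v})" by (rule sum_mono) (rule val)
  ultimately have c: "card C = card W" using le by simp
  have "\<forall>v\<in>W. (\<Sum>v\<in>W. 2::nat) = (\<Sum>v\<in>W. card {q\<in>B. f q \<in> C \<and> h q = v})" using s c by simp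
  then have "card {q\<in>B. f q \<in> C \<and> h q = v} = 2" if "v \<in> W" for v
    using sum_mono_inv[of "\<lambda>_. 2::nat" W "\<lambda>v. card {q\<in>B. f q \<in> C \<and> h q = v}" v] val that W(1) s c by simp
  then show ?thesis using c by blast
qed

lemma two_elements:
  assumes "card A = 2" "q \<in> A" "r \<in> A" "q \<noteq> r"
  shows "A = {q, r}"
  using assms by (metis card_2_iff doubleton_eq_iff insertE singletonD)

text \<open>A walk alternates between passing to the other half of an edge and to another half-edge
  at the same vertex; \<open>X\<close> changes at neither kind of step.\<close>

lemma constant_on_connected:
  assumes R: "\<And>u v. (u, v) \<in> R \<Longrightarrow> \<exists>q\<in>H. \<exists>r\<in>H. f q = f r \<and> h q = u \<and> h r = v"
    and conn: "\<And>u v. u \<in> h ` H \<Longrightarrow> v \<in> h ` H \<Longrightarrow> (u, v) \<in> R\<^sup>*"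
    and edge: "\<And>q r. q \<in> H \<Longrightarrow> r \<in> H \<Longrightarrow> f q = f r \<Longrightarrow> X q = X r"
    and vertex: "\<And>q r. q \<in> H \<Longrightarrow> r \<in> H \<Longrightarrow> h q = h r \<Longrightarrow> X q = X r"
    and "q \<in> H" "r \<in> H"
  shows "X q = X r"
proof -
  have "(h q, v) \<in> R\<^sup>* \<Longrightarrow> \<forall>r\<in>H. h r = v \<longrightarrow> X r = X q" for v
  proof (induction rule: rtrancl_induct)
    case base
    then show ?case using vertex assms(5) by blast
  next
    case (step u v)
    then show ?case using R[OF step(2)] edge vertex by metis
  qed
  then show ?thesis using conn[of "h q" "h r"] assms(5,6) by auto
qed

definition supp :: "('e \<Rightarrow> int) \<Rightarrow> 'e set" where "supp z = {e. z e \<noteq> 0}"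

lemma unit_square: "\<bar>a\<bar> = 1 \<Longrightarrow> a * a = (1::int)"
  by (metis abs_mult_self_eq mult_1)

section \<open>Flows, paths and cuts\<close>

locale half_edge_graph =
  fixes G :: "('v, 'e) multigraph" and B :: "'q set" and f :: "'q \<Rightarrow> 'e" and k :: "'q \<Rightarrow> 'v"
    and sg :: "'q \<Rightarrow> int"
  assumes hv: "halves B f sg" and finV: "finite (gverts G)" and edges: "f ` B = gedges G"
    and verts: "k ` B \<subseteq> gverts G"
    and ends: "\<And>e. e \<in> gedges G \<Longrightarrow> gends G e = image_mset k (mset_set {x\<in>B. f x = e})"
begin

lemma finB: "finite B" using hv by (simp add: halves_def)

lemma finE: "finite (gedges G)" using finB edges by (metis finite_imageI)

text \<open>The elements of first homology: a boundary is zero iff it pairs to zero with every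
  vertex function. Testing against functions makes cuts a matter of choosing
  \<open>g\<close>.\<close>

definition flow :: "('e \<Rightarrow> int) \<Rightarrow> bool" where
  "flow z \<longleftrightarrow> supp z \<subseteq> gedges G \<and> (\<forall>g. pairing B f sg k z g = 0)"

lemma gends_pair:
  assumes "q \<in> B" "r \<in> B" "q \<noteq> r" "f q = f r"
  shows "gends G (f q) = {#k q, k r#}"
  using halves_pair(1)[OF hv assms] assms ends[of "f q"] edges by auto

lemma adjacent_by_iff:
  assumes "A \<subseteq> gedges G"
  shows "(u, v) \<in> adjacent_by G A \<longleftrightarrow>
    (\<exists>q r. q \<in> B \<and> r \<in> B \<and> q \<noteq> r \<and> f q = f r \<and> f q \<in> A \<and> k q = u \<and> k r = v)"
proof
  assume "(u, v) \<in> adjacent_by G A"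
  then obtain e where e: "e \<in> A" "gends G e = {#u, v#}" by (auto simp: adjacent_by_def)
  then obtain q r where qr: "q \<noteq> r" "q \<in> B" "r \<in> B" "f q = e" "f r = e"
    using halvesE[OF hv, of e] assms edges by (metis subsetD)
  then have "{#k q, k r#} = {#u, v#}" using gends_pair[of q r] e by simp
  then have "k q = u \<and> k r = v \<or> k q = v \<and> k r = u" by (metis add_mset_eq_single add_eq_conv_ex add_mset_eq_singleton_iff)
  then show "\<exists>q r. q \<in> B \<and> r \<in> B \<and> q \<noteq> r \<and> f q = f r \<and> f q \<in> A \<and> k q = u \<and> k r = v"
    using qr e by metis
next
  assume "\<exists>q r. q \<in> B \<and> r \<in> B \<and> q \<noteq> r \<and> f q = f r \<and> f q \<in> A \<and> k q = u \<and> k r = v"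
  then show "(u, v) \<in> adjacent_by G A" using gends_pair unfolding adjacent_by_def by blast
qed

lemma sym_adjacent: "sym (adjacent_by G A)"
  by (auto simp: sym_def adjacent_by_def add_mset_commute)

lemma sym_connected: "(u, v) \<in> (adjacent_by G A)\<^sup>* \<Longrightarrow> (v, u) \<in> (adjacent_by G A)\<^sup>*"
  by (metis sym_adjacent sym_rtrancl symD)

lemma path_chain:
  assumes "(u, v) \<in> (adjacent_by G A)\<^sup>*" "A \<subseteq> gedges G"
  shows "\<exists>c. supp c \<subseteq> A \<and> (\<forall>g. pairing B f sg k c g = g v - g u)"
  using assms(1)
proof (induction rule: rtrancl_induct)
  case base
  show ?case by (intro exI[of _ "\<lambda>_. 0"]) (simp add: supp_def pairing_def)
next
  case (step v w)
  then obtain c where c: "supp c \<subseteq> A" "\<And>g. pairing B f sg k c g = g v - g u" by auto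
  obtain q r where qr: "q \<in> B" "r \<in> B" "q \<noteq> r" "f q = f r" "f q \<in> A" "k q = v" "k r = w"
    using step(2) adjacent_by_iff[OF assms(2)] by auto
  define c' where "c' = (\<lambda>e. c e + (if e = f q then - sg q else 0))"
  have "sg q * sg q = 1" using abs_sg[OF hv qr(1)] by (auto simp: abs_if split: if_splits)
  then have "pairing B f sg k c' g = g w - g u" for g
    unfolding c'_def pairing_add pairing_single[OF hv qr(1-4)] c(2) using qr by simp
  moreover have "supp c' \<subseteq> A" using c(1) qr(5) by (auto simp: supp_def c'_def split: if_splits)
  ultimately show ?case by blast
qed

text \<open>On an edge of \<open>A\<close> both halves have the same weight and opposite signs, so
  these edges drop out of the pairing of \<open>z\<close> with \<open>g\<close>.\<close>

lemma cut:
  assumes "flow z" "A \<subseteq> gedges G" and g: "\<And>u v. (u, v) \<in> adjacent_by G A \<Longrightarrow> g u = g v"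
  shows "(\<Sum>q\<in>{q\<in>B. f q \<notin> A}. g (k q) * (sg q * z (f q))) = 0"
proof -
  let ?h = "\<lambda>q. g (k q) * (sg q * z (f q))"
  have "sum ?h {q\<in>B. f q \<in> A} = 0"
  proof (rule sum_edge_cancel[OF hv])
    fix q r assume qr: "q \<in> B" "r \<in> B" "q \<noteq> r" "f q = f r" "f q \<in> A"
    then have "g (k q) = g (k r)" by (intro g) (use adjacent_by_iff[OF assms(2)] in blast)
    then show "?h q + ?h r = 0" using halves_pair(2)[OF hv qr(1-4)] qr(4) by simp
  qed
  moreover have "sum ?h B = sum ?h {q\<in>B. f q \<in> A} + sum ?h {q\<in>B. f q \<notin> A}"
    by (subst sum.union_disjoint[symmetric]) (use finB in \<open>auto intro!: sum.cong\<close>)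
  ultimately show ?thesis using assms(1) by (simp add: flow_def pairing_def)
qed

lemma cut_indicator:
  assumes "flow z" "A \<subseteq> gedges G" and "\<And>u v. (u, v) \<in> adjacent_by G A \<Longrightarrow> u \<in> K \<longleftrightarrow> v \<in> K"
  shows "(\<Sum>q\<in>{q\<in>B. f q \<notin> A \<and> k q \<in> K \<and> z (f q) \<noteq> 0}. sg q * z (f q)) = 0"
proof -
  have "(\<Sum>q\<in>{q\<in>B. f q \<notin> A \<and> k q \<in> K \<and> z (f q) \<noteq> 0}. sg q * z (f q)) =
     (\<Sum>q\<in>{q\<in>B. f q \<notin> A}. of_bool (k q \<in> K) * (sg q * z (f q)))"
    using finB by (intro sum.mono_neutral_cong_left) auto
  also have "\<dots> = 0" by (rule cut[OF assms(1,2)]) (use assms(3) in auto)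
  finally show ?thesis .
qed

text \<open>A path between the ends of an edge that avoids this edge is closed up by it to a
  flow.\<close>

lemma edge_in_flow:
  assumes "q \<in> B" "r \<in> B" "q \<noteq> r" "f q = f r" "A \<subseteq> gedges G" "(k q, k r) \<in> (adjacent_by G (A - {f q}))\<^sup>*"
  shows "\<exists>z. flow z \<and> z (f q) \<noteq> 0 \<and> supp z \<subseteq> insert (f q) A"
proof -
  obtain c where c: "supp c \<subseteq> A - {f q}" "\<And>g. pairing B f sg k c g = g (k r) - g (k q)"
    using path_chain[OF assms(6)] assms(5) by blast
  define z where "z = (\<lambda>e. c e + (if e = f q then sg q else 0))"
  have s: "sg q * sg q = 1" using abs_sg[OF hv assms(1)] by (auto simp: abs_if split: if_splits)
  have "pairing B f sg k z g = 0" for g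
    unfolding z_def pairing_add pairing_single[OF hv assms(1-4)] c(2) using s by simp
  moreover have "supp z \<subseteq> insert (f q) A" using c(1) by (auto simp: supp_def z_def split: if_splits)
  moreover have "c (f q) = 0" using c(1) by (auto simp: supp_def)
  then have "z (f q) \<noteq> 0" using s by (auto simp: z_def)
  moreover have "f q \<in> gedges G" using edges assms(1) by auto
  ultimately show ?thesis using assms(5) unfolding flow_def by blast
qed

text \<open>Otherwise the vertices reachable from \<open>k q\<close> without the edge form a set
  which \<open>z\<close> leaves through the half-edge \<open>q\<close> only, although the net flow
  out of it is zero. With \<open>edge_in_flow\<close> this characterizes bridges as the edges on
  which all flows vanish.\<close>

lemma edge_in_flow_connected:
  assumes "q \<in> B" "r \<in> B" "q \<noteq> r" "f q = f r" "A \<subseteq> gedges G" "flow z" "supp z \<subseteq> A" "z (f q) \<noteq> 0"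
  shows "(k q, k r) \<in> (adjacent_by G (A - {f q}))\<^sup>*"
proof (rule ccontr)
  define K where "K = {v. (k q, v) \<in> (adjacent_by G (A - {f q}))\<^sup>*}"
  assume "\<not> ?thesis"
  then have r: "k r \<notin> K" "k q \<in> K" by (auto simp: K_def)
  have "{x\<in>B. f x \<notin> A - {f q} \<and> k x \<in> K \<and> z (f x) \<noteq> 0} = {q}"
  proof -
    have "x = q" if "x \<in> B" "f x \<notin> A - {f q}" "k x \<in> K" "z (f x) \<noteq> 0" for x
    proof -
      have "f x = f q" using that assms(7) by (auto simp: supp_def)
      then have "x \<in> {q, r}" using halves_pair(1)[OF hv assms(1-4)] that by auto
      then show ?thesis using r that by auto
    qed
    moreover have "q \<in> {x\<in>B. f x \<notin> A - {f q} \<and> k x \<in> K \<and> z (f x) \<noteq> 0}" using assms(1,8) r(2) by simp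
    ultimately show ?thesis by blast
  qed
  moreover have "(\<Sum>x\<in>{x\<in>B. f x \<notin> A - {f q} \<and> k x \<in> K \<and> z (f x) \<noteq> 0}. sg x * z (f x)) = 0"
  proof (rule cut_indicator[OF assms(6)])
    fix u v assume "(u, v) \<in> adjacent_by G (A - {f q})"
    then show "u \<in> K \<longleftrightarrow> v \<in> K" unfolding K_def
      by (auto intro: rtrancl_into_rtrancl dest: symD[OF sym_adjacent])
  qed (use assms(5) in auto)
  ultimately show False using assms(8) abs_sg[OF hv assms(1)] by auto
qed

lemma vertex_sum:
  assumes "flow z" "supp z \<subseteq> C"
  shows "(\<Sum>x\<in>{x\<in>B. f x \<in> C \<and> k x = v}. sg x * z (f x)) = 0"
proof -
  have "(\<Sum>x\<in>{x\<in>B. f x \<in> C \<and> k x = v}. sg x * z (f x)) = pairing B f sg k z (\<lambda>u. of_bool (u = v))"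
    unfolding pairing_def using finB assms(2) by (intro sum.mono_neutral_cong_left) (auto simp: supp_def)
  then show ?thesis using assms(1) by (simp add: flow_def)
qed

text \<open>By hypothesis no edge of the support leaves \<open>K\<close>. So instead of cutting down
  \<open>z\<close> one may multiply the test function by the indicator of \<open>K\<close>.\<close>

lemma restrict_flow:
  assumes z: "flow z"
    and K: "\<And>q r. q \<in> B \<Longrightarrow> r \<in> B \<Longrightarrow> f q = f r \<Longrightarrow> z (f q) \<noteq> 0 \<Longrightarrow> k q \<in> K \<Longrightarrow> k r \<in> K"
  shows "flow (\<lambda>e. if \<exists>q\<in>B. f q = e \<and> k q \<in> K then z e else 0)"
proof -
  define w where "w = (\<lambda>e. if \<exists>q\<in>B. f q = e \<and> k q \<in> K then z e else 0)"
  have "pairing B f sg k w g = pairing B f sg k z (\<lambda>v. g v * of_bool (v \<in> K))" for g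
    unfolding pairing_def
  proof (rule sum.cong)
    fix q assume q: "q \<in> B"
    show "g (k q) * (sg q * w (f q)) = g (k q) * of_bool (k q \<in> K) * (sg q * z (f q))"
    proof (cases "z (f q) = 0")
      case False
      have "(\<exists>r\<in>B. f r = f q \<and> k r \<in> K) = (k q \<in> K)"
      proof (intro iffI)
        assume "\<exists>r\<in>B. f r = f q \<and> k r \<in> K"
        then obtain r where r: "r \<in> B" "f r = f q" "k r \<in> K" by auto
        show "k q \<in> K" by (rule K[OF r(1) q r(2) _ r(3)]) (use False r in simp)
      qed (use q in auto)
      then show ?thesis by (simp add: w_def)
    qed (simp add: w_def)
  qed simp
  moreover have "supp w \<subseteq> supp z" by (auto simp: supp_def w_def)
  ultimately have "flow w" using z unfolding flow_def by auto
  then show ?thesis by (simp add: w_def)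
qed

section \<open>Cycles as minimal supports of flows\<close>

definition circuits :: "'e set set" where
  "circuits = {C. C \<noteq> {} \<and> (\<exists>z. flow z \<and> supp z = C) \<and>
     (\<forall>z. flow z \<longrightarrow> supp z \<subseteq> C \<longrightarrow> supp z \<noteq> {} \<longrightarrow> supp z = C)}"

text \<open>At a vertex of a cycle just two half-edges meet, so a flow supported on the cycle
  vanishes on both or on neither, and by connectedness everywhere or nowhere. A nonzero flow exists
  because there are as many edges as vertices.\<close>

lemma cycle_imp_circuit:
  assumes "C \<in> cycles G"
  shows "C \<in> circuits"
proof -
  define H where "H = {q\<in>B. f q \<in> C}"
  define W where "W = (\<Union>e\<in>C. set_mset (gends G e))"
  define M where "M = \<lparr> gverts = W, gedges = C, gends = gends G \<rparr>"
  have C: "C \<subseteq> gedges G" and cyc: "is_cycle M" using assms by (auto simp: cycles_def M_def W_def)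
  have W: "W = k ` H"
    unfolding W_def H_def using C finB by (auto simp: ends subset_iff)
  have val: "card {q\<in>B. f q \<in> C \<and> k q = v} = 2" if "v \<in> W" for v
    using valency_eq_card[OF hv, of C M k v] C ends cyc edges that
    by (auto simp: M_def is_cycle_def subset_iff)
  have conn: "(u, v) \<in> (adjacent_by G C)\<^sup>*" if "u \<in> W" "v \<in> W" for u v
    using cyc that by (auto simp: M_def is_cycle_def graph_connected_def adjacent_by_def)
  have ne: "C \<noteq> {}" "card C = card W" "finite W" using cyc by (auto simp: M_def is_cycle_def)
  have full: "supp z = C" if z: "flow z" "supp z \<subseteq> C" "supp z \<noteq> {}" for z
  proof -
    have vertex: "(z (f q) = 0) = (z (f r) = 0)" if "q \<in> H" "r \<in> H" "k q = k r" for q r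
    proof (cases "q = r")
      case False
      have eq: "{x\<in>B. f x \<in> C \<and> k x = k q} = {q, r}"
      proof (rule two_elements)
        show "card {x\<in>B. f x \<in> C \<and> k x = k q} = 2" using that W by (intro val) simp
      qed (use that False in \<open>simp_all add: H_def\<close>)
      have "sg q * z (f q) + sg r * z (f r) = 0"
        using vertex_sum[OF z(1,2), of "k q"] unfolding eq using False by simp
      moreover have "sg q \<noteq> 0" "sg r \<noteq> 0" using abs_sg[OF hv] that unfolding H_def by fastforce+
      ultimately show ?thesis by (metis add_0 add.right_neutral mult_eq_0_iff)
    next
      case True
      then show ?thesis by simp
    qed
    have "(z (f q) = 0) = (z (f r) = 0)" if "q \<in> H" "r \<in> H" for q r
    proof (rule constant_on_connected[where R="adjacent_by G C" and h=k and f=f and H=H and X="\<lambda>q. z (f q) = 0"])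
      fix u v assume "(u, v) \<in> adjacent_by G C"
      then obtain q r where "q \<in> B" "r \<in> B" "f q = f r" "f q \<in> C" "k q = u" "k r = v"
        unfolding adjacent_by_iff[OF C] by blast
      then show "\<exists>q\<in>H. \<exists>r\<in>H. f q = f r \<and> k q = u \<and> k r = v"
        by (intro bexI[of _ q] bexI[of _ r]) (simp_all add: H_def)
    next
      fix u v assume "u \<in> k ` H" "v \<in> k ` H"
      then show "(u, v) \<in> (adjacent_by G C)\<^sup>*" using conn W by simp
    next
      fix q r assume "q \<in> H" "r \<in> H" "k q = k r"
      then show "(z (f q) = 0) = (z (f r) = 0)" by (rule vertex)
    qed (use that in simp_all)
    moreover have CH: "C = f ` H" using C unfolding edges[symmetric] by (auto simp: H_def)
    moreover obtain q where "q \<in> H" "z (f q) \<noteq> 0"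
    proof -
      obtain e where "e \<in> supp z" using z(3) by auto
      then show ?thesis using that z(2) CH by (auto simp: supp_def)
    qed
    ultimately have "z e \<noteq> 0" if "e \<in> C" for e using that by blast
    then show ?thesis using z(2) unfolding supp_def by blast
  qed
  have "C \<subseteq> f ` B" "card W \<le> card C" "\<And>q. q \<in> B \<Longrightarrow> f q \<in> C \<Longrightarrow> k q \<in> W"
    using C edges ne W by (simp_all add: H_def)
  then obtain z where "\<forall>e. e \<notin> C \<longrightarrow> z e = 0" "\<exists>e. z e \<noteq> 0" "\<forall>g. pairing B f sg k z g = 0"
    using nontrivial_flow[OF hv ne(3) _ ne(1)] by metis
  then have "flow z" "supp z \<subseteq> C" "supp z \<noteq> {}" using C by (auto simp: flow_def supp_def)
  then show ?thesis using full ne unfolding circuits_def by blast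
qed

text \<open>There are at most as many edges as vertices, as otherwise \<open>C\<close> minus an edge
  would still carry a nonzero flow. No vertex has only one half-edge, since a flow would vanish on
  it. Counting then forces valency 2, and minimality forces connectedness.\<close>

lemma circuit_imp_cycle:
  assumes "C \<in> circuits"
  shows "C \<in> cycles G"
proof -
  obtain z where ne: "C \<noteq> {}" and z: "flow z" "supp z = C"
    and min: "\<And>z. flow z \<Longrightarrow> supp z \<subseteq> C \<Longrightarrow> supp z \<noteq> {} \<Longrightarrow> supp z = C"
    using assms by (auto simp: circuits_def)
  have C: "C \<subseteq> gedges G" using z by (auto simp: flow_def)
  have finC: "finite C" using C finE finite_subset by blast
  define H where "H = {q\<in>B. f q \<in> C}"
  define W where "W = k ` H"
  have finW: "finite W" using finB by (simp add: W_def H_def)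
  have CH: "C = f ` H" using C edges by (auto simp: H_def)
  have "W \<noteq> {}" using ne CH by (auto simp: W_def)
  have le: "card C \<le> card W"
  proof (rule ccontr)
    assume n: "\<not> ?thesis"
    obtain e where e: "e \<in> C" using ne by auto
    have c: "card W \<le> card (C - {e})" using e n by auto
    moreover have "card W > 0" using \<open>W \<noteq> {}\<close> finW by auto
    ultimately have "C - {e} \<noteq> {}" by fastforce
    then obtain w where w: "\<forall>x. x \<notin> C - {e} \<longrightarrow> w x = 0" "\<exists>e. w e \<noteq> 0" "\<forall>g. pairing B f sg k w g = 0"
      using nontrivial_flow[OF hv finW, of "C - {e}" k] c C edges by (auto simp: W_def H_def)
    then have "flow w" "supp w \<subseteq> C - {e}" "supp w \<noteq> {}" using C by (auto simp: flow_def supp_def)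
    then show False using min[of w] e by auto
  qed
  have val2: "2 \<le> card {q\<in>B. f q \<in> C \<and> k q = v}" if v: "v \<in> W" for v
  proof (rule ccontr)
    assume n: "\<not> ?thesis"
    obtain q where q: "q \<in> B" "f q \<in> C" "k q = v" using v by (auto simp: W_def H_def)
    have "{x\<in>B. f x \<in> C \<and> k x = v} = {q}"
    proof -
      have "card {x\<in>B. f x \<in> C \<and> k x = v} \<le> Suc 0" using n by simp
      then show ?thesis using q finB card_le_Suc0_iff_eq[of "{x\<in>B. f x \<in> C \<and> k x = v}"] by auto
    qed
    moreover have "(\<Sum>x\<in>{x\<in>B. f x \<in> C \<and> k x = v}. sg x * z (f x)) = 0"
      using z by (intro vertex_sum) auto
    ultimately have "sg q * z (f q) = 0" by simp
    then show False using q z abs_sg[OF hv, of q] by (auto simp: supp_def)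
  qed
  have tight: "card C = card W \<and> (\<forall>v\<in>W. card {q\<in>B. f q \<in> C \<and> k q = v} = 2)"
    by (rule all_valencies_2[OF hv _ finW _ val2 le]) (use C edges in \<open>auto simp: W_def H_def\<close>)
  have conn: "(u, v) \<in> (adjacent_by G C)\<^sup>*" if uv: "u \<in> W" "v \<in> W" for u v
  proof -
    \<comment> \<open>If \<open>K\<close> missed a vertex of \<open>W\<close>, the restriction of
      \<open>z\<close> to the edges at \<open>K\<close> would be a flow with smaller nonempty
      support.\<close>
    define K where "K = {w. (u, w) \<in> (adjacent_by G C)\<^sup>*}"
    define w where "w = (\<lambda>e. if \<exists>q\<in>B. f q = e \<and> k q \<in> K then z e else 0)"
    have K: "k q \<in> K \<longleftrightarrow> k r \<in> K" if "q \<in> H" "r \<in> H" "f q = f r" for q r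
    proof (cases "q = r")
      case False
      then have 1: "(k q, k r) \<in> adjacent_by G C"
        unfolding adjacent_by_iff[OF C] using that unfolding H_def by blast
      have "(k r, k q) \<in> adjacent_by G C" by (rule symD[OF sym_adjacent 1])
      with 1 show ?thesis unfolding K_def mem_Collect_eq by (meson rtrancl_into_rtrancl)
    next
      case True
      then show ?thesis by simp
    qed
    have "flow w"
      unfolding w_def
    proof (rule restrict_flow[OF z(1)])
      fix q r assume "q \<in> B" "r \<in> B" "f q = f r" "z (f q) \<noteq> 0" "k q \<in> K"
      then show "k r \<in> K" using K[of q r] z(2) by (auto simp: H_def supp_def)
    qed
    moreover have "supp w \<subseteq> C" using z(2) by (auto simp: w_def supp_def)
    moreover have "supp w \<noteq> {}"
    proof -
      obtain q where "q \<in> H" "k q = u" using uv by (auto simp: W_def)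
      then have "w (f q) = z (f q)" "z (f q) \<noteq> 0" using z(2) by (auto simp: w_def K_def H_def supp_def)
      then have "f q \<in> supp w" by (simp add: supp_def)
      then show ?thesis by blast
    qed
    ultimately have "supp w = C" by (rule min)
    obtain q where q: "q \<in> H" "k q = v" using uv by (auto simp: W_def)
    then have "w (f q) \<noteq> 0" using \<open>supp w = C\<close> by (auto simp: supp_def H_def)
    then obtain r where "r \<in> B" "f r = f q" "k r \<in> K" by (auto simp: w_def split: if_splits)
    then have "k q \<in> K" using K[of r q] q by (simp add: H_def)
    then show ?thesis using q by (simp add: K_def)
  qed
  have W: "W = (\<Union>e\<in>C. set_mset (gends G e))"
    unfolding W_def H_def using C finB by (auto simp: ends subset_iff)
  define M where "M = \<lparr> gverts = W, gedges = C, gends = gends G \<rparr>"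
  have "valency M v = 2" if "v \<in> W" for v
    using valency_eq_card[OF hv, of C M k v] C ends edges that tight by (auto simp: M_def subset_iff)
  moreover have "card C \<ge> 1" using ne finC by (simp add: Suc_leI card_gt_0_iff)
  ultimately have "is_cycle M"
    using tight conn finW finC \<open>W \<noteq> {}\<close>
    by (auto simp: is_cycle_def M_def graph_connected_def adjacent_by_def)
  then show ?thesis using C unfolding cycles_def M_def W by auto
qed

lemma cycles_eq_circuits: "cycles G = circuits"
  using cycle_imp_circuit circuit_imp_cycle by blast

section \<open>C1-sets of a graph\<close>

definition cls :: "'e set \<Rightarrow> 'v \<Rightarrow> 'v set" where
  "cls S v = {w \<in> gverts G. (v, w) \<in> (adjacent_by G (gedges G - S))\<^sup>*}"

lemma contract_outside_eq:
  "contract_outside G S = \<lparr> gverts = cls S ` gverts G, gedges = S, gends = \<lambda>e. image_mset (cls S) (gends G e) \<rparr>"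
  by (simp add: contract_outside_def cls_def[abs_def] Let_def)

lemma cls_eq_iff:
  assumes "u \<in> gverts G" "v \<in> gverts G"
  shows "cls S u = cls S v \<longleftrightarrow> (u, v) \<in> (adjacent_by G (gedges G - S))\<^sup>*"
proof
  assume "cls S u = cls S v"
  moreover have "v \<in> cls S v" using assms by (simp add: cls_def)
  ultimately have "v \<in> cls S u" by simp
  then show "(u, v) \<in> (adjacent_by G (gedges G - S))\<^sup>*" by (simp add: cls_def)
next
  assume "(u, v) \<in> (adjacent_by G (gedges G - S))\<^sup>*"
  then show "cls S u = cls S v"
    unfolding cls_def using sym_connected by (blast intro: rtrancl_trans)
qed

lemma gends_contract:
  assumes "e \<in> gedges G"
  shows "gends (contract_outside G S) e = image_mset (\<lambda>q. cls S (k q)) (mset_set {x\<in>B. f x = e})"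
  by (simp add: contract_outside_eq ends[OF assms] image_mset.compositionality comp_def)

definition same_support :: "'e \<Rightarrow> 'e set" where
  "same_support e = {e'\<in>gedges G. \<forall>z. flow z \<longrightarrow> (z e = 0 \<longleftrightarrow> z e' = 0)}"

text \<open>The condition on separating nodes of the partial normalization becomes the absence of
  bridges in the complement of \<open>S\<close>. The definition refers to the graph alone, so it is
  shared by all sign functions on the same half-edges.\<close>

definition C1 :: "'e set set" where
  "C1 = {S. S \<subseteq> gedges G \<and> (\<forall>e\<in>gedges G - S. \<forall>u v. gends G e = {#u, v#} \<longrightarrow>
       (u, v) \<in> (adjacent_by G (gedges G - S - {e}))\<^sup>*) \<and> is_cycle (contract_outside G S)}"

lemma C1_valency:
  assumes "S \<in> C1" "q \<in> B" "f q \<in> S"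
  shows "card {x\<in>B. f x \<in> S \<and> cls S (k x) = cls S (k q)} = 2"
proof -
  have S: "S \<subseteq> gedges G" "is_cycle (contract_outside G S)" using assms by (auto simp: C1_def)
  have "k q \<in> gverts G" using assms verts by auto
  then have "valency (contract_outside G S) (cls S (k q)) = 2"
    using S by (auto simp: is_cycle_def contract_outside_eq)
  then show ?thesis
    using valency_eq_card[OF hv, of S "contract_outside G S" "\<lambda>q. cls S (k q)" "cls S (k q)"] S edges gends_contract
    by (auto simp: contract_outside_eq subset_iff)
qed

lemma C1_half_edges:
  assumes "S \<in> C1" "q \<in> B" "f q \<in> S" "r \<in> B" "f r \<in> S" "q \<noteq> r" "cls S (k q) = cls S (k r)"
  shows "{x\<in>B. f x \<in> S \<and> cls S (k x) = cls S (k q)} = {q, r}"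
proof (rule two_elements)
  show "card {x\<in>B. f x \<in> S \<and> cls S (k x) = cls S (k q)} = 2" using assms by (intro C1_valency)
qed (use assms in simp_all)

text \<open>The vertex condition in the contracted graph: flow leaves a component of the complement
  of \<open>S\<close> only through edges of \<open>S\<close>.\<close>

lemma class_sum:
  assumes "flow z" "S \<subseteq> gedges G" "u \<in> gverts G"
  shows "(\<Sum>x\<in>{x\<in>B. f x \<in> S \<and> cls S (k x) = cls S u}. sg x * z (f x)) = 0"
proof -
  have "(\<Sum>x\<in>{x\<in>B. f x \<notin> gedges G - S \<and> k x \<in> {v. cls S v = cls S u} \<and> z (f x) \<noteq> 0}. sg x * z (f x)) = 0"
  proof (rule cut_indicator[OF assms(1)])
    fix v w assume a: "(v, w) \<in> adjacent_by G (gedges G - S)"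
    then have "v \<in> gverts G" "w \<in> gverts G"
      using verts adjacent_by_iff[of "gedges G - S"] by auto
    then have "cls S v = cls S w" using cls_eq_iff a by blast
    then show "v \<in> {v. cls S v = cls S u} \<longleftrightarrow> w \<in> {v. cls S v = cls S u}" by simp
  qed auto
  moreover have "(\<Sum>x\<in>{x\<in>B. f x \<notin> gedges G - S \<and> k x \<in> {v. cls S v = cls S u} \<and> z (f x) \<noteq> 0}. sg x * z (f x)) =
      (\<Sum>x\<in>{x\<in>B. f x \<in> S \<and> cls S (k x) = cls S u}. sg x * z (f x))"
    by (rule sum.mono_neutral_cong_left) (use finB edges in auto)
  ultimately show ?thesis by simp
qed

lemma C1_opposite:
  assumes "S \<in> C1" "q \<in> B" "f q \<in> S" "r \<in> B" "f r \<in> S" "q \<noteq> r" "cls S (k q) = cls S (k r)" "flow z"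
  shows "sg q * z (f q) + sg r * z (f r) = 0"
proof -
  have "S \<subseteq> gedges G" "k q \<in> gverts G" using assms verts by (auto simp: C1_def)
  from class_sum[OF assms(8) this] show ?thesis
    unfolding C1_half_edges[OF assms(1-7)] using assms(6) by simp
qed

text \<open>Walking around the contracted cycle: a property of half-edges that is kept across each
  edge of \<open>S\<close> and across each class is constant on \<open>S\<close>.\<close>

lemma C1_constant:
  assumes S: "S \<in> C1" and edge: "\<And>q r. q \<in> B \<Longrightarrow> r \<in> B \<Longrightarrow> f q \<in> S \<Longrightarrow> f q = f r \<Longrightarrow> X q = X r"
    and vertex: "\<And>q r. q \<in> B \<Longrightarrow> r \<in> B \<Longrightarrow> f q \<in> S \<Longrightarrow> f r \<in> S \<Longrightarrow> cls S (k q) = cls S (k r) \<Longrightarrow> q \<noteq> r \<Longrightarrow> X q = X r"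
    and "q \<in> B" "r \<in> B" "f q \<in> S" "f r \<in> S"
  shows "X q = X r"
proof -
  define H where "H = {q\<in>B. f q \<in> S}"
  have S': "S \<subseteq> gedges G" "is_cycle (contract_outside G S)" using S by (auto simp: C1_def)
  show ?thesis
  proof (rule constant_on_connected[where R="adjacent_by (contract_outside G S) S" and H=H and f=f
        and h="\<lambda>q. cls S (k q)" and X=X])
    fix u v assume "(u, v) \<in> adjacent_by (contract_outside G S) S"
    then obtain e where e: "e \<in> S" "gends (contract_outside G S) e = {#u, v#}" by (auto simp: adjacent_by_def)
    have "e \<in> f ` B" using e S' edges by auto
    then obtain a b where ab: "a \<noteq> b" "{x\<in>B. f x = e} = {a, b}" "a \<in> B" "b \<in> B" "f a = e" "f b = e"
      using halvesE[OF hv] by metis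
    then have "{#cls S (k a), cls S (k b)#} = {#u, v#}"
      using gends_contract[of e S] e S' by auto
    then have "cls S (k a) = u \<and> cls S (k b) = v \<or> cls S (k b) = u \<and> cls S (k a) = v"
      by (metis add_mset_eq_single add_eq_conv_ex add_mset_eq_singleton_iff)
    moreover have "a \<in> H" "b \<in> H" "f a = f b" using ab e by (simp_all add: H_def)
    ultimately show "\<exists>q\<in>H. \<exists>r\<in>H. f q = f r \<and> cls S (k q) = u \<and> cls S (k r) = v"
      by metis
  next
    fix u v assume "u \<in> (\<lambda>q. cls S (k q)) ` H" "v \<in> (\<lambda>q. cls S (k q)) ` H"
    then have "u \<in> cls S ` gverts G" "v \<in> cls S ` gverts G" using verts by (auto simp: H_def)
    then show "(u, v) \<in> (adjacent_by (contract_outside G S) S)\<^sup>*"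
      using S' by (auto simp: is_cycle_def graph_connected_def contract_outside_eq)
  next
    fix q r assume *: "q \<in> H" "r \<in> H" "f q = f r"
    show "X q = X r" by (rule edge) (use * in \<open>simp_all add: H_def\<close>)
  next
    fix q r assume *: "q \<in> H" "r \<in> H" "cls S (k q) = cls S (k r)"
    show "X q = X r"
    proof (cases "q = r")
      case False
      show ?thesis by (rule vertex) (use * False in \<open>simp_all add: H_def\<close>)
    qed simp
  qed (use assms(4-7) in \<open>simp_all add: H_def\<close>)
qed

lemma C1_abs_constant:
  assumes "S \<in> C1" "flow z" "q \<in> B" "r \<in> B" "f q \<in> S" "f r \<in> S"
  shows "\<bar>z (f q)\<bar> = \<bar>z (f r)\<bar>"
proof (rule C1_constant[OF assms(1), of "\<lambda>q. \<bar>z (f q)\<bar>"])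
  fix q r assume *: "q \<in> B" "r \<in> B" "f q \<in> S" "f r \<in> S" "cls S (k q) = cls S (k r)" "q \<noteq> r"
  then have "sg q * z (f q) = - (sg r * z (f r))" using C1_opposite[OF assms(1), of q r z] assms(2) by simp
  then have "\<bar>sg q\<bar> * \<bar>z (f q)\<bar> = \<bar>sg r\<bar> * \<bar>z (f r)\<bar>" by (simp flip: abs_mult)
  then show "\<bar>z (f q)\<bar> = \<bar>z (f r)\<bar>" using abs_sg[OF hv] * by simp
qed (use assms in simp_all)

lemma C1_nonempty: "S \<in> C1 \<Longrightarrow> S \<noteq> {}"
  by (auto simp: C1_def is_cycle_def contract_outside_eq)

end

section \<open>C1-sets of connected bridgeless graphs\<close>

locale bridgeless_graph = half_edge_graph G B f k sg
  for G :: "('v, 'e) multigraph" and B :: "'q set" and f :: "'q \<Rightarrow> 'e" and k :: "'q \<Rightarrow> 'v"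
    and sg :: "'q \<Rightarrow> int" +
  assumes conn: "\<And>u v. u \<in> gverts G \<Longrightarrow> v \<in> gverts G \<Longrightarrow> (u, v) \<in> (adjacent_by G (gedges G))\<^sup>*"
    and bridgeless: "\<And>e u v. e \<in> gedges G \<Longrightarrow> gends G e = {#u, v#} \<Longrightarrow>
      (u, v) \<in> (adjacent_by G (gedges G - {e}))\<^sup>*"
begin

lemma bridgeless_flow:
  assumes "e \<in> gedges G"
  obtains z where "flow z" "z e \<noteq> 0"
proof -
  obtain q r where qr: "q \<noteq> r" "q \<in> B" "r \<in> B" "f q = e" "f r = e"
    using halvesE[OF hv] assms edges by metis
  have "(k q, k r) \<in> (adjacent_by G (gedges G - {f q}))\<^sup>*"
    using bridgeless[of e "k q" "k r"] gends_pair[of q r] qr assms by simp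
  then obtain z where "flow z" "z (f q) \<noteq> 0" using edge_in_flow[OF qr(2,3,1), of "gedges G"] qr by auto
  then show ?thesis using that qr by simp
qed

text \<open>On a C1-set the absolute value of a flow is constant. Conversely an edge outside
  \<open>S\<close> is no bridge of the complement of \<open>S\<close>, so some flow passes through
  it and avoids \<open>S\<close>.\<close>

lemma C1_eq_same_support:
  assumes S: "S \<in> C1" and e: "e \<in> S"
  shows "S = same_support e"
proof -
  have S': "S \<subseteq> gedges G" using S by (simp add: C1_def)
  have "e \<in> f ` B" using e S' edges by auto
  then obtain q where q: "q \<in> B" "f q = e" by auto
  show ?thesis
  proof (intro equalityI subsetI)
    fix e' assume e': "e' \<in> S"
    have "e' \<in> f ` B" using e' S' edges by auto
    then obtain r where r: "r \<in> B" "f r = e'" by auto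
    have "\<bar>z e\<bar> = \<bar>z e'\<bar>" if "flow z" for z
      using C1_abs_constant[OF S that q(1) r(1)] q r e e' by simp
    then have "(z e = 0) = (z e' = 0)" if "flow z" for z using that by (metis abs_eq_0_iff)
    then show "e' \<in> same_support e" unfolding same_support_def using e' S' by blast
  next
    fix e' assume e': "e' \<in> same_support e"
    show "e' \<in> S"
    proof (rule ccontr)
      assume n: "e' \<notin> S"
      have E: "e' \<in> gedges G" using e' by (simp add: same_support_def)
      obtain a b where ab: "a \<noteq> b" "a \<in> B" "b \<in> B" "f a = e'" "f b = e'"
        using halvesE[OF hv] E edges by metis
      have "(k a, k b) \<in> (adjacent_by G (gedges G - S - {f a}))\<^sup>*"
        using S E n gends_pair[of a b] ab unfolding C1_def by auto
      then obtain z where z: "flow z" "z e' \<noteq> 0" "supp z \<subseteq> insert e' (gedges G - S)"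
        using edge_in_flow[of a b "gedges G - S"] ab by auto
      then have "z e = 0" using e n by (auto simp: supp_def)
      then show False using z e' by (auto simp: same_support_def)
    qed
  qed
qed

text \<open>Different support behaviour only yields a flow vanishing on one of the two edges,
  possibly the wrong one; a linear combination exchanges their roles.\<close>

lemma same_support_separate:
  assumes "e \<in> gedges G" "e' \<in> gedges G" "e' \<notin> same_support e"
  obtains z where "flow z" "z e = 0" "z e' \<noteq> 0"
proof -
  obtain z where z: "flow z" "(z e = 0) \<noteq> (z e' = 0)" using assms by (auto simp: same_support_def)
  show ?thesis
  proof (cases "z e = 0")
    case True
    then show ?thesis using z that by blast
  next
    case False
    obtain w where w: "flow w" "w e' \<noteq> 0" using bridgeless_flow assms by metis
    \<comment> \<open>The coefficients make \<open>y\<close> vanish at \<open>e\<close>. At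
      \<open>e'\<close> the second term is zero since \<open>z e' = 0\<close>, and the first is
      \<open>z e * w e'\<close>, which is nonzero.\<close>
    define y where "y = (\<lambda>x. z e * w x + (- w e) * z x)"
    have "supp y \<subseteq> supp w \<union> supp z" by (auto simp: supp_def y_def)
    then have "flow y" using z w unfolding flow_def y_def pairing_lincomb by auto
    moreover have "y e = 0" "y e' \<noteq> 0" using z w False by (auto simp: y_def)
    ultimately show ?thesis using that by blast
  qed
qed

text \<open>A flow on the contracted graph is lifted by joining the ends of its edges to chosen
  representatives of the contracted components.\<close>

lemma lift_flow:
  assumes S: "S \<subseteq> gedges G" and w: "supp w \<subseteq> S" "\<And>g. pairing B f sg (\<lambda>q. cls S (k q)) w g = 0"
  obtains z where "flow z" "\<And>e. e \<in> S \<Longrightarrow> z e = w e"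
proof -
  define rep where "rep = (\<lambda>K::'v set. SOME v. v \<in> K)"
  have rep: "rep (cls S v) \<in> cls S v" if "v \<in> gverts G" for v
    unfolding rep_def by (rule someI[of _ v]) (use that in \<open>simp add: cls_def\<close>)
  have "\<exists>c. supp c \<subseteq> gedges G - S \<and> (\<forall>g. pairing B f sg k c g = g (rep (cls S v)) - g v)" if "v \<in> gverts G" for v
    by (rule path_chain) (use rep[OF that] in \<open>auto simp: cls_def\<close>)
  then obtain p where p: "\<And>v. v \<in> gverts G \<Longrightarrow> supp (p v) \<subseteq> gedges G - S"
      "\<And>v g. v \<in> gverts G \<Longrightarrow> pairing B f sg k (p v) g = g (rep (cls S v)) - g v"
    by metis
  \<comment> \<open>Each half-edge of \<open>S\<close> sends its share of flow along the path to the
    representative of its class. The paths avoid \<open>S\<close>, so \<open>z\<close> and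
    \<open>w\<close> agree there, and the boundary of \<open>z\<close> is that of \<open>w\<close>
    moved to the representatives.\<close>
  define z where "z = (\<lambda>e. w e + (\<Sum>q\<in>B. (sg q * w (f q)) * p (k q) e))"
  have kV: "k q \<in> gverts G" if "q \<in> B" for q using that verts by auto
  have "pairing B f sg k z g = 0" for g
  proof -
    have "pairing B f sg k z g = pairing B f sg k w g + (\<Sum>q\<in>B. sg q * w (f q) * pairing B f sg k (p (k q)) g)"
      unfolding z_def pairing_add pairing_sum ..
    also have "\<dots> = (\<Sum>q\<in>B. g (rep (cls S (k q))) * (sg q * w (f q)))"
      unfolding pairing_def[of B f sg k w] sum.distrib[symmetric]
      by (rule sum.cong) (auto simp: p(2)[OF kV] algebra_simps)
    also have "\<dots> = pairing B f sg (\<lambda>q. cls S (k q)) w (\<lambda>K. g (rep K))" by (simp add: pairing_def)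
    finally show ?thesis using w by simp
  qed
  moreover have z: "z e = w e" if "e \<notin> gedges G - S" for e
  proof -
    have "p (k q) e = 0" if "q \<in> B" for q using p(1)[OF kV[OF that]] \<open>e \<notin> gedges G - S\<close> by (auto simp: supp_def)
    then show ?thesis by (simp add: z_def)
  qed
  have "supp z \<subseteq> gedges G"
  proof
    fix e assume "e \<in> supp z"
    then show "e \<in> gedges G" using z[of e] w(1) S by (auto simp: supp_def)
  qed
  ultimately have "flow z" by (simp add: flow_def)
  then show ?thesis using that z by auto
qed

text \<open>The counting argument of \<open>circuit_imp_cycle\<close>, carried out in the contracted
  graph. With more edges than classes, a flow on \<open>S - {e0}\<close> would lift to one that
  separates \<open>e0\<close> from another edge of \<open>S\<close>. A class with a single half-edge
  of \<open>S\<close> would make that edge a bridge, and one with none would contradict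
  connectedness.\<close>

lemma same_support_in_C1:
  assumes e0: "e0 \<in> gedges G"
  shows "same_support e0 \<in> C1"
proof -
  define S where "S = same_support e0"
  have S: "S \<subseteq> gedges G" "e0 \<in> S" using e0 by (auto simp: S_def same_support_def)
  have SB: "S \<subseteq> f ` B" using S edges by simp
  define h where "h = (\<lambda>q. cls S (k q))"
  define W where "W = cls S ` gverts G"
  have finW: "finite W" using finV by (simp add: W_def)
  have hW: "h q \<in> W" if "q \<in> B" for q using that verts by (auto simp: h_def W_def)
  have nb: "(u, v) \<in> (adjacent_by G (gedges G - S - {e}))\<^sup>*"
    if "e \<in> gedges G - S" "gends G e = {#u, v#}" for e u v
  proof -
    have e: "e \<in> gedges G" "e \<notin> same_support e0" using that(1) by (auto simp: S_def)
    obtain z where z: "flow z" "z e0 = 0" "z e \<noteq> 0"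
      by (rule same_support_separate[OF e0, of e]) (use e in simp_all)
    have "supp z \<subseteq> gedges G - S" using z by (auto simp: supp_def flow_def S_def same_support_def)
    moreover have "(u, v) \<in> adjacent_by G {e}" using that(2) by (auto simp: adjacent_by_def)
    then obtain q r where qr: "q \<in> B" "r \<in> B" "q \<noteq> r" "f q = f r" "f q = e" "k q = u" "k r = v"
      using adjacent_by_iff[of "{e}" u v] e(1) by auto
    ultimately show ?thesis using edge_in_flow_connected[of q r "gedges G - S" z] z by auto
  qed
  have le: "card S \<le> card W"
  proof (rule ccontr)
    assume n: "\<not> ?thesis"
    have c: "card W \<le> card (S - {e0})" using n S by simp
    have "gverts G \<noteq> {}" using S edges verts by auto
    then have "card W > 0" using finW by (auto simp: W_def card_gt_0_iff)
    then have "S - {e0} \<noteq> {}" using c by (metis card.empty leD)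
    moreover have "S - {e0} \<subseteq> f ` B" using SB by auto
    ultimately obtain w where w: "\<forall>e. e \<notin> S - {e0} \<longrightarrow> w e = 0" "\<exists>e. w e \<noteq> 0"
        "\<forall>g. pairing B f sg h w g = 0"
      using nontrivial_flow[OF hv finW, of "S - {e0}" h] c hW by metis
    have "supp w \<subseteq> S" using w(1) by (auto simp: supp_def)
    then obtain z where z: "flow z" "\<And>e. e \<in> S \<Longrightarrow> z e = w e"
      using lift_flow[OF S(1), of w] w(3) unfolding h_def by blast
    obtain e where e: "w e \<noteq> 0" "e \<in> S" using w by blast
    have "z e0 = 0" using z(2) S(2) w(1) by simp
    moreover have "z e \<noteq> 0" using z(2) e by simp
    ultimately show False using e(2) z(1) by (auto simp: S_def same_support_def)
  qed
  have val: "2 \<le> card {q\<in>B. f q \<in> S \<and> h q = K}" if K: "K \<in> W" for K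
  proof (rule ccontr)
    assume n: "\<not> ?thesis"
    obtain u where u: "u \<in> gverts G" "K = cls S u" using K by (auto simp: W_def)
    have fin: "finite {q\<in>B. f q \<in> S \<and> h q = K}" using finB by simp
    have "\<exists>q. q \<in> B \<and> f q \<in> S \<and> h q = K"
    proof (rule ccontr)
      assume none: "\<not> ?thesis"
      have "(u, v) \<in> (adjacent_by G (gedges G))\<^sup>* \<Longrightarrow> v \<in> gverts G \<Longrightarrow> cls S v = K" for v
      proof (induction rule: rtrancl_induct)
        case base
        then show ?case using u by simp
      next
        case (step v w)
        then obtain q r where qr: "q \<in> B" "r \<in> B" "q \<noteq> r" "f q = f r" "k q = v" "k r = w"
          using adjacent_by_iff[of "gedges G"] by auto
        have vV: "v \<in> gverts G" using qr verts by auto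
        then have vK: "cls S v = K" using step by simp
        then have "f q \<notin> S" using none qr unfolding h_def by metis
        moreover have "f q \<in> gedges G" using qr edges by auto
        ultimately have "(v, w) \<in> adjacent_by G (gedges G - S)"
          using qr adjacent_by_iff[of "gedges G - S"] by blast
        then have "cls S v = cls S w" using cls_eq_iff vV step.prems by blast
        then show ?case using vK by simp
      qed
      then have all: "cls S v = K" if "v \<in> gverts G" for v using that conn u by blast
      obtain q where "q \<in> B" "f q = e0" using S SB by auto
      then show False using none all verts S unfolding h_def by blast
    qed
    then obtain q where q: "q \<in> B" "f q \<in> S" "h q = K" by blast
    have eq: "{q\<in>B. f q \<in> S \<and> cls S (k q) = cls S u} = {q}"
    proof -
      have "card {q\<in>B. f q \<in> S \<and> h q = K} \<le> Suc 0" using n by simp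
      then show ?thesis using q u card_le_Suc0_iff_eq[OF fin] by (auto simp: h_def)
    qed
    obtain z where z: "flow z" "z (f q) \<noteq> 0" using bridgeless_flow q S by blast
    have "sg q * z (f q) = 0" using class_sum[OF z(1) S(1) u(1)] unfolding eq by simp
    then show False using z abs_sg[OF hv q(1)] by auto
  qed
  have tight: "card S = card W \<and> (\<forall>v\<in>W. card {q\<in>B. f q \<in> S \<and> h q = v} = 2)"
    by (rule all_valencies_2[OF hv SB finW _ val le]) (use hW in auto)
  have cc: "(cls S u, cls S v) \<in> (adjacent_by (contract_outside G S) S)\<^sup>*"
    if "u \<in> gverts G" "v \<in> gverts G" for u v
    using conn[OF that] that(2)
  proof (induction rule: rtrancl_induct)
    case (step v w)
    then obtain q r where qr: "q \<in> B" "r \<in> B" "q \<noteq> r" "f q = f r" "k q = v" "k r = w"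
      using adjacent_by_iff[of "gedges G"] by auto
    have vV: "v \<in> gverts G" "f q \<in> gedges G" using qr verts edges by auto
    show ?case
    proof (cases "f q \<in> S")
      case True
      have "gends (contract_outside G S) (f q) = {#cls S v, cls S w#}"
        using gends_pair[OF qr(1-4)] qr by (simp add: contract_outside_eq)
      then have "(cls S v, cls S w) \<in> adjacent_by (contract_outside G S) S"
        using True by (auto simp: adjacent_by_def)
      then show ?thesis using step vV by (meson rtrancl_into_rtrancl)
    next
      case False
      then have "(v, w) \<in> adjacent_by G (gedges G - S)"
        using qr vV adjacent_by_iff[of "gedges G - S"] by blast
      then have "cls S v = cls S w" using cls_eq_iff vV step.prems by blast
      then show ?thesis using step vV by simp
    qed
  qed simp
  have v2: "valency (contract_outside G S) v = 2" if "v \<in> W" for v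
    using valency_eq_card[OF hv SB, of "contract_outside G S" h v] gends_contract S that tight
    by (auto simp: contract_outside_eq h_def subset_iff)
  have "finite S" using S finE finite_subset by blast
  then have "card S \<ge> 1" using S by (metis One_nat_def Suc_leI card_gt_0_iff empty_iff)
  moreover have "W \<noteq> {}" using S edges verts by (auto simp: W_def)
  ultimately have "is_cycle (contract_outside G S)"
    using tight cc v2 finW \<open>finite S\<close>
    by (auto simp: is_cycle_def graph_connected_def contract_outside_eq W_def)
  then show ?thesis using S nb unfolding C1_def S_def by blast
qed

lemma C1_eq: "C1 = same_support ` gedges G"
proof (intro equalityI subsetI)
  fix S assume S: "S \<in> C1"
  then obtain e where "e \<in> S" using C1_nonempty by blast
  then show "S \<in> same_support ` gedges G" using C1_eq_same_support[OF S] S by (auto simp: C1_def)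
qed (use same_support_in_C1 in auto)

lemma same_support_refl: "e \<in> gedges G \<Longrightarrow> e \<in> same_support e"
  by (simp add: same_support_def)

lemma C1_disjoint: "S \<in> C1 \<Longrightarrow> T \<in> C1 \<Longrightarrow> e \<in> S \<Longrightarrow> e \<in> T \<Longrightarrow> S = T"
  using C1_eq_same_support by metis

lemma finite_C1: "finite C1"
  unfolding C1_eq using finE by simp

lemma C1_sub: "S \<in> C1 \<Longrightarrow> S \<subseteq> gedges G"
  by (simp add: C1_def)

lemma C1_cover: "e \<in> gedges G \<Longrightarrow> same_support e \<in> C1 \<and> e \<in> same_support e"
  using same_support_in_C1 same_support_refl by blast

text \<open>A flow that vanishes on \<open>S\<close> but not on \<open>T\<close> splits into its
  parts on the components of the complement of \<open>S\<close>. The part at \<open>k q\<close> is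
  nonzero on \<open>f q\<close>, hence on all of \<open>T\<close> by \<open>same_support\<close>, so
  every edge of \<open>T\<close> touches that component.\<close>

lemma distinct_C1_same_class:
  assumes "S \<in> C1" "T \<in> C1" "S \<noteq> T" "q \<in> B" "r \<in> B" "f q \<in> T" "f r \<in> T"
  shows "cls S (k q) = cls S (k r)"
proof -
  obtain e0 where e0: "e0 \<in> S" using C1_nonempty assms(1) by blast
  have S: "S = same_support e0" and T: "T = same_support (f q)"
    using C1_eq_same_support assms e0 by blast+
  have SE: "e0 \<in> gedges G" "f q \<in> gedges G" using C1_sub assms e0 by blast+
  have "f q \<notin> S" using C1_disjoint assms by blast
  then obtain z where z: "flow z" "z e0 = 0" "z (f q) \<noteq> 0"
    using same_support_separate[OF SE] unfolding S by metis
  have zS: "e \<notin> S" if "z e \<noteq> 0" for e using z(1,2) that by (auto simp: S same_support_def)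
  define K where "K = {v \<in> gverts G. cls S v = cls S (k q)}"
  have cl: "cls S (k a) = cls S (k b)" if "a \<in> B" "b \<in> B" "f a = f b" "f a \<notin> S" for a b
  proof (cases "a = b")
    case False
    then have "(k a, k b) \<in> adjacent_by G (gedges G - S)"
      using that edges adjacent_by_iff[of "gedges G - S"] by blast
    then show ?thesis using cls_eq_iff[of "k a" "k b" S] that verts by blast
  qed simp
  define w where "w = (\<lambda>e. if \<exists>a\<in>B. f a = e \<and> k a \<in> K then z e else 0)"
  have "flow w" unfolding w_def
  proof (rule restrict_flow[OF z(1)])
    fix a b assume *: "a \<in> B" "b \<in> B" "f a = f b" "z (f a) \<noteq> 0" "k a \<in> K"
    then have "cls S (k a) = cls S (k b)" using cl zS by blast
    then show "k b \<in> K" using * verts by (auto simp: K_def)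
  qed
  moreover have "k q \<in> K" using assms(4) verts by (auto simp: K_def)
  then have "w (f q) \<noteq> 0" using z assms(4) by (auto simp: w_def)
  ultimately have "w (f r) \<noteq> 0" using assms(7) T by (auto simp: same_support_def)
  then obtain a where a: "a \<in> B" "f a = f r" "k a \<in> K" "z (f r) \<noteq> 0" by (auto simp: w_def split: if_splits)
  then have "cls S (k a) = cls S (k r)" using cl[of a r] zS assms(5) by simp
  then show ?thesis using a by (simp add: K_def)
qed

text \<open>The cyclic orientation of a C1-set is read off from the signs of any flow that is
  nonzero on it. The two half-edges of \<open>S\<close> at a class then get opposite signs: one
  enters and one leaves.\<close>

lemma cyclic_orientation:
  obtains \<rho> where "\<And>e. \<bar>\<rho> e\<bar> = (1::int)"
    and "\<And>S q r. S \<in> C1 \<Longrightarrow> q \<in> B \<Longrightarrow> r \<in> B \<Longrightarrow> f q \<in> S \<Longrightarrow> f r \<in> S \<Longrightarrow> q \<noteq> r \<Longrightarrow>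
      cls S (k q) = cls S (k r) \<Longrightarrow> \<rho> (f q) * sg q = - (\<rho> (f r) * sg r)"
    and "\<And>z S q r. flow z \<Longrightarrow> S \<in> C1 \<Longrightarrow> q \<in> B \<Longrightarrow> r \<in> B \<Longrightarrow> f q \<in> S \<Longrightarrow> f r \<in> S \<Longrightarrow>
      z (f q) * \<rho> (f q) = z (f r) * \<rho> (f r)"
proof -
  have "\<exists>z. flow z \<and> (\<forall>e\<in>S. z e \<noteq> 0)" if S: "S \<in> C1" for S
  proof -
    obtain e where e: "e \<in> S" using C1_nonempty[OF S] by blast
    have "e \<in> gedges G" using C1_sub[OF S] e by blast
    then obtain z where "flow z" "z e \<noteq> 0" using bridgeless_flow by blast
    moreover have "S = same_support e" by (rule C1_eq_same_support[OF S e])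
    ultimately show ?thesis by (auto simp: same_support_def)
  qed
  then obtain y where y: "\<And>S. S \<in> C1 \<Longrightarrow> flow (y S)" "\<And>S e. S \<in> C1 \<Longrightarrow> e \<in> S \<Longrightarrow> y S e \<noteq> 0"
    by metis
  \<comment> \<open>The default 1 off the graph keeps \<open>\<bar>\<rho> e\<bar> = 1\<close> valid
    without a side condition.\<close>
  define \<rho> where "\<rho> = (\<lambda>e. if e \<in> gedges G then sgn (y (same_support e) e) else 1)"
  have abs1: "\<bar>\<rho> e\<bar> = 1" for e using y(2) C1_cover[of e] by (auto simp: \<rho>_def abs_sgn_eq)
  have \<rho>: "\<rho> e = sgn (y S e)" if "S \<in> C1" "e \<in> S" for S e
    using that C1_eq_same_support[OF that] C1_sub by (auto simp: \<rho>_def)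
  have opp: "\<rho> (f q) * sg q = - (\<rho> (f r) * sg r)"
    if *: "S \<in> C1" "q \<in> B" "r \<in> B" "f q \<in> S" "f r \<in> S" "q \<noteq> r" "cls S (k q) = cls S (k r)" for S q r
  proof -
    define c where "c = \<bar>y S (f q)\<bar>"
    have c: "c \<noteq> 0" using y(2) * by (simp add: c_def)
    have yq: "y S (f q) = \<rho> (f q) * c" using \<rho> * by (simp add: c_def sgn_mult_abs)
    have "c = \<bar>y S (f r)\<bar>" unfolding c_def by (rule C1_abs_constant[OF *(1) y(1)[OF *(1)] *(2-5)])
    then have yr: "y S (f r) = \<rho> (f r) * c" using \<rho> * by (simp add: sgn_mult_abs)
    have "sg q * y S (f q) + sg r * y S (f r) = 0"
      using C1_opposite[of S q r "y S"] * y(1) by simp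
    then have "c * (\<rho> (f q) * sg q + \<rho> (f r) * sg r) = 0" unfolding yq yr by (simp add: algebra_simps)
    then show ?thesis using c by simp
  qed
  have "z (f q) * \<rho> (f q) = z (f r) * \<rho> (f r)"
    if *: "flow z" "S \<in> C1" "q \<in> B" "r \<in> B" "f q \<in> S" "f r \<in> S" for z S q r
  proof (rule C1_constant[OF *(2), of "\<lambda>q. z (f q) * \<rho> (f q)"])
    fix a b assume ab: "a \<in> B" "b \<in> B" "f a \<in> S" "f b \<in> S" "cls S (k a) = cls S (k b)" "a \<noteq> b"
    have 1: "sg a * z (f a) = - (sg b * z (f b))" using C1_opposite[of S a b z] ab * by simp
    have 2: "\<rho> (f a) * sg a = - (\<rho> (f b) * sg b)" using opp[of S a b] ab * by simp
    have u: "sg a * sg a = 1" "sg b * sg b = 1" using abs_sg[OF hv] ab unit_square by blast+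
    have "z (f a) * \<rho> (f a) = (sg a * z (f a)) * (\<rho> (f a) * sg a)" using u by (simp add: algebra_simps)
    also have "\<dots> = (sg b * z (f b)) * (\<rho> (f b) * sg b)" unfolding 1 2 by simp
    also have "\<dots> = z (f b) * \<rho> (f b)" using u by (simp add: algebra_simps)
    finally show "z (f a) * \<rho> (f a) = z (f b) * \<rho> (f b)" .
  qed (use * in simp_all)
  then show ?thesis using that abs1 opp by blast
qed

end

section \<open>Correspondence of flows from a bijection of C1-sets\<close>

text \<open>The assumptions relate \<phi> and \<epsilon> only at the level of C1-sets: the edge of
  \<open>\<phi> q\<close> lies in the image of the C1-set of \<open>f q\<close>, but it may differ
  from \<open>\<epsilon> (f q)\<close>. By \<phi>k the map \<phi> is also compatible with
  vertices.\<close>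

locale C1_pair = G: bridgeless_graph G B f k sg + G': bridgeless_graph G' B' f' k' sg'
  for G :: "('v, 'e) multigraph" and B :: "'q set" and f :: "'q \<Rightarrow> 'e" and k :: "'q \<Rightarrow> 'v" and sg
    and G' :: "('v2, 'e2) multigraph" and B' :: "'q2 set" and f' :: "'q2 \<Rightarrow> 'e2" and k' :: "'q2 \<Rightarrow> 'v2" and sg' +
  fixes \<phi> :: "'q \<Rightarrow> 'q2" and \<sigma> :: "'e set \<Rightarrow> 'e2 set" and \<epsilon> :: "'e \<Rightarrow> 'e2"
  assumes \<phi>: "bij_betw \<phi> B B'"
    and \<phi>k: "\<And>q r. q \<in> B \<Longrightarrow> r \<in> B \<Longrightarrow> k' (\<phi> q) = k' (\<phi> r) \<longleftrightarrow> k q = k r"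
    and \<sigma>: "bij_betw \<sigma> G.C1 G'.C1"
    and \<phi>\<sigma>: "\<And>S q. S \<in> G.C1 \<Longrightarrow> q \<in> B \<Longrightarrow> f' (\<phi> q) \<in> \<sigma> S \<longleftrightarrow> f q \<in> S"
    and \<epsilon>: "bij_betw \<epsilon> (gedges G) (gedges G')" "\<And>S. S \<in> G.C1 \<Longrightarrow> \<epsilon> ` S = \<sigma> S"
begin

lemma \<phi>B: "q \<in> B \<Longrightarrow> \<phi> q \<in> B'" using \<phi> by (auto simp: bij_betw_def)

lemma \<sigma>C1: "S \<in> G.C1 \<Longrightarrow> \<sigma> S \<in> G'.C1" using \<sigma> by (auto simp: bij_betw_def)

text \<open>An edge outside \<open>S\<close> lies in another C1-set \<open>T\<close>. Its halves may
  go to different edges of \<open>\<sigma> T\<close>, but all half-edges of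
  \<open>\<sigma> T\<close> lie at one class of the complement of \<open>\<sigma> S\<close> by
  \<open>distinct_C1_same_class\<close>. So a path outside \<open>S\<close> never changes the class
  of the image.\<close>

lemma class_transfer:
  assumes S: "S \<in> G.C1" and q: "q \<in> B" and r: "r \<in> B" and c: "G.cls S (k q) = G.cls S (k r)"
  shows "G'.cls (\<sigma> S) (k' (\<phi> q)) = G'.cls (\<sigma> S) (k' (\<phi> r))"
proof -
  have "(k q, v) \<in> (adjacent_by G (gedges G - S))\<^sup>* \<Longrightarrow>
      \<forall>r\<in>B. k r = v \<longrightarrow> G'.cls (\<sigma> S) (k' (\<phi> q)) = G'.cls (\<sigma> S) (k' (\<phi> r))" for v
  proof (induction rule: rtrancl_induct)
    case base
    then show ?case using \<phi>k q by metis
  next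
    case (step v w)
    then obtain a b where ab: "a \<in> B" "b \<in> B" "a \<noteq> b" "f a = f b" "f a \<in> gedges G - S" "k a = v" "k b = w"
      using G.adjacent_by_iff[of "gedges G - S"] by auto
    define T where "T = G.same_support (f a)"
    have T: "T \<in> G.C1" "f a \<in> T" using G.C1_cover[of "f a"] ab by (auto simp: T_def)
    then have "T \<noteq> S" using ab by auto
    then have "\<sigma> T \<noteq> \<sigma> S" using \<sigma> S T by (metis bij_betw_inv_into_left)
    then have "G'.cls (\<sigma> S) (k' (\<phi> a)) = G'.cls (\<sigma> S) (k' (\<phi> b))"
      using G'.distinct_C1_same_class[of "\<sigma> S" "\<sigma> T" "\<phi> a" "\<phi> b"] \<sigma>C1 S T \<phi>B ab \<phi>\<sigma> by simp
    then show ?case using step.IH ab \<phi>k by metis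
  qed
  moreover have "(k q, k r) \<in> (adjacent_by G (gedges G - S))\<^sup>*"
    using G.cls_eq_iff[of "k q" "k r" S] c q r G.verts by blast
  ultimately show ?thesis using r by blast
qed

text \<open>The sign \<open>\<alpha> v\<close> is the product over all C1-sets \<open>S\<close> of the sign comparing the cyclic
  orientations of \<open>S\<close> and \<open>\<sigma> S\<close> on the component of \<open>v\<close> in the complement of \<open>S\<close>. On the half-edges
  of \<open>S\<close> all factors but the one of \<open>S\<close> are constant.\<close>

lemma signs:
  assumes \<tau>: "\<And>q. q \<in> B \<Longrightarrow> \<bar>\<tau> q\<bar> = (1::int)" and \<tau>': "\<And>q. q \<in> B' \<Longrightarrow> \<bar>\<tau>' q\<bar> = (1::int)"
    and opp: "\<And>S q r. S \<in> G.C1 \<Longrightarrow> q \<in> B \<Longrightarrow> r \<in> B \<Longrightarrow> f q \<in> S \<Longrightarrow> f r \<in> S \<Longrightarrow> q \<noteq> r \<Longrightarrow>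
      G.cls S (k q) = G.cls S (k r) \<Longrightarrow> \<tau> q = - \<tau> r"
    and opp': "\<And>S q r. S \<in> G'.C1 \<Longrightarrow> q \<in> B' \<Longrightarrow> r \<in> B' \<Longrightarrow> f' q \<in> S \<Longrightarrow> f' r \<in> S \<Longrightarrow> q \<noteq> r \<Longrightarrow>
      G'.cls S (k' q) = G'.cls S (k' r) \<Longrightarrow> \<tau>' q = - \<tau>' r"
  obtains \<alpha> \<kappa> where "\<And>v. \<bar>\<alpha> v\<bar> = (1::int)" "\<And>S. \<bar>\<kappa> S\<bar> = (1::int)"
    "\<And>S q. S \<in> G.C1 \<Longrightarrow> q \<in> B \<Longrightarrow> f q \<in> S \<Longrightarrow> \<kappa> S * \<tau>' (\<phi> q) = \<alpha> (k q) * \<tau> q"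
proof -
  define Q where "Q = (\<lambda>S v. {q\<in>B. f q \<in> S \<and> G.cls S (k q) = G.cls S v})"
  define pick where "pick = (\<lambda>S v. SOME q. q \<in> Q S v)"
  \<comment> \<open>At a class with half-edges of \<open>S\<close> the choice among its two
    half-edges is immaterial, because \<tau> and \<tau>' both change sign between them. The value 1
    elsewhere keeps absolute value 1 for every argument.\<close>
  define \<beta> where "\<beta> = (\<lambda>S v. if Q S v = {} then 1 else \<tau> (pick S v) * \<tau>' (\<phi> (pick S v)))"
  have pick: "pick S v \<in> Q S v" if "Q S v \<noteq> {}" for S v unfolding pick_def using that by (auto intro: someI)
  have abs_\<beta>: "\<bar>\<beta> S v\<bar> = 1" for S v
    using pick[of S v] \<tau> \<tau>' \<phi>B by (auto simp: \<beta>_def Q_def abs_mult)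
  have \<beta>_cong: "\<beta> S u = \<beta> S v" if "G.cls S u = G.cls S v" for S u v
  proof -
    have "Q S u = Q S v" using that by (simp add: Q_def)
    then show ?thesis by (simp add: \<beta>_def pick_def)
  qed
  have \<beta>_eq: "\<beta> S (k q) = \<tau> q * \<tau>' (\<phi> q)" if S: "S \<in> G.C1" and q: "q \<in> B" "f q \<in> S" for S q
  proof -
    define r where "r = pick S (k q)"
    have ne: "Q S (k q) \<noteq> {}" using q by (auto simp: Q_def)
    then have r: "r \<in> B" "f r \<in> S" "G.cls S (k r) = G.cls S (k q)" using pick unfolding r_def Q_def by blast+
    have "\<tau> r * \<tau>' (\<phi> r) = \<tau> q * \<tau>' (\<phi> q)"
    proof (cases "r = q")
      case False
      then have "\<phi> r \<noteq> \<phi> q" using \<phi> r q by (metis bij_betw_inv_into_left)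
      then have "\<tau>' (\<phi> r) = - \<tau>' (\<phi> q)"
        using opp'[of "\<sigma> S" "\<phi> r" "\<phi> q"] class_transfer[OF S r(1) q(1) r(3)] \<sigma>C1[OF S] \<phi>B \<phi>\<sigma>[OF S] q r by simp
      moreover have "\<tau> r = - \<tau> q" using opp[OF S r(1) q(1) r(2) q(2) False r(3)] .
      ultimately show ?thesis by simp
    qed simp
    then show ?thesis using ne by (simp add: \<beta>_def r_def)
  qed
  define \<alpha> where "\<alpha> = (\<lambda>v. \<Prod>S\<in>G.C1. \<beta> S v)"
  \<comment> \<open>The other factors of \<alpha>, evaluated at one sample half-edge of
    \<open>S\<close>; they have the same value at all half-edges of \<open>S\<close>.\<close>
  define \<kappa> where "\<kappa> = (\<lambda>S. \<Prod>T\<in>G.C1 - {S}. \<beta> T (k (SOME q. q \<in> B \<and> f q \<in> S)))"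
  have "\<bar>\<alpha> v\<bar> = 1" for v by (simp add: \<alpha>_def abs_prod abs_\<beta>)
  moreover have "\<bar>\<kappa> S\<bar> = 1" for S by (simp add: \<kappa>_def abs_prod abs_\<beta>)
  moreover have "\<kappa> S * \<tau>' (\<phi> q) = \<alpha> (k q) * \<tau> q" if S: "S \<in> G.C1" and q: "q \<in> B" "f q \<in> S" for S q
  proof -
    define r where "r = (SOME q. q \<in> B \<and> f q \<in> S)"
    have r: "r \<in> B" "f r \<in> S" unfolding r_def using someI[of "\<lambda>q. q \<in> B \<and> f q \<in> S" q] q by blast+
    have "\<kappa> S = (\<Prod>T\<in>G.C1 - {S}. \<beta> T (k q))"
      unfolding \<kappa>_def r_def[symmetric]
      by (intro prod.cong refl \<beta>_cong G.distinct_C1_same_class[of _ S]) (use S q r in auto)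
    then have "\<alpha> (k q) = \<beta> S (k q) * \<kappa> S"
      unfolding \<alpha>_def using prod.remove[OF G.finite_C1 S] by simp
    also have "\<dots> = \<tau> q * \<tau>' (\<phi> q) * \<kappa> S" using \<beta>_eq[OF S q] by simp
    finally have "\<alpha> (k q) * \<tau> q = (\<tau> q * \<tau> q) * (\<kappa> S * \<tau>' (\<phi> q))" by (simp add: algebra_simps)
    then show ?thesis using unit_square[OF \<tau>[OF q(1)]] by simp
  qed
  ultimately show ?thesis by (rule that)
qed

text \<open>A branchwise form of the condition on \<eta>. The disjunction in the premise lets it be
  used before one knows that flows correspond: a flow on either side suffices to show constancy on
  the C1-set.\<close>

lemma eta_correspondence:
  obtains sgn' \<alpha> where "\<And>v. \<bar>\<alpha> v\<bar> = (1::int)" "halves B' f' sgn'"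
    "\<And>z z' q. G.flow z \<or> half_edge_graph.flow G' B' f' k' sgn' z' \<Longrightarrow> (\<And>e. e \<in> gedges G \<Longrightarrow> z' (\<epsilon> e) = z e) \<Longrightarrow>
       q \<in> B \<Longrightarrow> sgn' (\<phi> q) * z' (f' (\<phi> q)) = \<alpha> (k q) * (sg q * z (f q))"
proof -
  obtain \<rho> where \<rho>: "\<And>e. \<bar>\<rho> e\<bar> = (1::int)"
    and \<rho>2: "\<And>S q r. S \<in> G.C1 \<Longrightarrow> q \<in> B \<Longrightarrow> r \<in> B \<Longrightarrow> f q \<in> S \<Longrightarrow> f r \<in> S \<Longrightarrow> q \<noteq> r \<Longrightarrow>
      G.cls S (k q) = G.cls S (k r) \<Longrightarrow> \<rho> (f q) * sg q = - (\<rho> (f r) * sg r)"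
    and \<rho>3: "\<And>z S q r. G.flow z \<Longrightarrow> S \<in> G.C1 \<Longrightarrow> q \<in> B \<Longrightarrow> r \<in> B \<Longrightarrow> f q \<in> S \<Longrightarrow> f r \<in> S \<Longrightarrow>
      z (f q) * \<rho> (f q) = z (f r) * \<rho> (f r)"
    using G.cyclic_orientation by blast
  obtain \<rho>' where \<rho>': "\<And>e. \<bar>\<rho>' e\<bar> = (1::int)"
    and \<rho>'2: "\<And>S q r. S \<in> G'.C1 \<Longrightarrow> q \<in> B' \<Longrightarrow> r \<in> B' \<Longrightarrow> f' q \<in> S \<Longrightarrow> f' r \<in> S \<Longrightarrow> q \<noteq> r \<Longrightarrow>
      G'.cls S (k' q) = G'.cls S (k' r) \<Longrightarrow> \<rho>' (f' q) * sg' q = - (\<rho>' (f' r) * sg' r)"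
    and \<rho>'3: "\<And>z S q r. G'.flow z \<Longrightarrow> S \<in> G'.C1 \<Longrightarrow> q \<in> B' \<Longrightarrow> r \<in> B' \<Longrightarrow> f' q \<in> S \<Longrightarrow> f' r \<in> S \<Longrightarrow>
      z (f' q) * \<rho>' (f' q) = z (f' r) * \<rho>' (f' r)"
    using G'.cyclic_orientation by blast
  obtain \<alpha> \<kappa> where \<alpha>: "\<And>v. \<bar>\<alpha> v\<bar> = (1::int)" and \<kappa>: "\<And>S. \<bar>\<kappa> S\<bar> = (1::int)"
    and \<alpha>\<kappa>: "\<And>S q. S \<in> G.C1 \<Longrightarrow> q \<in> B \<Longrightarrow> f q \<in> S \<Longrightarrow>
      \<kappa> S * (\<rho>' (f' (\<phi> q)) * sg' (\<phi> q)) = \<alpha> (k q) * (\<rho> (f q) * sg q)"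
  proof -
    have 1: "\<bar>\<rho> (f q) * sg q\<bar> = 1" if "q \<in> B" for q using \<rho> abs_sg[OF G.hv that] by (simp add: abs_mult)
    have 2: "\<bar>\<rho>' (f' q) * sg' q\<bar> = 1" if "q \<in> B'" for q using \<rho>' abs_sg[OF G'.hv that] by (simp add: abs_mult)
    show ?thesis
      by (rule signs[of "\<lambda>q. \<rho> (f q) * sg q" "\<lambda>q. \<rho>' (f' q) * sg' q", OF 1 2 \<rho>2 \<rho>'2]) (assumption | rule that)+
  qed
  define \<delta> where "\<delta> = inv_into (gedges G) \<epsilon>"
  \<comment> \<open>Reorients the node \<open>e'\<close> so that, relative to the cyclic
    orientations \<rho> and \<rho>', it points as its preimage \<open>\<delta> e'\<close> does. The
    factor \<kappa>, common to the whole C1-set, compensates for the contributions of the other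
    C1-sets to \<alpha>.\<close>
  define u where "u = (\<lambda>e'. \<kappa> (G.same_support (\<delta> e')) * \<rho> (\<delta> e') * \<rho>' e')"
  define sgn' where "sgn' = (\<lambda>q'. u (f' q') * sg' q')"
  have abs_u: "\<bar>u e\<bar> = 1" for e by (simp add: u_def abs_mult \<kappa> \<rho> \<rho>')
  have halves': "halves B' f' sgn'"
    unfolding halves_def
  proof (intro conjI ballI)
    fix e assume "e \<in> f' ` B'"
    then obtain q r where qr: "{x\<in>B'. f' x = e} = {q, r}" "f' q = e" "f' r = e" "sg' q = 1" "sg' r = -1"
      using halvesE[OF G'.hv] by metis
    have "u e = 1 \<or> u e = -1" using abs_u[of e] by linarith
    then show "\<exists>q r. {x\<in>B'. f' x = e} = {q, r} \<and> sgn' q = 1 \<and> sgn' r = - 1"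
    proof
      assume "u e = 1"
      then show ?thesis using qr by (intro exI[of _ q] exI[of _ r]) (simp add: sgn'_def)
    next
      assume "u e = -1"
      then show ?thesis using qr by (intro exI[of _ r] exI[of _ q]) (auto simp: sgn'_def)
    qed
  qed (rule G'.finB)
  interpret N: half_edge_graph G' B' f' k' sgn'
    by (rule half_edge_graph.intro[OF halves' G'.finV G'.edges G'.verts G'.ends])
  have key: "sgn' (\<phi> q) * z' (f' (\<phi> q)) = \<alpha> (k q) * (sg q * z (f q))"
    if fl: "G.flow z \<or> N.flow z'" and zz: "\<And>e. e \<in> gedges G \<Longrightarrow> z' (\<epsilon> e) = z e" and q: "q \<in> B" for z z' q
  proof -
    define S where "S = G.same_support (f q)"
    have fq: "f q \<in> gedges G" using q G.edges by blast
    then have S: "S \<in> G.C1" "f q \<in> S" using G.C1_cover by (auto simp: S_def)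
    have SE: "S \<subseteq> gedges G" using G.C1_sub S by blast
    have "f' (\<phi> q) \<in> \<sigma> S" using \<phi>\<sigma> S q by blast
    then obtain g where g: "g \<in> S" "f' (\<phi> q) = \<epsilon> g" using \<epsilon>(2)[OF S(1)] by auto
    have \<delta>: "\<delta> (\<epsilon> e) = e" if "e \<in> S" for e
      using that SE \<epsilon>(1) unfolding \<delta>_def by (metis bij_betw_inv_into_left subsetD)
    have ss: "G.same_support e = S" if "e \<in> S" for e using G.C1_eq_same_support[OF S(1) that] by simp
    \<comment> \<open>The branch \<open>\<phi> q\<close> lies over \<open>\<epsilon> g\<close>,
      where \<open>g\<close> may differ from \<open>f q\<close>; constancy on the C1-set bridges
      this gap.\<close>
    have const: "z g * \<rho> g = z (f q) * \<rho> (f q)"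
    proof (cases "G.flow z")
      case True
      have "g \<in> f ` B" using g SE G.edges by auto
      then obtain r where "r \<in> B" "f r = g" by auto
      then show ?thesis using \<rho>3[OF True S(1) _ q _ S(2), of r] g by simp
    next
      case False
      then have N: "N.flow z'" using fl by simp
      \<comment> \<open>Changing the orientation of an edge is the same as changing the sign of the
        flow on it, so \<rho>' can be applied with the old signs \<open>sg'\<close>.\<close>
      have "G'.flow (\<lambda>e. u e * z' e)"
      proof -
        have "pairing B' f' sg' k' (\<lambda>e. u e * z' e) h = pairing B' f' sgn' k' z' h" for h
          by (simp add: pairing_def sgn'_def mult_ac)
        then show ?thesis using N abs_u unfolding G'.flow_def N.flow_def by (auto simp: supp_def)
      qed
      note c = \<rho>'3[OF this \<sigma>C1[OF S(1)]]
      have "u (\<epsilon> e) * z' (\<epsilon> e) * \<rho>' (\<epsilon> e) = \<kappa> S * (z e * \<rho> e)" if "e \<in> S" for e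
      proof -
        have "\<rho>' (\<epsilon> e) * \<rho>' (\<epsilon> e) = 1" using \<rho>' unit_square by blast
        then show ?thesis using zz[of e] that SE \<delta>[OF that] ss[OF that]
          by (auto simp: u_def algebra_simps)
      qed
      note ue = this
      have B'ex: "\<exists>r\<in>B'. f' r = \<epsilon> e" if "e \<in> S" for e
      proof -
        have "\<epsilon> e \<in> f' ` B'" unfolding G'.edges using \<epsilon>(1) that SE by (auto simp: bij_betw_def)
        then show ?thesis by auto
      qed
      obtain a b where ab: "a \<in> B'" "f' a = \<epsilon> g" "b \<in> B'" "f' b = \<epsilon> (f q)" using B'ex g S(2) by metis
      have "f' a \<in> \<sigma> S" "f' b \<in> \<sigma> S" using ab g S \<epsilon>(2)[OF S(1)] by auto
      from c[OF ab(1,3) this] have "\<kappa> S * (z g * \<rho> g) = \<kappa> S * (z (f q) * \<rho> (f q))"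
        using ue[OF g(1)] ue[OF S(2)] ab by simp
      then show ?thesis using \<kappa>[of S] by auto
    qed
    have "sgn' (\<phi> q) * z' (f' (\<phi> q)) = (z g * \<rho> g) * (\<kappa> S * (\<rho>' (f' (\<phi> q)) * sg' (\<phi> q)))"
      using zz[of g] g SE \<delta>[OF g(1)] ss[OF g(1)] by (auto simp: sgn'_def u_def algebra_simps)
    also have "\<dots> = (z (f q) * \<rho> (f q)) * (\<alpha> (k q) * (\<rho> (f q) * sg q))" unfolding const \<alpha>\<kappa>[OF S(1) q S(2)] ..
    also have "\<dots> = (\<rho> (f q) * \<rho> (f q)) * (\<alpha> (k q) * (sg q * z (f q)))" by (simp add: algebra_simps)
    finally show ?thesis using unit_square[OF \<rho>[of "f q"]] by simp
  qed
  show ?thesis by (rule that[OF _ halves', of \<alpha>]) (fact \<alpha>, fact key)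
qed

text \<open>Reindexing by \<phi> turns a test function on one side into one on the other, multiplied
  by the signs \<alpha>. By \<phi>k the result depends only on the vertex, so any half-edge chosen
  by \<open>SOME\<close> at that vertex will do.\<close>

lemma flow_correspondence:
  assumes \<alpha>: "\<And>v. \<bar>\<alpha> v\<bar> = (1::int)"
    and key: "\<And>q. q \<in> B \<Longrightarrow> s' (\<phi> q) * z' (f' (\<phi> q)) = \<alpha> (k q) * (sg q * z (f q))"
  shows "(\<forall>g. pairing B f sg k z g = 0) \<longleftrightarrow> (\<forall>g. pairing B' f' s' k' z' g = 0)"
proof -
  have p': "pairing B' f' s' k' z' g = (\<Sum>q\<in>B. (g (k' (\<phi> q)) * \<alpha> (k q)) * (sg q * z (f q)))" for g
    unfolding pairing_def using sum.reindex_bij_betw[OF \<phi>, of "\<lambda>q. g (k' q) * (s' q * z' (f' q))"] key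
    by (simp add: mult.assoc)
  show ?thesis
  proof (intro iffI allI)
    fix g assume a: "\<forall>g. pairing B f sg k z g = 0"
    define h where "h = (\<lambda>v. g (k' (\<phi> (SOME r. r \<in> B \<and> k r = v))) * \<alpha> v)"
    have "g (k' (\<phi> q)) * \<alpha> (k q) = h (k q)" if "q \<in> B" for q
    proof -
      have "(SOME r. r \<in> B \<and> k r = k q) \<in> B \<and> k (SOME r. r \<in> B \<and> k r = k q) = k q"
        by (rule someI[of _ q]) (use that in simp)
      then show ?thesis unfolding h_def using \<phi>k that by metis
    qed
    then have "pairing B' f' s' k' z' g = pairing B f sg k z h" unfolding p' pairing_def[of B f] by simp
    then show "pairing B' f' s' k' z' g = 0" using a by simp
  next
    fix g assume a: "\<forall>g. pairing B' f' s' k' z' g = 0"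
    define h where "h = (\<lambda>v'. let r = (SOME r. r \<in> B \<and> k' (\<phi> r) = v') in g (k r) * \<alpha> (k r))"
    have h: "h (k' (\<phi> q)) * \<alpha> (k q) = g (k q)" if "q \<in> B" for q
    proof -
      define r where "r = (SOME r. r \<in> B \<and> k' (\<phi> r) = k' (\<phi> q))"
      have "r \<in> B \<and> k' (\<phi> r) = k' (\<phi> q)" unfolding r_def by (rule someI[of _ q]) (use that in simp)
      then have "k r = k q" using \<phi>k that by blast
      then show ?thesis using unit_square[OF \<alpha>[of "k q"]] unfolding h_def r_def[symmetric] Let_def
        by (simp add: mult.assoc)
    qed
    have "pairing B' f' s' k' z' h = pairing B f sg k z g" unfolding p' pairing_def[of B f] by (simp add: h)
    then show "pairing B f sg k z g = 0" using a by simp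
  qed
qed

end

section \<open>Correspondence of C1-sets from a bijection of flow supports\<close>

lemma union_of_bijections:
  assumes disj: "\<And>S T e. S \<in> \<S> \<Longrightarrow> T \<in> \<S> \<Longrightarrow> e \<in> S \<Longrightarrow> e \<in> T \<Longrightarrow> S = T"
    and disj': "\<And>S T e. S \<in> \<S>' \<Longrightarrow> T \<in> \<S>' \<Longrightarrow> e \<in> S \<Longrightarrow> e \<in> T \<Longrightarrow> S = T"
    and \<sigma>: "bij_betw \<sigma> \<S> \<S>'" and b: "\<And>S. S \<in> \<S> \<Longrightarrow> \<exists>b. bij_betw b S (\<sigma> S)"
  obtains \<epsilon> where "bij_betw \<epsilon> (\<Union>\<S>) (\<Union>\<S>')" "\<And>S. S \<in> \<S> \<Longrightarrow> \<epsilon> ` S = \<sigma> S"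
proof -
  obtain b where b: "\<And>S. S \<in> \<S> \<Longrightarrow> bij_betw (b S) S (\<sigma> S)" using b by metis
  define \<epsilon> where "\<epsilon> = (\<lambda>e. b (THE S. S \<in> \<S> \<and> e \<in> S) e)"
  have \<epsilon>: "\<epsilon> e = b S e" if "S \<in> \<S>" "e \<in> S" for S e
  proof -
    have "(THE S. S \<in> \<S> \<and> e \<in> S) = S" by (rule the_equality) (use that disj in blast)+
    then show ?thesis by (simp add: \<epsilon>_def)
  qed
  have img: "\<epsilon> ` S = \<sigma> S" if "S \<in> \<S>" for S
  proof -
    have "\<epsilon> ` S = b S ` S" by (rule image_cong) (use \<epsilon>[OF that] in auto)
    then show ?thesis using b[OF that] by (simp add: bij_betw_def)
  qed
  have "inj_on \<epsilon> (\<Union>\<S>)"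
  proof (rule inj_onI)
    fix x y assume "x \<in> \<Union>\<S>" "y \<in> \<Union>\<S>" and eq: "\<epsilon> x = \<epsilon> y"
    then obtain S T where ST: "S \<in> \<S>" "x \<in> S" "T \<in> \<S>" "y \<in> T" by auto
    have "\<epsilon> x \<in> \<epsilon> ` S" "\<epsilon> x \<in> \<epsilon> ` T" using imageI[OF ST(2), of \<epsilon>] imageI[OF ST(4), of \<epsilon>] eq by simp_all
    then have "\<epsilon> x \<in> \<sigma> S" "\<epsilon> x \<in> \<sigma> T" unfolding img[OF ST(1)] img[OF ST(3)] .
    moreover have "\<sigma> S \<in> \<S>'" "\<sigma> T \<in> \<S>'" using \<sigma> ST by (auto simp: bij_betw_def)
    ultimately have "\<sigma> S = \<sigma> T" using disj' by blast
    then have "S = T" using \<sigma> ST by (metis bij_betw_inv_into_left)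
    then show "x = y" using eq ST \<epsilon> b[OF ST(1)] by (auto simp: bij_betw_def dest: inj_onD)
  qed
  moreover have "\<epsilon> ` \<Union>\<S> = \<Union>\<S>'" using img \<sigma> by (auto simp: bij_betw_def image_Union)
  ultimately show ?thesis using that[of \<epsilon>] img by (simp add: bij_betw_def)
qed

definition (in half_edge_graph) flow_supports :: "'e set set" where
  "flow_supports = supp ` Collect flow"

lemma (in half_edge_graph) circuits_eq:
  "circuits = {C \<in> flow_supports. C \<noteq> {} \<and> (\<forall>D\<in>flow_supports. D \<subseteq> C \<longrightarrow> D \<noteq> {} \<longrightarrow> D = C)}"
  unfolding circuits_def flow_supports_def by (auto 0 2)

lemma (in half_edge_graph) flow_supports_sub: "D \<in> flow_supports \<Longrightarrow> D \<subseteq> gedges G"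
  by (auto simp: flow_supports_def flow_def)

lemma (in half_edge_graph) same_support_iff:
  "same_support e = {e'\<in>gedges G. \<forall>D\<in>flow_supports. e \<in> D \<longleftrightarrow> e' \<in> D}"
  by (simp add: same_support_def flow_supports_def supp_def)

text \<open>Flow supports are the only data transferred: circuits and classes of equal support are
  both definable from the family of supports.\<close>

locale support_iso = G: bridgeless_graph G B f k sg + G': bridgeless_graph G' B' f' k' sg'
  for G :: "('v, 'e) multigraph" and B :: "'q set" and f :: "'q \<Rightarrow> 'e" and k :: "'q \<Rightarrow> 'v" and sg
    and G' :: "('v2, 'e2) multigraph" and B' :: "'q2 set" and f' :: "'q2 \<Rightarrow> 'e2" and k' :: "'q2 \<Rightarrow> 'v2" and sg' +
  fixes \<epsilon> :: "'e \<Rightarrow> 'e2"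
  assumes \<epsilon>: "bij_betw \<epsilon> (gedges G) (gedges G')"
    and supports: "G'.flow_supports = (image \<epsilon>) ` G.flow_supports"
begin

lemma inj_image: "inj_on (image \<epsilon>) (Pow (gedges G))"
  using \<epsilon> by (intro inj_on_image_Pow) (simp add: bij_betw_def)

lemma bij_circuits: "bij_betw (image \<epsilon>) G.circuits G'.circuits"
proof -
  have sub: "G.flow_supports \<subseteq> Pow (gedges G)" using G.flow_supports_sub by auto
  have inj: "\<epsilon> ` D \<subseteq> \<epsilon> ` C \<longleftrightarrow> D \<subseteq> C" "\<epsilon> ` D = \<epsilon> ` C \<longleftrightarrow> D = C"
    if "D \<in> G.flow_supports" "C \<in> G.flow_supports" for C D
  proof -
    have DC: "D \<subseteq> gedges G" "C \<subseteq> gedges G" using that sub by blast+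
    have "inj_on \<epsilon> (gedges G)" using \<epsilon> by (simp add: bij_betw_def)
    then show "\<epsilon> ` D \<subseteq> \<epsilon> ` C \<longleftrightarrow> D \<subseteq> C" "\<epsilon> ` D = \<epsilon> ` C \<longleftrightarrow> D = C"
      by (rule inj_on_image_subset_iff[OF _ DC], rule inj_on_image_eq_iff[OF _ DC])
  qed
  have "G'.circuits = (image \<epsilon>) ` G.circuits"
  proof -
    have "(\<forall>D\<in>G'.flow_supports. D \<subseteq> \<epsilon> ` C \<longrightarrow> D \<noteq> {} \<longrightarrow> D = \<epsilon> ` C) \<longleftrightarrow>
        (\<forall>D\<in>G.flow_supports. D \<subseteq> C \<longrightarrow> D \<noteq> {} \<longrightarrow> D = C)" if "C \<in> G.flow_supports" for C
      unfolding supports ball_simps by (rule ball_cong) (simp_all add: inj that)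
    then have iff: "\<epsilon> ` C \<in> G'.circuits \<longleftrightarrow> C \<in> G.circuits" if "C \<in> G.flow_supports" for C
      unfolding G'.circuits_eq G.circuits_eq mem_Collect_eq using that supports by simp
    show ?thesis
    proof (intro equalityI subsetI)
      fix C' assume C': "C' \<in> G'.circuits"
      then have "C' \<in> (image \<epsilon>) ` G.flow_supports" using supports by (simp add: G'.circuits_eq)
      then obtain C where "C \<in> G.flow_supports" "C' = \<epsilon> ` C" by (rule imageE)
      then show "C' \<in> (image \<epsilon>) ` G.circuits" using iff C' by simp
    next
      fix C' assume "C' \<in> (image \<epsilon>) ` G.circuits"
      then obtain C where "C \<in> G.circuits" "C' = \<epsilon> ` C" by (rule imageE)
      then show "C' \<in> G'.circuits" using iff by (simp add: G.circuits_eq)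
    qed
  qed
  moreover have "inj_on (image \<epsilon>) G.circuits"
    by (rule inj_on_subset[OF inj_image]) (use sub in \<open>auto simp: G.circuits_eq\<close>)
  ultimately show ?thesis by (simp add: bij_betw_def)
qed

lemma cyclic: "cyclic_bijection G G' \<epsilon>"
  unfolding cyclic_bijection_def G.cycles_eq_circuits G'.cycles_eq_circuits
  using \<epsilon> bij_circuits by blast

lemma \<epsilon>_mem: "e \<in> gedges G \<Longrightarrow> D \<subseteq> gedges G \<Longrightarrow> \<epsilon> e \<in> \<epsilon> ` D \<longleftrightarrow> e \<in> D"
  using \<epsilon> by (auto simp: bij_betw_def dest: inj_onD)

lemma same_support_image:
  assumes "e \<in> gedges G"
  shows "G'.same_support (\<epsilon> e) = \<epsilon> ` G.same_support e"
proof -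
  have E': "gedges G' = \<epsilon> ` gedges G" using \<epsilon> by (simp add: bij_betw_def)
  have eq: "(\<forall>D\<in>G'.flow_supports. \<epsilon> e \<in> D \<longleftrightarrow> \<epsilon> x \<in> D) \<longleftrightarrow> (\<forall>D\<in>G.flow_supports. e \<in> D \<longleftrightarrow> x \<in> D)"
    if "x \<in> gedges G" for x
    unfolding supports ball_simps
    by (rule ball_cong) (use \<epsilon>_mem[OF assms G.flow_supports_sub] \<epsilon>_mem[OF that G.flow_supports_sub] in simp_all)
  show ?thesis unfolding G'.same_support_iff G.same_support_iff E'
  proof (intro equalityI subsetI)
    fix y assume y: "y \<in> {e' \<in> \<epsilon> ` gedges G. \<forall>D\<in>G'.flow_supports. \<epsilon> e \<in> D \<longleftrightarrow> e' \<in> D}"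
    then obtain x where "x \<in> gedges G" "y = \<epsilon> x" by blast
    then show "y \<in> \<epsilon> ` {e' \<in> gedges G. \<forall>D\<in>G.flow_supports. e \<in> D \<longleftrightarrow> e' \<in> D}"
      using y eq[of x] by simp
  next
    fix y assume "y \<in> \<epsilon> ` {e' \<in> gedges G. \<forall>D\<in>G.flow_supports. e \<in> D \<longleftrightarrow> e' \<in> D}"
    then obtain x where "x \<in> gedges G" "\<forall>D\<in>G.flow_supports. e \<in> D \<longleftrightarrow> x \<in> D" "y = \<epsilon> x" by blast
    then show "y \<in> {e' \<in> \<epsilon> ` gedges G. \<forall>D\<in>G'.flow_supports. \<epsilon> e \<in> D \<longleftrightarrow> e' \<in> D}"
      using eq[of x] by simp
  qed
qed

lemma bij_C1: "bij_betw (image \<epsilon>) G.C1 G'.C1"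
proof -
  have E': "gedges G' = \<epsilon> ` gedges G" using \<epsilon> by (simp add: bij_betw_def)
  have "G'.C1 = (\<lambda>e. \<epsilon> ` G.same_support e) ` gedges G"
    unfolding G'.C1_eq E' image_image by (intro image_cong refl same_support_image)
  then have "G'.C1 = (image \<epsilon>) ` G.C1" unfolding G.C1_eq by (simp add: image_image)
  moreover have "inj_on (image \<epsilon>) G.C1"
    by (rule inj_on_subset[OF inj_image]) (use G.C1_sub in auto)
  ultimately show ?thesis by (simp add: bij_betw_def)
qed

text \<open>For a half-edge \<open>q\<close>, the edge \<open>f q\<close> and the
  \<epsilon>-preimage of \<open>f' (\<phi> q)\<close> belong to the same flow supports, hence to the
  same C1-set. That \<open>\<phi> q\<close> is a half-edge at all follows because some flow support
  contains \<open>f q\<close>; so injectivity is assumed on a larger set \<open>P\<close> of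
  points.\<close>

lemma C1_half_edge_image:
  assumes \<phi>: "inj_on \<phi> P" "B \<subseteq> P"
    and \<phi>D: "\<And>D. D \<in> G.flow_supports \<Longrightarrow> \<phi> ` {q\<in>B. f q \<in> D} = {q\<in>B'. f' q \<in> \<epsilon> ` D}"
    and S: "S \<in> G.C1"
  shows "\<phi> ` {q\<in>B. f q \<in> S} = {q\<in>B'. f' q \<in> \<epsilon> ` S}"
proof -
  have cover: "\<exists>D\<in>G.flow_supports. e \<in> D" if e: "e \<in> gedges G" for e
  proof -
    obtain z where "G.flow z" "z e \<noteq> 0" using G.bridgeless_flow e by metis
    then have "supp z \<in> G.flow_supports" "e \<in> supp z" by (simp add: G.flow_supports_def, simp add: supp_def)
    then show ?thesis by blast
  qed
  have E': "gedges G' = \<epsilon> ` gedges G" using \<epsilon> by (simp add: bij_betw_def)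
  have fE: "f q \<in> gedges G" if "q \<in> B" for q using that G.edges by blast
  have fE': "f' q \<in> gedges G'" if "q \<in> B'" for q using that G'.edges by blast
  have main: "\<phi> q \<in> B' \<and> (\<exists>g\<in>G.same_support (f q). f' (\<phi> q) = \<epsilon> g)" if q: "q \<in> B" for q
  proof -
    have mem: "f q \<in> D \<longleftrightarrow> \<phi> q \<in> B' \<and> f' (\<phi> q) \<in> \<epsilon> ` D" if D: "D \<in> G.flow_supports" for D
    proof -
      have "\<phi> q \<in> \<phi> ` {q\<in>B. f q \<in> D} \<longleftrightarrow> f q \<in> D"
        using inj_on_image_mem_iff[OF \<phi>(1), of q "{q\<in>B. f q \<in> D}"] q \<phi>(2) by auto
      then show ?thesis unfolding \<phi>D[OF D] by simp
    qed
    obtain D where D: "D \<in> G.flow_supports" "f q \<in> D" using cover fE q by blast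
    then have q': "\<phi> q \<in> B'" using mem by blast
    then obtain g where g: "g \<in> gedges G" "f' (\<phi> q) = \<epsilon> g" using fE' E' by blast
    have "f q \<in> D \<longleftrightarrow> g \<in> D" if "D \<in> G.flow_supports" for D
      unfolding mem[OF that] g(2) \<epsilon>_mem[OF g(1) G.flow_supports_sub[OF that]] using q' by simp
    then have "g \<in> G.same_support (f q)" using g by (simp add: G.same_support_iff)
    then show ?thesis using g q' by blast
  qed
  show ?thesis
  proof (intro equalityI subsetI)
    fix x assume "x \<in> \<phi> ` {q\<in>B. f q \<in> S}"
    then obtain q where q: "q \<in> B" "f q \<in> S" "x = \<phi> q" by blast
    then show "x \<in> {q\<in>B'. f' q \<in> \<epsilon> ` S}"
      using main[OF q(1)] G.C1_eq_same_support[OF S q(2)] by blast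
  next
    fix x assume "x \<in> {q\<in>B'. f' q \<in> \<epsilon> ` S}"
    then obtain g where g: "x \<in> B'" "g \<in> S" "f' x = \<epsilon> g" by blast
    have gE: "g \<in> gedges G" using g G.C1_sub[OF S] by blast
    then obtain D where D: "D \<in> G.flow_supports" "g \<in> D" using cover by blast
    then have "x \<in> \<phi> ` {q\<in>B. f q \<in> D}" unfolding \<phi>D[OF D(1)] using g by blast
    then obtain q where q: "q \<in> B" "x = \<phi> q" by blast
    obtain g2 where g2: "g2 \<in> G.same_support (f q)" "f' (\<phi> q) = \<epsilon> g2" using main[OF q(1)] by blast
    have "g2 \<in> gedges G" using g2 by (simp add: G.same_support_def)
    then have "g2 = g" using g2 g q gE \<epsilon> by (metis bij_betw_inv_into_left)
    then have "S = G.same_support (f q)"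
      using G.C1_disjoint[OF S _ g(2)] G.C1_cover[OF fE[OF q(1)]] g2 by blast
    then show "x \<in> \<phi> ` {q\<in>B. f q \<in> S}" using q G.same_support_refl[OF fE] by blast
  qed
qed

end

section \<open>The dual graph and partial normalizations\<close>

context nodal_curve
begin

abbreviation "G \<equiv> dual_graph Xn X \<nu>"
abbreviation "B \<equiv> {q \<in> points Xn. \<nu> q \<in> singular_points X}"

definition orientation_sign :: "('k proj_point \<Rightarrow> 'k proj_point \<times> 'k proj_point) \<Rightarrow> 'k proj_point \<Rightarrow> int" where
  "orientation_sign ori q = (if q = snd (ori (\<nu> q)) then 1 else - 1)"

lemma singular_sub: "singular_points X \<subseteq> points X"
  by (auto simp: singular_points_def)

lemma image_B: "\<nu> ` B = singular_points X"
proof (intro equalityI subsetI)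
  fix p assume p: "p \<in> singular_points X"
  then obtain q where "q \<in> points Xn" "p = \<nu> q" using singular_sub surj by blast
  then show "p \<in> \<nu> ` B" using p by blast
qed blast

lemma finite_B: "finite B"
proof -
  have "B = (\<Union>p\<in>singular_points X. {q \<in> points Xn. \<nu> q = p})" by auto
  then show ?thesis using finite_singular finite_fibre by simp
qed

lemma fibre_eq: "e \<in> singular_points X \<Longrightarrow> fibre Xn \<nu> {e} = {q\<in>B. \<nu> q = e}"
  by (auto simp: fibre_def)

lemma node_fibre:
  assumes "e \<in> singular_points X"
  obtains q r where "q \<noteq> r" "{x\<in>B. \<nu> x = e} = {q, r}"
proof -
  obtain q r where "q \<noteq> r" "{x \<in> points Xn. \<nu> x = e} = {q, r}" using node_branches[OF assms] .
  moreover have "{x\<in>B. \<nu> x = e} = {x \<in> points Xn. \<nu> x = e}" using assms by auto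
  ultimately show ?thesis using that by simp
qed

lemma orientation_pair:
  assumes ori: "orientation Xn X \<nu> ori" and e: "e \<in> singular_points X"
  shows "{x\<in>B. \<nu> x = e} = {snd (ori e), fst (ori e)}" "snd (ori e) \<noteq> fst (ori e)"
    "orientation_sign ori (snd (ori e)) = 1" "orientation_sign ori (fst (ori e)) = - 1"
proof -
  show eq: "{x\<in>B. \<nu> x = e} = {snd (ori e), fst (ori e)}"
    using ori e fibre_eq[OF e] unfolding orientation_def by blast
  obtain q r where qr: "q \<noteq> r" "{x\<in>B. \<nu> x = e} = {q, r}" using node_fibre[OF e] .
  then show ne: "snd (ori e) \<noteq> fst (ori e)" using eq by auto
  have "\<nu> (snd (ori e)) = e" "\<nu> (fst (ori e)) = e" using eq by blast+
  then show "orientation_sign ori (snd (ori e)) = 1" "orientation_sign ori (fst (ori e)) = - 1"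
    using ne by (auto simp: orientation_sign_def)
qed

lemma halves_orientation: "orientation Xn X \<nu> ori \<Longrightarrow> halves B \<nu> (orientation_sign ori)"
  unfolding halves_def image_B
proof (intro conjI ballI)
  fix e assume "orientation Xn X \<nu> ori" "e \<in> singular_points X"
  note o = orientation_pair[OF this]
  show "\<exists>q r. {x\<in>B. \<nu> x = e} = {q, r} \<and> orientation_sign ori q = 1 \<and> orientation_sign ori r = - 1"
    by (intro exI conjI) (rule o)+
qed (rule finite_B)

lemma orientation_of_halves:
  assumes "halves B \<nu> s"
  obtains ori where "orientation Xn X \<nu> ori" "\<And>q. q \<in> B \<Longrightarrow> orientation_sign ori q = s q"
proof -
  have "\<exists>p. {x\<in>B. \<nu> x = e} = {snd p, fst p} \<and> s (snd p) = 1 \<and> s (fst p) = -1" if "e \<in> singular_points X" for e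
  proof -
    have "e \<in> \<nu> ` B" using that image_B by simp
    then obtain q r where qr: "{x\<in>B. \<nu> x = e} = {q, r}" "s q = 1" "s r = -1"
      using assms unfolding halves_def by blast
    then show ?thesis by (intro exI[of _ "(r, q)"]) simp
  qed
  then obtain ori where "\<forall>e\<in>singular_points X. {x\<in>B. \<nu> x = e} = {snd (ori e), fst (ori e)} \<and>
      s (snd (ori e)) = 1 \<and> s (fst (ori e)) = -1"
    using bchoice[of "singular_points X" "\<lambda>e p. {x\<in>B. \<nu> x = e} = {snd p, fst p} \<and> s (snd p) = 1 \<and> s (fst p) = -1"]
    by blast
  then have ori: "\<And>e. e \<in> singular_points X \<Longrightarrow> {x\<in>B. \<nu> x = e} = {snd (ori e), fst (ori e)}"
    "\<And>e. e \<in> singular_points X \<Longrightarrow> s (snd (ori e)) = 1" "\<And>e. e \<in> singular_points X \<Longrightarrow> s (fst (ori e)) = -1"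
    by blast+
  have "orientation Xn X \<nu> ori"
    unfolding orientation_def
  proof
    fix e assume e: "e \<in> singular_points X"
    show "{fst (ori e), snd (ori e)} = fibre Xn \<nu> {e}" unfolding fibre_eq[OF e] ori(1)[OF e] by blast
  qed
  moreover have "orientation_sign ori q = s q" if q: "q \<in> B" for q
  proof -
    have e: "\<nu> q \<in> singular_points X" using q by simp
    have "q \<in> {x\<in>B. \<nu> x = \<nu> q}" using q by simp
    then consider "snd (ori (\<nu> q)) = q" | "fst (ori (\<nu> q)) = q" "snd (ori (\<nu> q)) \<noteq> q"
      unfolding ori(1)[OF e] by blast
    then show ?thesis
    proof cases
      case 1
      then show ?thesis using ori(2)[OF e] by (simp add: orientation_sign_def)
    next
      case 2
      then show ?thesis using ori(3)[OF e] by (simp add: orientation_sign_def)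
    qed
  qed
  ultimately show ?thesis using that by blast
qed

lemma ex_orientation: "\<exists>ori. orientation Xn X \<nu> ori"
proof -
  have "\<exists>p. {fst p, snd p} = fibre Xn \<nu> {e}" if "e \<in> singular_points X" for e
  proof -
    obtain q r where "{x\<in>B. \<nu> x = e} = {q, r}" using node_fibre[OF \<open>e \<in> singular_points X\<close>] .
    then show ?thesis unfolding fibre_eq[OF that] by (intro exI[of _ "(q, r)"]) simp
  qed
  then show ?thesis unfolding orientation_def by metis
qed

lemma gverts_G: "gverts G = k ` points Xn" and gedges_G: "gedges G = singular_points X"
  by (simp_all add: dual_graph_def irreducible_components_eq)

lemma half_edge_graph:
  assumes "halves B \<nu> s"
  shows "half_edge_graph G B \<nu> k s"
proof (rule half_edge_graph.intro[OF assms])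
  show "finite (gverts G)" using finite_k by (simp add: gverts_G)
  show "\<nu> ` B = gedges G" unfolding image_B gedges_G ..
  show "k ` B \<subseteq> gverts G" unfolding gverts_G by blast
  show "gends G e = image_mset k (mset_set {x \<in> B. \<nu> x = e})" if "e \<in> gedges G" for e
    using that fibre_eq[of e] by (simp add: dual_graph_def)
qed

lemma adjacent_iff:
  assumes "A \<subseteq> singular_points X"
  shows "(u, v) \<in> adjacent_by G A \<longleftrightarrow>
    (\<exists>q r. q \<in> B \<and> r \<in> B \<and> q \<noteq> r \<and> \<nu> q = \<nu> r \<and> \<nu> q \<in> A \<and> k q = u \<and> k r = v)"
proof -
  obtain ori where "orientation Xn X \<nu> ori" using ex_orientation ..
  then interpret half_edge_graph G B \<nu> k "orientation_sign ori" by (intro half_edge_graph halves_orientation)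
  show ?thesis by (rule adjacent_by_iff) (use assms in \<open>simp add: gedges_G\<close>)
qed

definition joined :: "'k proj_point set \<Rightarrow> ('k proj_point set \<times> 'k proj_point set) set" where
  "joined A = {(u, v). u \<in> gverts G \<and> v \<in> gverts G \<and> (u, v) \<in> (adjacent_by G A)\<^sup>*}"

text \<open>One statement for \<open>X\<close>, for its partial normalizations and for these with
  nodes removed: \<open>Q\<close> is glued from \<open>Xn\<close>, and \<open>A\<close> consists of
  the nodes whose two branches remain glued after \<open>M\<close> is taken out.\<close>

lemma gluing_components:
  assumes quot: "quotient_map (zariski Xn) Q \<pi>"
    and \<pi>: "\<And>q r. q \<in> points Xn \<Longrightarrow> r \<in> points Xn \<Longrightarrow> \<pi> q = \<pi> r \<Longrightarrow> \<nu> q = \<nu> r"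
    and M: "finite M" and A: "A \<subseteq> singular_points X"
    and glue: "\<And>q r. q \<in> B \<Longrightarrow> r \<in> B \<Longrightarrow> q \<noteq> r \<Longrightarrow> \<nu> q = \<nu> r \<Longrightarrow> \<pi> q = \<pi> r \<and> \<pi> q \<notin> M \<longleftrightarrow> \<nu> q \<in> A"
  shows "card (connected_components_of (subtopology Q (topspace Q - M))) = card (gverts G // joined A)"
    "equiv (gverts G) (joined A)"
proof -
  define R where "R = {(u, v). \<exists>q r. q \<in> points Xn \<and> r \<in> points Xn \<and> \<pi> q = \<pi> r \<and> \<pi> q \<notin> M \<and> k q = u \<and> k r = v}"
  have fib: "finite {q \<in> points Xn. \<pi> q = y}" for y
  proof (cases "\<exists>q\<in>points Xn. \<pi> q = y")
    case True
    then obtain q where q: "q \<in> points Xn" "\<pi> q = y" by blast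
    have "{r \<in> points Xn. \<pi> r = y} \<subseteq> {r \<in> points Xn. \<nu> r = \<nu> q}" using \<pi> q by blast
    then show ?thesis using finite_fibre finite_subset by blast
  next
    case False
    then have "{q \<in> points Xn. \<pi> q = y} = {}" by blast
    then show ?thesis by (metis finite.emptyI)
  qed
  have inB: "q \<in> B \<and> r \<in> B" if "q \<in> points Xn" "r \<in> points Xn" "\<pi> q = \<pi> r" "k q \<noteq> k r" for q r
  proof -
    have \<nu>: "\<nu> q = \<nu> r" using \<pi> that by blast
    then have "\<nu> q \<in> singular_points X" using nonsingular_same_component[of q r] that by blast
    then show ?thesis using that \<nu> by simp
  qed
  have overlap: "finite {q \<in> points Xn. \<exists>r\<in>points Xn. \<pi> r = \<pi> q \<and> k r \<noteq> k q}"
    by (rule finite_subset[OF _ finite_B]) (use inB in force)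
  have V: "finite (gverts G)" "k ` points Xn = gverts G" using finite_k by (simp_all add: gverts_G)
  note qc = quotient_components[OF t1 V _ _ _ quot fib overlap M, folded R_def]
  have "adjacent_by G A \<subseteq> R"
  proof clarify
    fix u v assume "(u, v) \<in> adjacent_by G A"
    then obtain q r where qr: "q \<in> B" "r \<in> B" "q \<noteq> r" "\<nu> q = \<nu> r" "\<nu> q \<in> A" "k q = u" "k r = v"
      unfolding adjacent_iff[OF A] by blast
    then have "\<pi> q = \<pi> r \<and> \<pi> q \<notin> M" using glue by blast
    then show "(u, v) \<in> R" using qr unfolding R_def by blast
  qed
  \<comment> \<open>Taking \<open>q = r\<close> shows that \<open>R\<close> also relates vertices to
    themselves, hence the reflexive closure.\<close>
  moreover have "R \<subseteq> (adjacent_by G A)\<^sup>*"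
  proof clarify
    fix u v assume "(u, v) \<in> R"
    then obtain q r where qr: "q \<in> points Xn" "r \<in> points Xn" "\<pi> q = \<pi> r" "\<pi> q \<notin> M" "k q = u" "k r = v"
      unfolding R_def by blast
    show "(u, v) \<in> (adjacent_by G A)\<^sup>*"
    proof (cases "u = v")
      case False
      then have b: "q \<in> B" "r \<in> B" "q \<noteq> r" "\<nu> q = \<nu> r" using inB[OF qr(1-3)] qr(5,6) \<pi>[OF qr(1-3)] by auto
      then have "\<nu> q \<in> A" using glue qr(3,4) by blast
      then have "(u, v) \<in> adjacent_by G A" unfolding adjacent_iff[OF A] using b qr(5,6) by blast
      then show ?thesis by (rule r_into_rtrancl)
    qed simp
  qed
  ultimately have "R\<^sup>* = (adjacent_by G A)\<^sup>*" by (rule rtrancl_subset)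
  then have E: "{(u, v). u \<in> gverts G \<and> v \<in> gverts G \<and> (u, v) \<in> R\<^sup>*} = joined A"
    by (simp add: joined_def)
  show "card (connected_components_of (subtopology Q (topspace Q - M))) = card (gverts G // joined A)"
    "equiv (gverts G) (joined A)"
    by (rule qc[unfolded E]; (rule k_fibres, simp add: gverts_G)?)+
qed

lemma joined_mono: "A \<subseteq> A' \<Longrightarrow> joined A \<subseteq> joined A'"
proof -
  assume "A \<subseteq> A'"
  then have "adjacent_by G A \<subseteq> adjacent_by G A'" unfolding adjacent_by_def by blast
  then have "(adjacent_by G A)\<^sup>* \<subseteq> (adjacent_by G A')\<^sup>*" by (rule rtrancl_mono)
  then show "joined A \<subseteq> joined A'" unfolding joined_def by blast
qed

lemma joined_remove_edge:
  assumes A: "A \<subseteq> singular_points X" and e: "e \<in> A"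
  shows "joined (A - {e}) = joined A \<longleftrightarrow>
    (\<forall>u v. gends G e = {#u, v#} \<longrightarrow> (u, v) \<in> (adjacent_by G (A - {e}))\<^sup>*)"
proof
  assume eq: "joined (A - {e}) = joined A"
  show "\<forall>u v. gends G e = {#u, v#} \<longrightarrow> (u, v) \<in> (adjacent_by G (A - {e}))\<^sup>*"
  proof (intro allI impI)
    fix u v assume "gends G e = {#u, v#}"
    then have uv: "(u, v) \<in> adjacent_by G A" using e by (auto simp: adjacent_by_def)
    then have "u \<in> gverts G" "v \<in> gverts G" using adjacent_iff[OF A] gverts_G by auto
    then have "(u, v) \<in> joined A" using uv by (simp add: joined_def r_into_rtrancl)
    then show "(u, v) \<in> (adjacent_by G (A - {e}))\<^sup>*" using eq by (auto simp: joined_def)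
  qed
next
  assume *: "\<forall>u v. gends G e = {#u, v#} \<longrightarrow> (u, v) \<in> (adjacent_by G (A - {e}))\<^sup>*"
  have "adjacent_by G A \<subseteq> (adjacent_by G (A - {e}))\<^sup>*"
  proof clarify
    fix u v assume "(u, v) \<in> adjacent_by G A"
    then obtain e' where "e' \<in> A" "gends G e' = {#u, v#}" by (auto simp: adjacent_by_def)
    then show "(u, v) \<in> (adjacent_by G (A - {e}))\<^sup>*"
      using * by (cases "e' = e") (auto simp: adjacent_by_def intro!: r_into_rtrancl)
  qed
  then have "(adjacent_by G A)\<^sup>* = (adjacent_by G (A - {e}))\<^sup>*"
    by (rule rtrancl_subset[rotated]) (auto simp: adjacent_by_def)
  then show "joined (A - {e}) = joined A" by (simp add: joined_def)
qed

lemma components_X: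
  assumes "finite M"
  shows "card (connected_components_of (subtopology (zariski X) (points X - M))) = card (gverts G // joined (singular_points X - M))"
    "equiv (gverts G) (joined (singular_points X - M))"
proof -
  have "\<nu> q = \<nu> r \<and> \<nu> q \<notin> M \<longleftrightarrow> \<nu> q \<in> singular_points X - M"
    if "q \<in> B" "r \<in> B" "q \<noteq> r" "\<nu> q = \<nu> r" for q r
    using that by blast
  note gc = gluing_components[where Q="zariski X" and \<pi>=\<nu> and M=M and A="singular_points X - M",
      OF quotient _ assms Diff_subset this]
  show "card (connected_components_of (subtopology (zariski X) (points X - M))) = card (gverts G // joined (singular_points X - M))"
    "equiv (gverts G) (joined (singular_points X - M))"
    by (rule gc(1), assumption+, rule gc(2), assumption+)
qed

text \<open>Removing a node deletes a point of the curve and an edge of the graph. Since punctured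
  components stay connected, both counts of connected components agree, and an unchanged count means
  an unchanged relation \<open>joined\<close>.\<close>

lemma no_bridge:
  assumes "\<not> (\<exists>n. separating_node X n)" "e \<in> singular_points X" "gends G e = {#u, v#}"
  shows "(u, v) \<in> (adjacent_by G (singular_points X - {e}))\<^sup>*"
proof -
  have "\<not> card (connected_components_of (zariski X)) < card (connected_components_of (subtopology (zariski X) (points X - {e})))"
  proof
    assume "card (connected_components_of (zariski X)) < card (connected_components_of (subtopology (zariski X) (points X - {e})))"
    then have "separating_node X e" unfolding separating_node_def using assms(2) by (rule conjI[rotated])
    then show False using assms(1) by blast
  qed
  moreover have "card (connected_components_of (zariski X)) = card (gverts G // joined (singular_points X))"
    "equiv (gverts G) (joined (singular_points X))"
    using components_X[of "{}"] by simp_all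
  ultimately have "joined (singular_points X - {e}) = joined (singular_points X)"
    using finer_quotient_card[of "gverts G" "joined (singular_points X)" "joined (singular_points X - {e})"]
      components_X[of "{e}"] joined_mono[of "singular_points X - {e}" "singular_points X"] finite_k
    by (auto simp: gverts_G)
  then show ?thesis using joined_remove_edge[of "singular_points X" e] assms(2,3) by blast
qed

lemma connected_graph:
  assumes "u \<in> gverts G" "v \<in> gverts G"
  shows "(u, v) \<in> (adjacent_by G (singular_points X))\<^sup>*"
proof -
  have "points X \<noteq> {} \<and> connected_space (zariski X)"
    using nodal by (simp add: connected_nodal_curve_def)
  then have "connected_components_of (zariski X) = {points X}"
    unfolding connected_components_of_eq_singleton by simp
  then have c: "card (gverts G // joined (singular_points X)) = 1" and E: "equiv (gverts G) (joined (singular_points X))"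
    using components_X[of "{}"] by simp_all
  obtain x where x: "gverts G // joined (singular_points X) = {x}" by (rule card_1_singletonE[OF c])
  have "joined (singular_points X) `` {u} \<in> gverts G // joined (singular_points X)"
    "joined (singular_points X) `` {v} \<in> gverts G // joined (singular_points X)"
    by (rule quotientI[OF assms(1)], rule quotientI[OF assms(2)])
  then have "joined (singular_points X) `` {u} = joined (singular_points X) `` {v}"
    unfolding x by simp
  then have "(u, v) \<in> joined (singular_points X)" using eq_equiv_class_iff[OF E assms] by simp
  then show ?thesis by (simp add: joined_def)
qed

section \<open>Partial normalizations and their separating nodes\<close>

context
  fixes S assumes S: "S \<subseteq> singular_points X"
begin

abbreviation "Y \<equiv> partial_normalization Xn X \<nu> S"
abbreviation "\<pi> \<equiv> partial_norm_map \<nu> S"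

lemma openin_Y: "openin (zariski Y) U \<longleftrightarrow> U \<subseteq> (points X - S) <+> fibre Xn \<nu> S \<and> openin (zariski Xn) (fibre Xn \<pi> U)"
  by (simp add: partial_normalization_def topology_inverse'[OF istopology_partial_norm_open] partial_norm_open_def)

lemma \<pi>_image: "\<pi> ` points Xn = (points X - S) <+> fibre Xn \<nu> S"
proof (intro equalityI subsetI)
  fix y assume "y \<in> \<pi> ` points Xn"
  then obtain q where q: "q \<in> points Xn" "y = \<pi> q" by blast
  show "y \<in> (points X - S) <+> fibre Xn \<nu> S"
    using \<nu>_points[OF q(1)] q by (cases "\<nu> q \<in> S") (simp_all add: partial_norm_map_def fibre_def InlI InrI)
next
  fix y assume "y \<in> (points X - S) <+> fibre Xn \<nu> S"
  then show "y \<in> \<pi> ` points Xn"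
  proof (elim PlusE)
    fix x assume x: "x \<in> points X - S" "y = Inl x"
    then obtain q where "q \<in> points Xn" "x = \<nu> q" using surj by blast
    then show ?thesis using x by (auto simp: partial_norm_map_def intro!: image_eqI[of _ _ q])
  next
    fix q assume "q \<in> fibre Xn \<nu> S" "y = Inr q"
    then show ?thesis by (auto simp: partial_norm_map_def fibre_def intro!: image_eqI[of _ _ q])
  qed
qed

lemma points_Y: "points Y = (points X - S) <+> fibre Xn \<nu> S"
proof
  show "points Y \<subseteq> (points X - S) <+> fibre Xn \<nu> S" using openin_Y[of "points Y"] by blast
  have "fibre Xn \<pi> ((points X - S) <+> fibre Xn \<nu> S) = points Xn" using \<pi>_image by (auto simp: fibre_def)
  then have "openin (zariski Y) ((points X - S) <+> fibre Xn \<nu> S)" unfolding openin_Y by simp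
  then show "(points X - S) <+> fibre Xn \<nu> S \<subseteq> points Y" by (rule openin_subset)
qed

lemma quotient_Y: "quotient_map (zariski Xn) (zariski Y) \<pi>"
  unfolding quotient_map_def
proof (intro conjI allI impI)
  show "\<pi> ` points Xn = points Y" unfolding points_Y by (rule \<pi>_image)
  fix U assume "U \<subseteq> points Y"
  then show "openin (zariski Xn) {x \<in> points Xn. \<pi> x \<in> U} \<longleftrightarrow> openin (zariski Y) U"
    unfolding openin_Y points_Y by (simp add: fibre_def)
qed

lemma components_Y:
  assumes "finite M"
  shows "card (connected_components_of (subtopology (zariski Y) (points Y - M))) =
      card (gverts G // joined {e \<in> singular_points X - S. Inl e \<notin> M})"
    "equiv (gverts G) (joined {e \<in> singular_points X - S. Inl e \<notin> M})"
proof -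
  let ?A = "{e \<in> singular_points X - S. Inl e \<notin> M}"
  have \<pi>\<nu>: "\<nu> q = \<nu> r" if "\<pi> q = \<pi> r" for q r
    using that by (cases "\<nu> q \<in> S"; cases "\<nu> r \<in> S") (simp_all add: partial_norm_map_def)
  have glue: "\<pi> q = \<pi> r \<and> \<pi> q \<notin> M \<longleftrightarrow> \<nu> q \<in> ?A"
    if "q \<in> B" "r \<in> B" "q \<noteq> r" "\<nu> q = \<nu> r" for q r
  proof (cases "\<nu> q \<in> S")
    case True
    then have "\<pi> q \<noteq> \<pi> r" using that(3,4) by (simp add: partial_norm_map_def)
    then show ?thesis using True by blast
  next
    case False
    then have "\<pi> q = Inl (\<nu> q)" "\<pi> r = Inl (\<nu> q)" using that(4) by (simp_all add: partial_norm_map_def)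
    then show ?thesis using False that(1) by simp
  qed
  have A: "?A \<subseteq> singular_points X" by blast
  note gc = gluing_components[where Q="zariski Y" and \<pi>=\<pi> and M=M and A="?A", OF quotient_Y \<pi>\<nu> assms A glue]
  show "card (connected_components_of (subtopology (zariski Y) (points Y - M))) = card (gverts G // joined ?A)"
    "equiv (gverts G) (joined ?A)"
    by (rule gc(1), assumption+, rule gc(2), assumption+)
qed

lemma open_remove_S: "openin (zariski Xn) W \<Longrightarrow> openin (zariski Xn) {q \<in> W. \<nu> q \<notin> S}"
proof -
  assume W: "openin (zariski Xn) W"
  have "finite {q \<in> points Xn. \<nu> q \<in> S}" using S by (intro finite_subset[OF _ finite_B]) blast
  then have "closedin (zariski Xn) {q \<in> points Xn. \<nu> q \<in> S}" using t1 by (auto simp: t1_space_closedin_finite)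
  then have "openin (zariski Xn) (W - {q \<in> points Xn. \<nu> q \<in> S})" using W by (rule openin_diff[rotated])
  moreover have "W - {q \<in> points Xn. \<nu> q \<in> S} = {q \<in> W. \<nu> q \<notin> S}" using openin_subset[OF W] by auto
  ultimately show ?thesis by simp
qed

text \<open>Only finitely many points of \<open>Xn\<close> lie over \<open>S\<close>, and they form
  a closed set. Away from them \<open>X\<close> and \<open>Y\<close> carry the same quotient
  topology.\<close>

lemma near_Inl:
  assumes e: "e \<in> points X - S"
  shows "near Y (Inl e) P \<longleftrightarrow> near X e (\<lambda>x. P (Inl x))"
proof
  assume "near Y (Inl e) P"
  then obtain U where U: "openin (zariski Y) U" "Inl e \<in> U" "\<And>x. x \<in> U \<Longrightarrow> P x" by (auto simp: near_def)
  define W where "W = {x \<in> points X - S. Inl x \<in> U}"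
  have eq: "{q \<in> points Xn. \<nu> q \<in> W} = {q \<in> fibre Xn \<pi> U. \<nu> q \<notin> S}"
    using \<nu>_points by (auto simp: W_def fibre_def partial_norm_map_def)
  have "openin (zariski Xn) {q \<in> fibre Xn \<pi> U. \<nu> q \<notin> S}" using U(1) openin_Y open_remove_S by blast
  moreover have "W \<subseteq> points X" by (auto simp: W_def)
  then have "openin (zariski Xn) {q \<in> points Xn. \<nu> q \<in> W} = openin (zariski X) W"
    using quotient unfolding quotient_map_def by blast
  ultimately have "openin (zariski X) W" unfolding eq by blast
  moreover have "e \<in> W" using e U(2) by (simp add: W_def)
  moreover have "\<forall>x\<in>W. P (Inl x)" using U(3) by (auto simp: W_def)
  ultimately show "near X e (\<lambda>x. P (Inl x))" unfolding near_def by blast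
next
  assume "near X e (\<lambda>x. P (Inl x))"
  then obtain W where W: "openin (zariski X) W" "e \<in> W" "\<And>x. x \<in> W \<Longrightarrow> P (Inl x)" by (auto simp: near_def)
  define U :: "('k proj_point + 'k proj_point) set" where "U = Inl ` (W - S)"
  have "fibre Xn \<pi> U = {q \<in> {q \<in> points Xn. \<nu> q \<in> W}. \<nu> q \<notin> S}"
    by (auto simp: U_def fibre_def partial_norm_map_def)
  then have "openin (zariski Xn) (fibre Xn \<pi> U)"
    using open_remove_S[OF openin_continuous_map_preimage[OF cont W(1)]] by simp
  moreover have "U \<subseteq> (points X - S) <+> fibre Xn \<nu> S" using openin_subset[OF W(1)] by (auto simp: U_def)
  ultimately have "openin (zariski Y) U" unfolding openin_Y by blast
  moreover have "Inl e \<in> U" using e W(2) by (simp add: U_def)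
  moreover have "\<forall>x\<in>U. P x" using W(3) by (auto simp: U_def)
  ultimately show "near Y (Inl e) P" unfolding near_def by blast
qed

text \<open>Off \<open>S\<close> the germs and neighbourhoods of \<open>Y\<close> are those of
  \<open>X\<close>, so a uniformizer at \<open>Inl e\<close> would restrict to one at
  \<open>e\<close>. Thus the nodes outside \<open>S\<close> can serve as separating nodes of
  \<open>Y\<close>.\<close>

lemma singular_Inl:
  assumes e: "e \<in> singular_points X - S"
  shows "Inl e \<in> singular_points Y"
proof -
  have eX: "e \<in> points X - S" using e singular_sub by blast
  have reg: "h \<in> regular_at Y (Inl e) \<longleftrightarrow> h \<circ> Inl \<in> regular_at X e" for h
    by (simp add: partial_normalization_def)
  have "\<not> nonsingular_at Y (Inl e)"
  proof
    assume "nonsingular_at Y (Inl e)"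
    then obtain t where t: "t \<in> regular_at Y (Inl e)" "t (Inl e) = 0" "\<not> near Y (Inl e) (\<lambda>x. t x = 0)"
      and dvr: "\<And>h. h \<in> regular_at Y (Inl e) \<Longrightarrow> near Y (Inl e) (\<lambda>x. h x = 0) \<or>
        (\<exists>u \<in> regular_at Y (Inl e). \<exists>m::nat. u (Inl e) \<noteq> 0 \<and> near Y (Inl e) (\<lambda>x. h x = u x * t x ^ m))"
      unfolding nonsingular_at_def by blast
    have "nonsingular_at X e"
      unfolding nonsingular_at_def
    proof (intro bexI[of _ "t \<circ> Inl"] conjI ballI)
      show "t \<circ> Inl \<in> regular_at X e" using t(1) by (simp add: reg)
      show "(t \<circ> Inl) e = 0" using t(2) by simp
      show "\<not> near X e (\<lambda>x. (t \<circ> Inl) x = 0)" using t(3) near_Inl[OF eX] by simp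
      fix h assume h: "h \<in> regular_at X e"
      \<comment> \<open>Extension by 0 to the points over \<open>S\<close>; regularity at
        \<open>Inl e\<close> looks only at the values on \<open>Inl\<close>.\<close>
      define h' :: "'k proj_point + 'k proj_point \<Rightarrow> 'k" where "h' = case_sum h (\<lambda>_. 0)"
      have h': "h' \<circ> Inl = h" "\<And>x. h' (Inl x) = h x" by (auto simp: h'_def)
      then have "h' \<in> regular_at Y (Inl e)" unfolding reg using h by (simp only:)
      from dvr[OF this] show "near X e (\<lambda>x. h x = 0) \<or>
          (\<exists>u\<in>regular_at X e. \<exists>m. u e \<noteq> 0 \<and> near X e (\<lambda>x. h x = u x * (t \<circ> Inl) x ^ m))"
      proof (elim disjE bexE exE conjE)
        assume "near Y (Inl e) (\<lambda>x. h' x = 0)"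
        then show ?thesis unfolding near_Inl[OF eX] h' by (rule disjI1)
      next
        fix u m assume u: "u \<in> regular_at Y (Inl e)" "u (Inl e) \<noteq> 0"
          "near Y (Inl e) (\<lambda>x. h' x = u x * t x ^ m)"
        then show ?thesis unfolding near_Inl[OF eX] reg h'
          by (intro disjI2 bexI[of _ "u \<circ> Inl"] exI[of _ m]) simp_all
      qed
    qed
    then show False using e by (simp add: singular_points_def)
  qed
  then show ?thesis using eX by (simp add: singular_points_def points_Y InlI)
qed

text \<open>Removing \<open>Inl e\<close> for a node \<open>e\<close> outside \<open>S\<close>
  deletes that edge from the complement of \<open>S\<close>. Removing any other point deletes no
  edge and leaves the count of components unchanged.\<close>

lemma no_separating_node_Y:
  "(\<not> (\<exists>n. separating_node Y n)) \<longleftrightarrow> (\<forall>e\<in>singular_points X - S. \<forall>u v. gends G e = {#u, v#} \<longrightarrow>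
     (u, v) \<in> (adjacent_by G (singular_points X - S - {e}))\<^sup>*)"
proof -
  let ?A = "singular_points X - S"
  have A: "{e \<in> ?A. Inl e \<notin> {}} = ?A" by auto
  have c: "card (connected_components_of (zariski Y)) = card (gverts G // joined ?A)" and E: "equiv (gverts G) (joined ?A)"
    using components_Y[of "{}", unfolded A] by simp_all
  have V: "finite (gverts G)" using finite_k by (simp add: gverts_G)
  have sep: "card (connected_components_of (zariski Y)) < card (connected_components_of (subtopology (zariski Y) (points Y - {n})))
      \<longleftrightarrow> joined {e \<in> ?A. Inl e \<notin> {n}} \<noteq> joined ?A" for n
    unfolding c components_Y(1)[of "{n}", OF finite.insertI[OF finite.emptyI]]
    using finer_quotient_card[OF V E components_Y(2)[of "{n}"] joined_mono] by auto
  have Ae: "{x \<in> ?A. Inl x \<notin> {Inl e}} = ?A - {e}" for e by auto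
  show ?thesis
  proof
    assume no: "\<not> (\<exists>n. separating_node Y n)"
    show "\<forall>e\<in>?A. \<forall>u v. gends G e = {#u, v#} \<longrightarrow> (u, v) \<in> (adjacent_by G (?A - {e}))\<^sup>*"
    proof
      fix e assume e: "e \<in> ?A"
      then have "joined (?A - {e}) = joined ?A"
        using no sep[of "Inl e"] singular_Inl[OF e] unfolding separating_node_def Ae by blast
      then show "\<forall>u v. gends G e = {#u, v#} \<longrightarrow> (u, v) \<in> (adjacent_by G (?A - {e}))\<^sup>*"
        using joined_remove_edge[OF _ e] by blast
    qed
  next
    assume *: "\<forall>e\<in>?A. \<forall>u v. gends G e = {#u, v#} \<longrightarrow> (u, v) \<in> (adjacent_by G (?A - {e}))\<^sup>*"
    show "\<not> (\<exists>n. separating_node Y n)"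
    proof
      assume "\<exists>n. separating_node Y n"
      then obtain n where "separating_node Y n" by (rule exE)
      then have n: "joined {e \<in> ?A. Inl e \<notin> {n}} \<noteq> joined ?A"
        unfolding separating_node_def using sep[of n] by (elim conjE) (rule iffD1)
      have "{e \<in> ?A. Inl e \<notin> {n}} \<noteq> ?A"
      proof (rule notI)
        assume "{e \<in> ?A. Inl e \<notin> {n}} = ?A"
        then have "joined {e \<in> ?A. Inl e \<notin> {n}} = joined ?A" by (rule arg_cong)
        with n show False by (rule notE)
      qed
      then obtain e where e: "e \<in> ?A" "n = Inl e" by blast
      then show False using n joined_remove_edge[OF _ e(1)] * unfolding e(2) Ae by blast
    qed
  qed
qed

end

lemma C1_sets_eq: "C1_sets Xn X \<nu> = half_edge_graph.C1 G"
proof -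
  obtain ori where "orientation Xn X \<nu> ori" using ex_orientation ..
  then interpret half_edge_graph G B \<nu> k "orientation_sign ori" by (intro half_edge_graph halves_orientation)
  show ?thesis unfolding C1_sets_def C1_def gedges_G using no_separating_node_Y by blast
qed

lemma bridgeless_graph:
  assumes "\<not> (\<exists>n. separating_node X n)" and h: "halves B \<nu> s"
  shows "bridgeless_graph G B \<nu> k s"
  by (rule bridgeless_graph.intro[OF half_edge_graph[OF h] bridgeless_graph_axioms.intro], unfold gedges_G)
    (rule connected_graph, assumption, assumption, rule no_bridge[OF assms(1)], assumption, assumption)

end

section \<open>Divisors on the normalization\<close>

lemma lookup_frag_extend:
  "Poly_Mapping.lookup (frag_extend b c) y =
     (\<Sum>x\<in>Poly_Mapping.keys c. Poly_Mapping.lookup c x * Poly_Mapping.lookup (b x) y)"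
  by (simp add: frag_extend_def lookup_sum)

lemma lookup_pushforward:
  assumes "inj_on h A" "Poly_Mapping.keys c \<subseteq> A" "x \<in> A"
  shows "Poly_Mapping.lookup (pushforward h c) (h x) = Poly_Mapping.lookup c x"
proof -
  have "Poly_Mapping.lookup (pushforward h c) (h x) =
      (\<Sum>y\<in>Poly_Mapping.keys c. if y = x then Poly_Mapping.lookup c x else 0)"
    unfolding pushforward_def lookup_frag_extend
    by (rule sum.cong) (use assms in \<open>auto dest: inj_onD\<close>)
  then show ?thesis by (simp add: in_keys_iff)
qed

lemma lookup_pushforward_0:
  assumes "y \<notin> h ` Poly_Mapping.keys c"
  shows "Poly_Mapping.lookup (pushforward h c) y = 0"
  unfolding pushforward_def lookup_frag_extend by (rule sum.neutral) (use assms in auto)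

lemma keys_pushforward:
  assumes "inj_on h A" "Poly_Mapping.keys c \<subseteq> A"
  shows "Poly_Mapping.keys (pushforward h c) = h ` Poly_Mapping.keys c"
proof (intro equalityI subsetI)
  fix y assume "y \<in> Poly_Mapping.keys (pushforward h c)"
  then show "y \<in> h ` Poly_Mapping.keys c" using lookup_pushforward_0[of y h c] by (auto simp: in_keys_iff)
next
  fix y assume "y \<in> h ` Poly_Mapping.keys c"
  then obtain x where x: "x \<in> Poly_Mapping.keys c" "y = h x" by (rule imageE)
  then show "y \<in> Poly_Mapping.keys (pushforward h c)"
    using lookup_pushforward[OF assms, of x] assms(2) by (auto simp: in_keys_iff)
qed

lemma lookup_sign_action:
  "Poly_Mapping.lookup (sign_action Y \<alpha> c) q =
     \<alpha> (connected_component_of_set (zariski Y) q) * Poly_Mapping.lookup c q"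
proof -
  have "Poly_Mapping.lookup (sign_action Y \<alpha> c) q = (\<Sum>x\<in>Poly_Mapping.keys c.
      if x = q then \<alpha> (connected_component_of_set (zariski Y) q) * Poly_Mapping.lookup c q else 0)"
    unfolding sign_action_def lookup_frag_extend by (rule sum.cong) auto
  then show ?thesis by (simp add: in_keys_iff)
qed

lemma supp_lookup: "supp (Poly_Mapping.lookup c) = Poly_Mapping.keys c"
  by (auto simp: supp_def in_keys_iff)

lemma finite_supp_lookup: "finite (supp z) \<Longrightarrow> \<exists>c. Poly_Mapping.lookup c = z"
  by (rule exI[of _ "Abs_poly_mapping z"]) (simp add: supp_def)

context nodal_curve
begin

lemma pairing_edges:
  assumes ori: "orientation Xn X \<nu> ori"
  shows "pairing B \<nu> (orientation_sign ori) h z g =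
    (\<Sum>e\<in>singular_points X. z e * (g (h (snd (ori e))) - g (h (fst (ori e)))))"
proof -
  let ?F = "\<lambda>q. g (h q) * (orientation_sign ori q * z (\<nu> q))"
  have "pairing B \<nu> (orientation_sign ori) h z g = sum ?F {q\<in>B. \<nu> q \<in> UNIV}" by (simp add: pairing_def)
  also have "\<dots> = (\<Sum>e\<in>UNIV \<inter> \<nu> ` B. sum ?F {q\<in>B. \<nu> q = e})" by (rule sum_by_edges[OF halves_orientation[OF ori]])
  also have "\<dots> = (\<Sum>e\<in>singular_points X. z e * (g (h (snd (ori e))) - g (h (fst (ori e)))))"
    unfolding image_B Int_UNIV_left
  proof (rule sum.cong)
    fix e assume e: "e \<in> singular_points X"
    note o = orientation_pair[OF ori e]
    have "\<nu> (snd (ori e)) = e" "\<nu> (fst (ori e)) = e" using o(1) by blast+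
    then show "sum ?F {q\<in>B. \<nu> q = e} = z e * (g (h (snd (ori e))) - g (h (fst (ori e))))"
      unfolding o(1) using o(2-4) by (simp add: algebra_simps)
  qed simp
  finally show ?thesis .
qed

lemma lookup_boundary:
  assumes ori: "orientation Xn X \<nu> ori" and c: "Poly_Mapping.keys c \<subseteq> singular_points X"
  shows "Poly_Mapping.lookup (boundary Xn \<nu> ori c) v =
    pairing B \<nu> (orientation_sign ori) k (Poly_Mapping.lookup c) (\<lambda>u. of_bool (u = v))"
  unfolding pairing_edges[OF ori] boundary_def lookup_frag_extend
  by (rule sum.mono_neutral_cong_left[OF finite_singular c]) (auto simp: in_keys_iff lookup_minus)

text \<open>The coefficient of the boundary at \<open>v\<close> is the pairing with the indicator of
  \<open>v\<close>, and on the finitely many vertices every test function is a combination of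
  indicators.\<close>

lemma H1_iff:
  assumes ori: "orientation Xn X \<nu> ori"
  shows "c \<in> H1 Xn X \<nu> ori \<longleftrightarrow> half_edge_graph.flow G B \<nu> k (orientation_sign ori) (Poly_Mapping.lookup c)"
proof -
  interpret half_edge_graph G B \<nu> k "orientation_sign ori"
    by (rule half_edge_graph[OF halves_orientation[OF ori]])
  show ?thesis
  proof (cases "Poly_Mapping.keys c \<subseteq> singular_points X")
    case True
    note lb = lookup_boundary[OF ori True]
    have "boundary Xn \<nu> ori c = 0 \<longleftrightarrow> (\<forall>g. pairing B \<nu> (orientation_sign ori) k (Poly_Mapping.lookup c) g = 0)"
    proof
      assume 0: "boundary Xn \<nu> ori c = 0"
      have v0: "pairing B \<nu> (orientation_sign ori) k (Poly_Mapping.lookup c) (\<lambda>u. of_bool (u = v)) = 0" for v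
        unfolding lb[symmetric] 0 by simp
      show "\<forall>g. pairing B \<nu> (orientation_sign ori) k (Poly_Mapping.lookup c) g = 0"
      proof
        fix g
        let ?F = "\<lambda>q. orientation_sign ori q * Poly_Mapping.lookup c (\<nu> q)"
        have "pairing B \<nu> (orientation_sign ori) k (Poly_Mapping.lookup c) g =
            (\<Sum>q\<in>B. \<Sum>v\<in>gverts G. g v * (of_bool (k q = v) * ?F q))"
          unfolding pairing_def
        proof (rule sum.cong)
          fix q assume q: "q \<in> B"
          have "k q \<in> gverts G" using verts q by blast
          have "(\<Sum>v\<in>gverts G. g v * (of_bool (k q = v) * ?F q)) = (\<Sum>v\<in>gverts G. if v = k q then g (k q) * ?F q else 0)"
            by (rule sum.cong) auto
          then show "g (k q) * ?F q = (\<Sum>v\<in>gverts G. g v * (of_bool (k q = v) * ?F q))"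
            using finV \<open>k q \<in> gverts G\<close> by simp
        qed simp
        also have "\<dots> = (\<Sum>v\<in>gverts G. g v * pairing B \<nu> (orientation_sign ori) k (Poly_Mapping.lookup c) (\<lambda>u. of_bool (u = v)))"
          unfolding pairing_def by (subst sum.swap) (simp add: sum_distrib_left)
        also have "\<dots> = 0" using v0 by simp
        finally show "pairing B \<nu> (orientation_sign ori) k (Poly_Mapping.lookup c) g = 0" .
      qed
    next
      assume "\<forall>g. pairing B \<nu> (orientation_sign ori) k (Poly_Mapping.lookup c) g = 0"
      then show "boundary Xn \<nu> ori c = 0" by (intro poly_mapping_eqI) (simp add: lb)
    qed
    then show ?thesis using True by (simp add: H1_def flow_def supp_lookup gedges_G)
  next
    case False
    then show ?thesis by (simp add: H1_def flow_def supp_lookup gedges_G)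
  qed
qed

lemma lookup_eta:
  assumes ori: "orientation Xn X \<nu> ori" and c: "Poly_Mapping.keys c \<subseteq> singular_points X"
  shows "Poly_Mapping.lookup (eta ori c) q =
    (if q \<in> B then orientation_sign ori q * Poly_Mapping.lookup c (\<nu> q) else 0)"
proof -
  have zero: "Poly_Mapping.lookup (frag_of (snd (ori e)) - frag_of (fst (ori e))) q = 0"
    if "e \<in> singular_points X" "q \<notin> B \<or> \<nu> q \<noteq> e" for e
  proof -
    have "q \<notin> {snd (ori e), fst (ori e)}" unfolding orientation_pair(1)[OF ori that(1), symmetric] using that(2) by blast
    then show ?thesis by (simp add: lookup_minus)
  qed
  show ?thesis
  proof (cases "q \<in> B")
    case False
    then have "Poly_Mapping.lookup (eta ori c) q = 0"
      unfolding eta_def lookup_frag_extend using zero c by (intro sum.neutral) auto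
    then show ?thesis unfolding if_not_P[OF False] .
  next
    case True
    then have e: "\<nu> q \<in> singular_points X" by simp
    have "q \<in> {x\<in>B. \<nu> x = \<nu> q}" using True by simp
    then have q: "q = snd (ori (\<nu> q)) \<or> q = fst (ori (\<nu> q))" unfolding orientation_pair(1)[OF ori e] by simp
    have one: "Poly_Mapping.lookup (frag_of (snd (ori (\<nu> q))) - frag_of (fst (ori (\<nu> q)))) q = orientation_sign ori q"
    proof (cases "q = snd (ori (\<nu> q))")
      case True
      then have "q \<noteq> fst (ori (\<nu> q))" using orientation_pair(2)[OF ori e] by metis
      then show ?thesis using True by (simp add: orientation_sign_def lookup_minus)
    next
      case False
      then have "q = fst (ori (\<nu> q))" using q by simp
      then show ?thesis using False by (simp add: orientation_sign_def lookup_minus)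
    qed
    have "Poly_Mapping.lookup (eta ori c) q =
        (\<Sum>e\<in>Poly_Mapping.keys c. if e = \<nu> q then Poly_Mapping.lookup c (\<nu> q) * orientation_sign ori q else 0)"
      unfolding eta_def lookup_frag_extend
    proof (rule sum.cong)
      fix e assume "e \<in> Poly_Mapping.keys c"
      then have "e \<in> singular_points X" using c by blast
      then show "Poly_Mapping.lookup c e * Poly_Mapping.lookup (frag_of (snd (ori e)) - frag_of (fst (ori e))) q =
          (if e = \<nu> q then Poly_Mapping.lookup c (\<nu> q) * orientation_sign ori q else 0)"
        using zero[of e] one by (cases "e = \<nu> q") auto
    qed simp
    then show ?thesis using True by (simp add: in_keys_iff)
  qed
qed

text \<open>A point of \<open>Xn\<close> is a branch of at most one node, so nothing cancels in
  \<eta> and the support of a chain can be recovered from its divisor.\<close>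

lemma keys_eta:
  assumes ori: "orientation Xn X \<nu> ori" and c: "Poly_Mapping.keys c \<subseteq> singular_points X"
  shows "Poly_Mapping.keys (eta ori c) = {q\<in>B. \<nu> q \<in> Poly_Mapping.keys c}"
  by (auto simp: in_keys_iff lookup_eta[OF assms] orientation_sign_def split: if_splits)

lemma flow_supports_eq:
  assumes ori: "orientation Xn X \<nu> ori"
  shows "half_edge_graph.flow_supports G B \<nu> k (orientation_sign ori) = Poly_Mapping.keys ` H1 Xn X \<nu> ori"
proof -
  interpret half_edge_graph G B \<nu> k "orientation_sign ori"
    by (rule half_edge_graph[OF halves_orientation[OF ori]])
  show ?thesis
  proof (intro equalityI subsetI)
    fix D assume "D \<in> flow_supports"
    then obtain z where z: "D = supp z" "flow z" unfolding flow_supports_def by blast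
    then have "finite (supp z)" using finE unfolding flow_def by (blast intro: finite_subset)
    then obtain c where c: "Poly_Mapping.lookup c = z" using finite_supp_lookup by blast
    then have "c \<in> H1 Xn X \<nu> ori" using z(2) by (simp add: H1_iff[OF ori])
    moreover have "D = Poly_Mapping.keys c" using z(1) c supp_lookup[of c] by simp
    ultimately show "D \<in> Poly_Mapping.keys ` H1 Xn X \<nu> ori" by (rule rev_image_eqI)
  next
    fix D assume "D \<in> Poly_Mapping.keys ` H1 Xn X \<nu> ori"
    then obtain c where c: "D = Poly_Mapping.keys c" "c \<in> H1 Xn X \<nu> ori" by (rule imageE)
    then show "D \<in> flow_supports"
      unfolding flow_supports_def c(1) supp_lookup[symmetric] using H1_iff[OF ori] by (intro imageI) simp
  qed
qed

lemma H1_keys: "c \<in> H1 Xn X \<nu> ori \<Longrightarrow> Poly_Mapping.keys c \<subseteq> singular_points X"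
  by (simp add: H1_def)

end

section \<open>Comparison of T-equivalence and C1-equivalence\<close>

locale two_curves = C: nodal_curve X Xn \<nu> + C': nodal_curve X' Xn' \<nu>'
  for X Xn :: "('k::field proj_point, 'k) variety" and \<nu>
    and X' Xn' :: "('k proj_point, 'k) variety" and \<nu>' +
  assumes nonsep: "\<not> (\<exists>n. separating_node X n)" and nonsep': "\<not> (\<exists>n. separating_node X' n)"
begin

lemma support_iso:
  assumes ori: "orientation Xn X \<nu> ori" and ori': "orientation Xn' X' \<nu>' ori'"
    and \<epsilon>: "bij_betw \<epsilon> (singular_points X) (singular_points X')"
    and H: "pushforward \<epsilon> ` H1 Xn X \<nu> ori = H1 Xn' X' \<nu>' ori'"
  shows "support_iso C.G C.B \<nu> C.k (C.orientation_sign ori) C'.G C'.B \<nu>' C'.k (C'.orientation_sign ori') \<epsilon>"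
proof (rule support_iso.intro)
  show "bridgeless_graph C.G C.B \<nu> C.k (C.orientation_sign ori)"
    by (rule C.bridgeless_graph[OF nonsep C.halves_orientation[OF ori]])
  show "bridgeless_graph C'.G C'.B \<nu>' C'.k (C'.orientation_sign ori')"
    by (rule C'.bridgeless_graph[OF nonsep' C'.halves_orientation[OF ori']])
  show "support_iso_axioms C.G C.B \<nu> C.k (C.orientation_sign ori) C'.G C'.B \<nu>' C'.k (C'.orientation_sign ori') \<epsilon>"
  proof (rule support_iso_axioms.intro)
    show "bij_betw \<epsilon> (gedges C.G) (gedges C'.G)" unfolding C.gedges_G C'.gedges_G by (rule \<epsilon>)
    have "inj_on \<epsilon> (singular_points X)" using \<epsilon> by (simp add: bij_betw_def)
    then have "Poly_Mapping.keys (pushforward \<epsilon> c) = \<epsilon> ` Poly_Mapping.keys c" if "c \<in> H1 Xn X \<nu> ori" for c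
      using keys_pushforward C.H1_keys[OF that] by blast
    then show "half_edge_graph.flow_supports C'.G C'.B \<nu>' C'.k (C'.orientation_sign ori') =
        (image \<epsilon>) ` half_edge_graph.flow_supports C.G C.B \<nu> C.k (C.orientation_sign ori)"
      unfolding C.flow_supports_eq[OF ori] C'.flow_supports_eq[OF ori'] H[symmetric] image_image
      by (rule image_cong[OF refl])
  qed
qed

lemma fibre_half_edges: "S \<subseteq> singular_points X \<Longrightarrow> fibre Xn \<nu> S = {q\<in>C.B. \<nu> q \<in> S}"
  by (auto simp: fibre_def)

lemma T_imp_C1:
  assumes "T_equivalent Xn X \<nu> Xn' X' \<nu>'"
  shows "C1_equivalent Xn X \<nu> Xn' X' \<nu>'"
proof -
  obtain \<phi> \<epsilon> where iso: "isomorphism Xn Xn' \<phi>"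
    and cyc: "cyclic_bijection C.G C'.G \<epsilon>"
    and all: "\<And>ori. orientation Xn X \<nu> ori \<Longrightarrow> \<exists>ori' \<alpha>. orientation Xn' X' \<nu>' ori' \<and>
             \<alpha> \<in> connected_components_of (zariski Xn) \<rightarrow> {1, -1} \<and>
             pushforward \<epsilon> ` H1 Xn X \<nu> ori = H1 Xn' X' \<nu>' ori' \<and>
             (\<forall>z \<in> H1 Xn X \<nu> ori.
                eta ori' (pushforward \<epsilon> z) = pushforward \<phi> (sign_action Xn \<alpha> (eta ori z)))"
    using assms unfolding T_equivalent_def by (elim exE conjE) (rule that, assumption, assumption, elim allE impE, assumption)
  obtain ori where ori: "orientation Xn X \<nu> ori" using C.ex_orientation by (rule exE)
  obtain ori' \<alpha> where ori': "orientation Xn' X' \<nu>' ori'"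
    and \<alpha>: "\<alpha> \<in> connected_components_of (zariski Xn) \<rightarrow> {1, -1}"
    and H: "pushforward \<epsilon> ` H1 Xn X \<nu> ori = H1 Xn' X' \<nu>' ori'"
    and eta: "\<And>z. z \<in> H1 Xn X \<nu> ori \<Longrightarrow>
                eta ori' (pushforward \<epsilon> z) = pushforward \<phi> (sign_action Xn \<alpha> (eta ori z))"
    using all[OF ori] by (elim exE conjE) (rule that, assumption, assumption, assumption, erule bspec)
  have \<epsilon>X: "bij_betw \<epsilon> (singular_points X) (singular_points X')"
    using cyc by (simp add: cyclic_bijection_def C.gedges_G C'.gedges_G)
  interpret support_iso C.G C.B \<nu> C.k "C.orientation_sign ori" C'.G C'.B \<nu>' C'.k "C'.orientation_sign ori'" \<epsilon>
    by (rule support_iso[OF ori ori' \<epsilon>X H])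
  have hom: "homeomorphic_map (zariski Xn) (zariski Xn') \<phi>" using iso by (simp add: isomorphism_def)
  have inj: "inj_on \<phi> (points Xn)" by (rule homeomorphic_imp_injective_map[OF hom])
  have sub: "C.B \<subseteq> points Xn" by blast
  have \<phi>D: "\<phi> ` {q\<in>C.B. \<nu> q \<in> D} = {q\<in>C'.B. \<nu>' q \<in> \<epsilon> ` D}" if D: "D \<in> G.flow_supports" for D
  proof -
    obtain c where c: "D = Poly_Mapping.keys c" "c \<in> H1 Xn X \<nu> ori"
      using D unfolding C.flow_supports_eq[OF ori] by (rule imageE)
    note kc = C.H1_keys[OF c(2)]
    have "pushforward \<epsilon> c \<in> H1 Xn' X' \<nu>' ori'" unfolding H[symmetric] using c(2) by (rule imageI)
    then have kc': "Poly_Mapping.keys (pushforward \<epsilon> c) \<subseteq> singular_points X'" by (rule C'.H1_keys)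
    have "inj_on \<epsilon> (singular_points X)" using \<epsilon>X by (simp add: bij_betw_def)
    then have k\<epsilon>: "Poly_Mapping.keys (pushforward \<epsilon> c) = \<epsilon> ` D" unfolding c(1) using kc by (rule keys_pushforward)
    have ke: "Poly_Mapping.keys (eta ori c) = {q\<in>C.B. \<nu> q \<in> D}" unfolding c(1) by (rule C.keys_eta[OF ori kc])
    \<comment> \<open>The signs are nonzero on components through points of \<open>Xn\<close>, and
      other coefficients of \<eta> are zero anyway; so the action of \<alpha> does not change the
      support.\<close>
    have ks: "Poly_Mapping.keys (sign_action Xn \<alpha> (eta ori c)) = {q\<in>C.B. \<nu> q \<in> D}"
    proof -
      have "Poly_Mapping.lookup (sign_action Xn \<alpha> (eta ori c)) q = 0 \<longleftrightarrow> Poly_Mapping.lookup (eta ori c) q = 0" for q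
      proof (cases "q \<in> points Xn")
        case True
        then have "\<alpha> (C.cc q) \<in> {1, -1}"
          by (intro funcset_mem[OF \<alpha>]) (simp add: connected_component_in_connected_components_of)
        then have "\<alpha> (C.cc q) \<noteq> 0" by auto
        then show ?thesis by (simp add: lookup_sign_action)
      next
        case False
        then have "Poly_Mapping.lookup (eta ori c) q = 0" by (simp add: C.lookup_eta[OF ori kc])
        then show ?thesis by (simp add: lookup_sign_action)
      qed
      then have "Poly_Mapping.keys (sign_action Xn \<alpha> (eta ori c)) = Poly_Mapping.keys (eta ori c)"
        by (simp add: set_eq_iff in_keys_iff)
      then show ?thesis using ke by simp
    qed
    have "{q\<in>C'.B. \<nu>' q \<in> \<epsilon> ` D} = Poly_Mapping.keys (eta ori' (pushforward \<epsilon> c))"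
      unfolding C'.keys_eta[OF ori' kc'] k\<epsilon> ..
    also have "\<dots> = Poly_Mapping.keys (pushforward \<phi> (sign_action Xn \<alpha> (eta ori c)))" unfolding eta[OF c(2)] ..
    also have "\<dots> = \<phi> ` {q\<in>C.B. \<nu> q \<in> D}"
      using keys_pushforward[OF inj, of "sign_action Xn \<alpha> (eta ori c)"] unfolding ks by blast
    finally show ?thesis by (rule sym)
  qed
  have C1: "C1_sets Xn X \<nu> = G.C1" "C1_sets Xn' X' \<nu>' = G'.C1" by (rule C.C1_sets_eq, rule C'.C1_sets_eq)
  have "\<phi> ` fibre Xn \<nu> S = fibre Xn' \<nu>' (\<epsilon> ` S)" if S: "S \<in> G.C1" for S
  proof -
    have SX: "S \<subseteq> singular_points X" using G.C1_sub[OF S] by (simp add: C.gedges_G)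
    then have "\<epsilon> ` S \<subseteq> singular_points X'" using \<epsilon>X unfolding bij_betw_def by blast
    then have f': "fibre Xn' \<nu>' (\<epsilon> ` S) = {q\<in>C'.B. \<nu>' q \<in> \<epsilon> ` S}" by (auto simp: fibre_def)
    show ?thesis unfolding fibre_half_edges[OF SX] f' by (rule C1_half_edge_image[OF inj sub \<phi>D S])
  qed
  then show ?thesis unfolding C1_equivalent_def C1 using iso bij_C1 by blast
qed

lemma C1_imp_T:
  assumes "C1_equivalent Xn X \<nu> Xn' X' \<nu>'"
  shows "T_equivalent Xn X \<nu> Xn' X' \<nu>'"
proof -
  obtain \<phi> \<sigma> where iso: "isomorphism Xn Xn' \<phi>"
    and \<sigma>: "bij_betw \<sigma> (C1_sets Xn X \<nu>) (C1_sets Xn' X' \<nu>')"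
    and \<phi>\<sigma>: "\<And>S. S \<in> C1_sets Xn X \<nu> \<Longrightarrow> \<phi> ` fibre Xn \<nu> S = fibre Xn' \<nu>' (\<sigma> S)"
    using assms unfolding C1_equivalent_def by (elim exE conjE) (rule that, assumption, assumption, erule bspec)
  obtain ori0 where ori0: "orientation Xn X \<nu> ori0" using C.ex_orientation by (rule exE)
  obtain ori0' where ori0': "orientation Xn' X' \<nu>' ori0'" using C'.ex_orientation by (rule exE)
  interpret G: bridgeless_graph C.G C.B \<nu> C.k "C.orientation_sign ori0"
    by (rule C.bridgeless_graph[OF nonsep C.halves_orientation[OF ori0]])
  interpret G': bridgeless_graph C'.G C'.B \<nu>' C'.k "C'.orientation_sign ori0'"
    by (rule C'.bridgeless_graph[OF nonsep' C'.halves_orientation[OF ori0']])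
  note C1 = C.C1_sets_eq C'.C1_sets_eq
  have \<sigma>: "bij_betw \<sigma> G.C1 G'.C1" using \<sigma> unfolding C1 .
  have hom: "homeomorphic_map (zariski Xn) (zariski Xn') \<phi>" using iso by (simp add: isomorphism_def)
  have inj: "inj_on \<phi> (points Xn)" by (rule homeomorphic_imp_injective_map[OF hom])
  have sur: "\<phi> ` points Xn = points Xn'" by (rule homeomorphic_imp_surjective_map[OF hom])
  have sing: "\<Union>G.C1 = singular_points X" "\<Union>G'.C1 = singular_points X'"
    using G.C1_sub G.C1_cover G'.C1_sub G'.C1_cover unfolding C.gedges_G C'.gedges_G by blast+
  have \<phi>S: "\<phi> ` {q\<in>C.B. \<nu> q \<in> S} = {q\<in>C'.B. \<nu>' q \<in> \<sigma> S}" if S: "S \<in> G.C1" for S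
  proof -
    have "S \<subseteq> singular_points X" using sing(1) S by blast
    then have 1: "fibre Xn \<nu> S = {q\<in>C.B. \<nu> q \<in> S}" by (rule fibre_half_edges)
    have "\<sigma> S \<in> G'.C1" using \<sigma> S by (rule bij_betwE[rule_format])
    then have "\<sigma> S \<subseteq> singular_points X'" using sing(2) by blast
    then have 2: "fibre Xn' \<nu>' (\<sigma> S) = {q\<in>C'.B. \<nu>' q \<in> \<sigma> S}" by (auto simp: fibre_def)
    show ?thesis using \<phi>\<sigma>[unfolded C1, OF S] unfolding 1 2 .
  qed
  have \<phi>mem: "\<nu>' (\<phi> q) \<in> \<sigma> S \<longleftrightarrow> \<nu> q \<in> S" if S: "S \<in> G.C1" and q: "q \<in> C.B" for S q
  proof -
    have "\<phi> q \<in> \<phi> ` {q\<in>C.B. \<nu> q \<in> S} \<longleftrightarrow> \<nu> q \<in> S"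
      using inj_on_image_mem_iff[OF inj, of q "{q\<in>C.B. \<nu> q \<in> S}"] q by blast
    moreover have "\<phi> q \<in> points Xn'" using sur q by blast
    moreover have "\<sigma> S \<subseteq> singular_points X'" using bij_betwE[OF \<sigma>] S sing(2) by blast
    ultimately show ?thesis unfolding \<phi>S[OF S] by blast
  qed
  have \<phi>B: "bij_betw \<phi> C.B C'.B"
  proof -
    have "C.B = (\<Union>S\<in>G.C1. {q\<in>C.B. \<nu> q \<in> S})" using sing(1) by blast
    then have "\<phi> ` C.B = (\<Union>S\<in>G.C1. \<phi> ` {q\<in>C.B. \<nu> q \<in> S})" by (metis image_UN)
    also have "\<dots> = (\<Union>S\<in>G.C1. {q\<in>C'.B. \<nu>' q \<in> \<sigma> S})" using \<phi>S by simp
    also have "\<dots> = (\<Union>S'\<in>\<sigma> ` G.C1. {q\<in>C'.B. \<nu>' q \<in> S'})" by simp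
    also have "\<dots> = (\<Union>S'\<in>G'.C1. {q\<in>C'.B. \<nu>' q \<in> S'})" using bij_betw_imp_surj_on[OF \<sigma>] by simp
    also have "\<dots> = C'.B" using sing(2) by blast
    finally have "\<phi> ` C.B = C'.B" .
    moreover have "inj_on \<phi> C.B" by (rule inj_on_subset[OF inj]) blast
    ultimately show ?thesis by (simp add: bij_betw_def)
  qed
  have \<phi>k: "C'.k (\<phi> q) = C'.k (\<phi> r) \<longleftrightarrow> C.k q = C.k r" if "q \<in> C.B" "r \<in> C.B" for q r
  proof -
    have P: "q \<in> points Xn" "r \<in> points Xn" using that by blast+
    then have P': "\<phi> q \<in> points Xn'" "\<phi> r \<in> points Xn'" using sur by blast+
    have "C'.cc (\<phi> q) = C'.cc (\<phi> r) \<longleftrightarrow> \<phi> ` C.cc q = \<phi> ` C.cc r"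
      unfolding homeomorphic_map_connected_component_of[OF hom P(1)] homeomorphic_map_connected_component_of[OF hom P(2)] ..
    also have "\<dots> \<longleftrightarrow> C.cc q = C.cc r" by (rule inj_on_image_eq_iff[OF inj C.cc_sub C.cc_sub])
    finally show ?thesis unfolding C.k_eq_iff[OF P] C'.k_eq_iff[OF P'] .
  qed
  \<comment> \<open>The map \<phi> matches the half-edges over \<open>S\<close> with those over
    \<open>\<sigma> S\<close>, and each side has two half-edges per node; so the two sets have the
    same size.\<close>
  have ex: "\<exists>b. bij_betw b S (\<sigma> S)" if S: "S \<in> G.C1" for S
  proof -
    have S': "\<sigma> S \<in> G'.C1" using bij_betwE[OF \<sigma>] S by blast
    have sub: "S \<subseteq> \<nu> ` C.B" "\<sigma> S \<subseteq> \<nu>' ` C'.B"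
      using sing S S' unfolding C.image_B C'.image_B by blast+
    have "card {q\<in>C'.B. \<nu>' q \<in> \<sigma> S} = card {q\<in>C.B. \<nu> q \<in> S}"
      unfolding \<phi>S[OF S, symmetric] by (rule card_image) (rule inj_on_subset[OF inj], blast)
    then have "card S = card (\<sigma> S)"
      using card_half_edges[OF G.hv sub(1)] card_half_edges[OF G'.hv sub(2)] by simp
    moreover have "finite S" "finite (\<sigma> S)"
      using sub C.finite_B C'.finite_B by (meson finite_imageI finite_subset)+
    ultimately show ?thesis using finite_same_card_bij by blast
  qed
  \<comment> \<open>T-equivalence asks for one \<epsilon> before an orientation of \<open>X\<close>
    is given, so it is glued here from bijections of the C1-sets; only \<open>ori'\<close> and
    \<alpha> will depend on \<open>ori\<close>.\<close>
  obtain \<epsilon> where \<epsilon>: "bij_betw \<epsilon> (\<Union>G.C1) (\<Union>G'.C1)" "\<And>S. S \<in> G.C1 \<Longrightarrow> \<epsilon> ` S = \<sigma> S"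
    by (rule union_of_bijections[where \<S>=G.C1 and \<S>'=G'.C1 and \<sigma>=\<sigma>, OF G.C1_disjoint G'.C1_disjoint \<sigma> ex]) (assumption | rule that)+
  have \<epsilon>X: "bij_betw \<epsilon> (singular_points X) (singular_points X')" using \<epsilon>(1) unfolding sing .
  have inj\<epsilon>: "inj_on \<epsilon> (singular_points X)" using \<epsilon>X by (simp add: bij_betw_def)
  have main: "\<exists>ori' \<alpha>. orientation Xn' X' \<nu>' ori' \<and>
             \<alpha> \<in> connected_components_of (zariski Xn) \<rightarrow> {1, -1} \<and>
             pushforward \<epsilon> ` H1 Xn X \<nu> ori = H1 Xn' X' \<nu>' ori' \<and>
             (\<forall>z \<in> H1 Xn X \<nu> ori.
                eta ori' (pushforward \<epsilon> z) = pushforward \<phi> (sign_action Xn \<alpha> (eta ori z)))"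
    if ori: "orientation Xn X \<nu> ori" for ori
  proof -
    interpret H: bridgeless_graph C.G C.B \<nu> C.k "C.orientation_sign ori"
      by (rule C.bridgeless_graph[OF nonsep C.halves_orientation[OF ori]])
    interpret P: C1_pair C.G C.B \<nu> C.k "C.orientation_sign ori" C'.G C'.B \<nu>' C'.k "C'.orientation_sign ori0'" \<phi> \<sigma> \<epsilon>
    proof (rule C1_pair.intro[OF H.bridgeless_graph_axioms G'.bridgeless_graph_axioms C1_pair_axioms.intro])
      show "bij_betw \<phi> C.B C'.B" by (rule \<phi>B)
      show "bij_betw \<sigma> G.C1 G'.C1" by (rule \<sigma>)
      show "bij_betw \<epsilon> (gedges C.G) (gedges C'.G)" unfolding C.gedges_G C'.gedges_G by (rule \<epsilon>X)
    qed (fact \<phi>k, fact \<phi>mem, fact \<epsilon>(2))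
    obtain s' \<alpha>' where \<alpha>': "\<And>v. \<bar>\<alpha>' v\<bar> = (1::int)" and s': "halves C'.B \<nu>' s'"
      and key: "\<And>z z' q. H.flow z \<or> half_edge_graph.flow C'.G C'.B \<nu>' C'.k s' z' \<Longrightarrow>
        (\<And>e. e \<in> gedges C.G \<Longrightarrow> z' (\<epsilon> e) = z e) \<Longrightarrow> q \<in> C.B \<Longrightarrow>
        s' (\<phi> q) * z' (\<nu>' (\<phi> q)) = \<alpha>' (C.k q) * (C.orientation_sign ori q * z (\<nu> q))"
    proof (rule P.eta_correspondence)
      fix s' \<alpha>'
      assume "\<And>v. \<bar>\<alpha>' v\<bar> = (1::int)" "halves C'.B \<nu>' s'"
        "\<And>z z' q. H.flow z \<or> half_edge_graph.flow C'.G C'.B \<nu>' C'.k s' z' \<Longrightarrow>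
          (\<And>e. e \<in> gedges C.G \<Longrightarrow> z' (\<epsilon> e) = z e) \<Longrightarrow> q \<in> C.B \<Longrightarrow>
          s' (\<phi> q) * z' (\<nu>' (\<phi> q)) = \<alpha>' (C.k q) * (C.orientation_sign ori q * z (\<nu> q))"
      then show ?thesis by (rule that[of \<alpha>' s'])
    qed
    obtain ori' where ori': "orientation Xn' X' \<nu>' ori'" "\<And>q. q \<in> C'.B \<Longrightarrow> C'.orientation_sign ori' q = s' q"
      by (rule C'.orientation_of_halves[OF s'], rule that, assumption)
    have flow': "half_edge_graph.flow C'.G C'.B \<nu>' C'.k s' z' \<longleftrightarrow>
        half_edge_graph.flow C'.G C'.B \<nu>' C'.k (C'.orientation_sign ori') z'" for z'
    proof -
      have "pairing C'.B \<nu>' s' C'.k z' g = pairing C'.B \<nu>' (C'.orientation_sign ori') C'.k z' g" for g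
        unfolding pairing_def by (rule sum.cong) (simp_all only: ori'(2))
      then show ?thesis
        unfolding half_edge_graph.flow_def[OF C'.half_edge_graph[OF s']]
          half_edge_graph.flow_def[OF C'.half_edge_graph[OF C'.halves_orientation[OF ori'(1)]]] by simp
    qed
    \<comment> \<open>A translation of indices: \<open>\<alpha>'\<close> is indexed by vertices,
      which are images under \<nu> of the connected components of \<open>Xn\<close>.\<close>
    define \<alpha> where "\<alpha> = (\<lambda>Z. \<alpha>' (\<nu> ` Z))"
    have \<alpha>: "\<alpha> \<in> connected_components_of (zariski Xn) \<rightarrow> {1, -1}"
    proof
      fix Z
      show "\<alpha> Z \<in> {1, -1}" using \<alpha>'[of "\<nu> ` Z"] by (auto simp: \<alpha>_def abs_if split: if_splits)
    qed
    have \<alpha>k: "\<alpha> (C.cc q) = \<alpha>' (C.k q)" for q by (simp add: \<alpha>_def branch_component_def)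
    \<comment> \<open>If either chain is a flow, \<open>key\<close> applies and
      \<open>flow_correspondence\<close> shows that the other is one too; if neither is, there is
      nothing to show.\<close>
    have flow_iff: "c \<in> H1 Xn X \<nu> ori \<longleftrightarrow> c' \<in> H1 Xn' X' \<nu>' ori'"
      if c: "Poly_Mapping.keys c \<subseteq> singular_points X" and c': "Poly_Mapping.keys c' \<subseteq> singular_points X'"
        and cc': "\<And>e. e \<in> singular_points X \<Longrightarrow> Poly_Mapping.lookup c' (\<epsilon> e) = Poly_Mapping.lookup c e" for c c'
    proof -
      let ?z = "Poly_Mapping.lookup c" and ?z' = "Poly_Mapping.lookup c'"
      have iff: "(\<forall>g. pairing C.B \<nu> (C.orientation_sign ori) C.k ?z g = 0) \<longleftrightarrow> (\<forall>g. pairing C'.B \<nu>' s' C'.k ?z' g = 0)"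
        if "H.flow ?z \<or> half_edge_graph.flow C'.G C'.B \<nu>' C'.k s' ?z'"
        by (rule P.flow_correspondence[OF \<alpha>'], rule key[OF that]) (simp_all add: cc' C.gedges_G)
      have f: "H.flow ?z \<longleftrightarrow> (\<forall>g. pairing C.B \<nu> (C.orientation_sign ori) C.k ?z g = 0)"
        using c by (simp add: H.flow_def supp_lookup C.gedges_G)
      have f': "half_edge_graph.flow C'.G C'.B \<nu>' C'.k s' ?z' \<longleftrightarrow> (\<forall>g. pairing C'.B \<nu>' s' C'.k ?z' g = 0)"
        using c' by (simp add: half_edge_graph.flow_def[OF C'.half_edge_graph[OF s']] supp_lookup C'.gedges_G)
      have "H.flow ?z \<longleftrightarrow> half_edge_graph.flow C'.G C'.B \<nu>' C'.k s' ?z'"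
        using iff f f' by argo
      then show ?thesis unfolding C.H1_iff[OF ori] C'.H1_iff[OF ori'(1)] flow'[symmetric] .
    qed
    have push: "Poly_Mapping.keys (pushforward \<epsilon> c) \<subseteq> singular_points X'"
      "\<And>e. e \<in> singular_points X \<Longrightarrow> Poly_Mapping.lookup (pushforward \<epsilon> c) (\<epsilon> e) = Poly_Mapping.lookup c e"
      if c: "Poly_Mapping.keys c \<subseteq> singular_points X" for c
    proof -
      show "Poly_Mapping.keys (pushforward \<epsilon> c) \<subseteq> singular_points X'"
        unfolding keys_pushforward[OF inj\<epsilon> c] using \<epsilon>X c unfolding bij_betw_def by blast
      show "Poly_Mapping.lookup (pushforward \<epsilon> c) (\<epsilon> e) = Poly_Mapping.lookup c e" if "e \<in> singular_points X" for e
        by (rule lookup_pushforward[OF inj\<epsilon> c that])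
    qed
    have H: "pushforward \<epsilon> ` H1 Xn X \<nu> ori = H1 Xn' X' \<nu>' ori'"
    proof (intro equalityI subsetI)
      fix c' assume "c' \<in> pushforward \<epsilon> ` H1 Xn X \<nu> ori"
      then obtain c where c: "c' = pushforward \<epsilon> c" "c \<in> H1 Xn X \<nu> ori" by (rule imageE)
      note kc = C.H1_keys[OF c(2)]
      show "c' \<in> H1 Xn' X' \<nu>' ori'" unfolding c(1) using flow_iff[OF kc push[OF kc]] c(2) by (rule iffD1)
    next
      fix c' assume c': "c' \<in> H1 Xn' X' \<nu>' ori'"
      note kc' = C'.H1_keys[OF c']
      \<comment> \<open>The only candidate for a preimage of \<open>c'\<close>: its coefficients
        pulled back along \<epsilon>, and 0 off the nodes to keep the support finite.\<close>
      define z where "z = (\<lambda>e. if e \<in> singular_points X then Poly_Mapping.lookup c' (\<epsilon> e) else 0)"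
      have "finite (supp z)" by (rule finite_subset[OF _ C.finite_singular]) (auto simp: supp_def z_def split: if_splits)
      then obtain c where c: "Poly_Mapping.lookup c = z" using finite_supp_lookup by blast
      have kc: "Poly_Mapping.keys c \<subseteq> singular_points X"
        unfolding supp_lookup[symmetric] c by (auto simp: supp_def z_def split: if_splits)
      have "c \<in> H1 Xn X \<nu> ori" using flow_iff[OF kc kc'] c' by (simp add: c z_def)
      moreover have "c' = pushforward \<epsilon> c"
      proof (rule poly_mapping_eqI)
        fix y
        show "Poly_Mapping.lookup c' y = Poly_Mapping.lookup (pushforward \<epsilon> c) y"
        proof (cases "y \<in> singular_points X'")
          case True
          then have "y \<in> \<epsilon> ` singular_points X" using \<epsilon>X by (simp add: bij_betw_def)
          then obtain e where e: "y = \<epsilon> e" "e \<in> singular_points X" by (rule imageE)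
          show ?thesis unfolding e(1) push(2)[OF kc e(2)] c using e(2) by (simp add: z_def)
        next
          case False
          then have "y \<notin> Poly_Mapping.keys c'" "y \<notin> Poly_Mapping.keys (pushforward \<epsilon> c)"
            using kc' push(1)[OF kc] by blast+
          then show ?thesis by (simp add: in_keys_iff)
        qed
      qed
      ultimately show "c' \<in> pushforward \<epsilon> ` H1 Xn X \<nu> ori" by (rule rev_image_eqI)
    qed
    have eta: "eta ori' (pushforward \<epsilon> c) = pushforward \<phi> (sign_action Xn \<alpha> (eta ori c))" if c: "c \<in> H1 Xn X \<nu> ori" for c
    proof (rule poly_mapping_eqI)
      fix y
      note kc = C.H1_keys[OF c]
      note kc' = push(1)[OF kc]
      have flow: "H.flow (Poly_Mapping.lookup c)" using c C.H1_iff[OF ori] by blast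
      have ks: "Poly_Mapping.keys (sign_action Xn \<alpha> (eta ori c)) \<subseteq> C.B"
      proof
        fix q assume "q \<in> Poly_Mapping.keys (sign_action Xn \<alpha> (eta ori c))"
        then show "q \<in> C.B" using C.lookup_eta[OF ori kc, of q] by (auto simp: in_keys_iff lookup_sign_action split: if_splits)
      qed
      show "Poly_Mapping.lookup (eta ori' (pushforward \<epsilon> c)) y =
          Poly_Mapping.lookup (pushforward \<phi> (sign_action Xn \<alpha> (eta ori c))) y"
      proof (cases "y \<in> C'.B")
        case True
        then have "y \<in> \<phi> ` C.B" using \<phi>B by (simp add: bij_betw_def)
        then obtain q where q: "y = \<phi> q" "q \<in> C.B" by (rule imageE)
        have "Poly_Mapping.lookup (eta ori' (pushforward \<epsilon> c)) y =
            s' (\<phi> q) * Poly_Mapping.lookup (pushforward \<epsilon> c) (\<nu>' (\<phi> q))"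
          unfolding q(1) C'.lookup_eta[OF ori'(1) kc'] if_P[OF True[unfolded q(1)]] ori'(2)[OF True[unfolded q(1)]] ..
        also have "\<dots> = \<alpha>' (C.k q) * (C.orientation_sign ori q * Poly_Mapping.lookup c (\<nu> q))"
          by (rule key[OF disjI1[OF flow] _ q(2)]) (simp add: push(2)[OF kc] C.gedges_G)
        also have "\<dots> = Poly_Mapping.lookup (sign_action Xn \<alpha> (eta ori c)) q"
          unfolding lookup_sign_action C.lookup_eta[OF ori kc] if_P[OF q(2)] \<alpha>k ..
        also have "\<dots> = Poly_Mapping.lookup (pushforward \<phi> (sign_action Xn \<alpha> (eta ori c))) y"
          unfolding q(1) by (rule lookup_pushforward[symmetric, OF bij_betw_imp_inj_on[OF \<phi>B] ks q(2)])
        finally show ?thesis .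
      next
        case False
        have "y \<notin> \<phi> ` Poly_Mapping.keys (sign_action Xn \<alpha> (eta ori c))"
          using ks bij_betw_imp_surj_on[OF \<phi>B] False by blast
        then have "Poly_Mapping.lookup (pushforward \<phi> (sign_action Xn \<alpha> (eta ori c))) y = 0"
          by (rule lookup_pushforward_0)
        then show ?thesis unfolding C'.lookup_eta[OF ori'(1) kc'] if_not_P[OF False] by simp
      qed
    qed
    show ?thesis using ori'(1) \<alpha> H eta by blast
  qed
  \<comment> \<open>For a single orientation the equality of homology groups already says that
    \<epsilon> preserves flow supports, and with them the cycles.\<close>
  obtain ori' where "orientation Xn' X' \<nu>' ori'" "pushforward \<epsilon> ` H1 Xn X \<nu> ori0 = H1 Xn' X' \<nu>' ori'"
    using main[OF ori0] by (elim exE conjE) (rule that)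
  then have "cyclic_bijection C.G C'.G \<epsilon>" by (rule support_iso.cyclic[OF support_iso[OF ori0 _ \<epsilon>X]])
  then show ?thesis unfolding T_equivalent_def using iso main by blast
qed

end

theorem proposition3p2p1:
  fixes X Xn X' Xn' :: "('k::alg_closed_field proj_point, 'k) variety"
    and \<nu> \<nu>' :: "'k proj_point \<Rightarrow> 'k proj_point"
  assumes "connected_nodal_curve X Xn \<nu>" and "\<not> (\<exists>n. separating_node X n)"
    and "connected_nodal_curve X' Xn' \<nu>'" and "\<not> (\<exists>n. separating_node X' n)"
  shows "T_equivalent Xn X \<nu> Xn' X' \<nu>' \<longleftrightarrow> C1_equivalent Xn X \<nu> Xn' X' \<nu>'"
proof -
  interpret two_curves X Xn \<nu> X' Xn' \<nu>'
    by unfold_locales (rule assms)+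
  show ?thesis using T_imp_C1 C1_imp_T by blast
qed

end
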